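(* Let $a,b\in\mathbb{C}$ with $a-b\notin\mathbb{Z}$ and, for $q\in(0,1)$, let $$\Phi(a,b;q,x)=\sum_{n\ge0}\frac{(q^a;q)_n(q^b;q)_n}{(q;q)_n}\left(\frac{x}{1-q}\right)^n .$$ Then, when $q\to1^-$, the function $\Phi(a,b;q,x)$ converges to the Borel sum of the confluent hypergeometric series $${}_2F_0(a,b;-;x)=\sum_{n\ge0}\frac{(a)_n(b)_n}{n!}x^n ,$$ uniformly on the compacts of a convenient sector centered at $0$; namely, for $d\in(0,2\pi)$, on the compacts of the sector $\{|\arg x-d|<\pi/2\}$, the Borel sum being the one in the direction $d$: $$\frac1x\int_0^{e^{id}\infty}\left(\sum_{n\ge0}\frac{(a)_n(b)_n}{n!\,n!}\xi^n\right)e^{-\xi/x}\,d\xi ,$$ where the series in the integrand denotes its analytic continuation along the half line $e^{id}\mathbb{R}^+$.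
   Context: $(\alpha;q)_0=1$ and $(\alpha;q)_n=(1-\alpha)(1-q\alpha)\cdots(1-q^{n-1}\alpha)$ for $n\ge1$; $(a)_0=1$ and $(a)_n=a(a+1)\cdots(a+n-1)$ for $n\ge1$. The series $\Phi(a,b;q,x)$ converges near $x=0$ and is identified with its meromorphic continuation.
   Formalization: The sector |arg x − d| < π/2 is taken with arg x in (0,2π), so it is cut at the positive real axis: the poles (1−q)q^(−k) fill that axis as q→1, and beyond it the limit differs from the Borel sum in direction d by a Stokes term (unless the series terminates). *)

theory Defs
  imports "HOL-Complex_Analysis.Complex_Analysis"
begin

definition qpoch :: "complex \<Rightarrow> complex \<Rightarrow> nat \<Rightarrow> complex" where
  "qpoch \<alpha> q n = (\<Prod>k<n. 1 - q ^ k * \<alpha>)"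

definition Phi_fps :: "complex \<Rightarrow> complex \<Rightarrow> real \<Rightarrow> complex fps" where
  "Phi_fps a b q = Abs_fps (\<lambda>n.
     qpoch (of_real q powr a) (of_real q) n * qpoch (of_real q powr b) (of_real q) n /
     qpoch (of_real q) (of_real q) n * (1 / (1 - of_real q)) ^ n)"

(* The meromorphic continuation to the whole plane of the sum of the series near 0.
   Being "nicely" meromorphic fixes the values (0 at poles, the limit elsewhere), so
   that the continuation is unique as a HOL function. *)
definition Phi :: "complex \<Rightarrow> complex \<Rightarrow> real \<Rightarrow> complex \<Rightarrow> complex" where
  "Phi a b q = (THE F. F nicely_meromorphic_on UNIV \<and> F has_fps_expansion Phi_fps a b q)"

definition hyp2F0_fps :: "complex \<Rightarrow> complex \<Rightarrow> complex fps" where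
  "hyp2F0_fps a b = Abs_fps (\<lambda>n. pochhammer a n * pochhammer b n / fact n)"

definition borel_transform :: "complex fps \<Rightarrow> complex fps" where
  "borel_transform F = Abs_fps (\<lambda>n. fps_nth F n / fact n)"

definition half_line :: "real \<Rightarrow> complex set" where
  "half_line d = {of_real t * cis d | t. 0 \<le> t}"

(* The library's analytic_on means holomorphic on an open neighbourhood of the (closed)
   half line, so the chosen function is uniquely determined on the half line itself,
   which is the only place where it is used. *)
definition continuation_along :: "real \<Rightarrow> complex fps \<Rightarrow> complex \<Rightarrow> complex" where
  "continuation_along d G = (SOME g. g analytic_on half_line d \<and> g has_fps_expansion G)"

(* (1/x) times the Laplace integral along the half line of direction d, written with
   the parametrization \<xi> = t e^(i d), d\<xi> = e^(i d) dt, t \<ge> 0. *)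
definition borel_sum :: "real \<Rightarrow> complex fps \<Rightarrow> complex \<Rightarrow> complex" where
  "borel_sum d F x =
     1 / x * (LBINT t:{0..}. continuation_along d (borel_transform F) (of_real t * cis d) *
                exp (- (of_real t * cis d) / x) * cis d)"

(* The argument is the determination in (0, 2 pi).  The positive real axis is excluded:
   the poles (1 - q) q^(-k) of Phi lie on it and fill it up as q tends to 1, and the
   Borel sums on its two sides differ by a Stokes term. *)
definition sector :: "real \<Rightarrow> complex set" where
  "sector d = {x. 0 < Arg2pi x \<and> \<bar>Arg2pi x - d\<bar> < pi / 2}"

end

theory Submission
  imports Defs
begin

text \<open>
  For \<open>Re b > 0\<close>, Heine's transformation writes \<open>\<Phi>(a, b; q, x)\<close> as a quotient of two Jackson
  sums over the nodes \<open>q\<^sup>k / (1 - q)\<close>; by dominated convergence it tends to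
  \<open>\<Gamma>(b)\<^sup>-\<^sup>1 \<integral> s\<^sup>b\<^sup>-\<^sup>1 e\<^sup>-\<^sup>s (1 - x s)\<^sup>-\<^sup>a ds\<close> over the positive half line, for \<open>x\<close> off the positive
  axis. For \<open>0 < Re b < 2\<close>, Euler's integral continues the Borel transform to the plane cut
  along \<open>[1, \<infinity>)\<close>, and its Laplace integral is the same function: on the half line of direction \<open>d\<close>
  this is Fubini's theorem, elsewhere in the sector it follows by analytic continuation.
  The contiguous relation \<open>(a - b) F(a, b) = a F(a + 1, b) - b F(a, b + 1)\<close>, whose coefficients do
  not depend on \<open>x\<close>, has a \<open>q\<close>-analogue for \<open>\<Phi>\<close>; together with the symmetry in \<open>a\<close> and \<open>b\<close> it
  carries the statement to all parameters with \<open>a - b \<notin> \<int>\<close>.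
\<close>

subsection \<open>Integrals depending holomorphically on a parameter\<close>

text \<open>The Borel transform is 2F1(a, b; 1; \<xi>), whose own Euler integral needs 0 < Re b < 1,
  and unit shifts of that open strip miss the lines where Re b is an integer. So 2F1(a, b; 2; \<xi>)
  is represented instead, with Beta parameters b and 2 - b, and the Borel transform is recovered as
  the derivative of \<xi> 2F1(a, b; 2; \<xi>). The strip then has width 2, and unit shifts reach
  every b with positive real part. The contiguous relation is solved in two ways: for F(a, b + 1),
  dividing by b, to raise Re b; for F(a, b), dividing by a - b, to lower the parameters. The second
  division recurs after integer shifts of both parameters, which is where a - b must not be an
  integer. Dominated convergence works along sequences, so convergence is stated for q_n -> 1 and
  x_n -> x simultaneously; since both vary, uniformity on compacts follows by extracting
  subsequences. The majorants must not depend on q: they come from telescoping sums of logarithms,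
  with constants governed by the angle between x and the positive axis.\<close>

lemma has_field_derivative_integral:
  fixes f :: "complex \<Rightarrow> 'a \<Rightarrow> complex"
  assumes r: "r > 0"
    and meas: "\<And>z. z \<in> ball z0 r \<Longrightarrow> f z \<in> borel_measurable M"
    and hol: "\<And>t. t \<in> space M \<Longrightarrow> (\<lambda>z. f z t) holomorphic_on ball z0 r"
    and bound: "\<And>z t. z \<in> ball z0 r \<Longrightarrow> t \<in> space M \<Longrightarrow> norm (f z t) \<le> D t"
    and int: "integrable M D"
  shows "((\<lambda>z. \<integral>t. f z t \<partial>M) has_field_derivative (\<integral>t. deriv (\<lambda>z. f z t) z0 \<partial>M)) (at z0)"
proof -
  \<comment> \<open>Cauchy's inequality on the circle of radius \<open>r/4\<close> around
    \<open>w\<close>, which stays in \<open>ball z0 r\<close> for \<open>w\<close> in the half ball,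
    turns the bound \<open>D\<close> into one for the derivative.\<close>
  have deriv_bound: "norm (deriv (\<lambda>z. f z t) w) \<le> 4 / r * D t"
    if t: "t \<in> space M" and w: "w \<in> ball z0 (r/2)" for t w
  proof -
    have sub: "cball w (r/4) \<subseteq> ball z0 r"
      using w r by (auto simp: subset_iff) (smt (verit) dist_triangle dist_commute field_sum_of_halves)
    have "norm ((deriv ^^ 1) (\<lambda>z. f z t) w) \<le> fact 1 * D t / (r/4) ^ 1"
    proof (rule Cauchy_inequality)
      show "(\<lambda>z. f z t) holomorphic_on ball w (r/4)"
        using hol[OF t] sub ball_subset_cball by (meson holomorphic_on_subset subset_trans)
      show "continuous_on (cball w (r/4)) (\<lambda>z. f z t)"
        using hol[OF t] sub by (meson holomorphic_on_imp_continuous_on holomorphic_on_subset)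
      fix x assume "norm (w - x) = r/4"
      then have "x \<in> cball w (r/4)" by (simp add: dist_norm)
      then show "norm (f x t) \<le> D t" using bound sub t by blast
    qed (use r in auto)
    then show ?thesis by (simp add: field_simps)
  qed
  \<comment> \<open>The mean value inequality makes \<open>4 / r * D\<close> a common majorant of
    all difference quotients at \<open>z0\<close>.\<close>
  have lip: "norm (f z t - f z0 t) \<le> 4 / r * D t * norm (z - z0)"
    if t: "t \<in> space M" and z: "z \<in> ball z0 (r/2)" for t z
  proof (rule field_differentiable_bound[where S = "ball z0 (r/2)" and f' = "deriv (\<lambda>z. f z t)"])
    fix w assume w: "w \<in> ball z0 (r/2)"
    have "w \<in> ball z0 r" using w r by auto
    then have "((\<lambda>z. f z t) has_field_derivative deriv (\<lambda>z. f z t) w) (at w)"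
      using hol[OF t] holomorphic_derivI by blast
    then show "((\<lambda>z. f z t) has_field_derivative deriv (\<lambda>z. f z t) w) (at w within ball z0 (r/2))"
      by (rule has_field_derivative_at_within)
  qed (use deriv_bound t z r in auto)
  have intf: "integrable M (f z)" if "z \<in> ball z0 r" for z
  proof (rule Bochner_Integration.integrable_bound[OF int meas[OF that]])
    show "AE t in M. norm (f z t) \<le> norm (D t)"
      using bound[OF that] by (intro AE_I2) (force intro: order_trans)
  qed
  have z0: "z0 \<in> ball z0 r" using r by simp
  show ?thesis
    unfolding has_field_derivative_iff tendsto_at_iff_sequentially
  proof (intro allI impI)
    fix X :: "nat \<Rightarrow> complex"
    assume X: "\<forall>i. X i \<in> UNIV - {z0}" "X \<longlonglongrightarrow> z0"
    have "\<forall>\<^sub>F i in sequentially. X i \<in> ball z0 (r/2)"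
      using X(2) r by (intro topological_tendstoD) auto
    then obtain N where N: "\<And>i. i \<ge> N \<Longrightarrow> X i \<in> ball z0 (r/2)"
      unfolding eventually_sequentially by blast
    define s where "s i t = (f (X (i + N)) t - f z0 t) / (X (i + N) - z0)" for i t
    have XN: "X (i + N) \<in> ball z0 (r/2)" "X (i + N) \<in> ball z0 r" "X (i + N) \<noteq> z0" for i
      using N[of "i + N"] X(1) r by auto
    have lim: "(\<lambda>i. s i t) \<longlonglongrightarrow> deriv (\<lambda>z. f z t) z0" if t: "t \<in> space M" for t
    proof -
      have "((\<lambda>z. f z t) has_field_derivative deriv (\<lambda>z. f z t) z0) (at z0)"
        using hol[OF t] holomorphic_derivI z0 by blast
      then have "((\<lambda>i. (f (X i) t - f z0 t) / (X i - z0)) \<longlongrightarrow> deriv (\<lambda>z. f z t) z0) sequentially"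
        unfolding has_field_derivative_iff tendsto_at_iff_sequentially using X by (auto simp: o_def)
      from LIMSEQ_ignore_initial_segment[OF this, of N] show ?thesis by (simp add: s_def)
    qed
    have smeas: "s i \<in> borel_measurable M" for i
      unfolding s_def using meas[OF XN(2)] meas[OF z0] by measurable
    have "(\<lambda>i. \<integral>t. s i t \<partial>M) \<longlonglongrightarrow> (\<integral>t. deriv (\<lambda>z. f z t) z0 \<partial>M)"
    proof (rule integral_dominated_convergence[where w = "\<lambda>t. 4 / r * D t"])
      \<comment> \<open>Measurability in \<open>t\<close> is inherited from the difference
        quotients, whose pointwise limit this is.\<close>
      show "(\<lambda>t. deriv (\<lambda>z. f z t) z0) \<in> borel_measurable M"
        by (rule borel_measurable_LIMSEQ_metric[OF smeas lim])
      show "AE t in M. norm (s i t) \<le> 4 / r * D t" for i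
      proof (rule AE_I2)
        fix t assume "t \<in> space M"
        from lip[OF this XN(1)[of i]] XN(3)[of i] show "norm (s i t) \<le> 4 / r * D t"
          by (simp add: s_def norm_divide divide_le_eq)
      qed
    qed (use smeas lim int in auto)
    moreover have "(\<integral>t. s i t \<partial>M)
        = ((\<integral>t. f (X (i + N)) t \<partial>M) - (\<integral>t. f z0 t \<partial>M)) / (X (i + N) - z0)" for i
      unfolding s_def using intf[OF XN(2)] intf[OF z0] by simp
    ultimately have "(\<lambda>i. ((\<integral>t. f (X (i + N)) t \<partial>M) - (\<integral>t. f z0 t \<partial>M)) / (X (i + N) - z0))
        \<longlonglongrightarrow> (\<integral>t. deriv (\<lambda>z. f z t) z0 \<partial>M)" by simp
    then show "((\<lambda>y. ((\<integral>t. f y t \<partial>M) - (\<integral>t. f z0 t \<partial>M)) / (y - z0)) \<circ> X)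
        \<longlonglongrightarrow> (\<integral>t. deriv (\<lambda>z. f z t) z0 \<partial>M)"
      unfolding o_def by (rule LIMSEQ_offset)
  qed
qed

text \<open>A lower bound for \<open>\<bar>1 - w\<bar> / (1 + \<bar>w\<bar>)\<close> on the ray through \<open>x\<close>; away from \<open>0\<close>, where the
  value is meaningless, it vanishes exactly on the positive axis.\<close>
definition ray_gap :: "complex \<Rightarrow> real" where
  "ray_gap x = sqrt ((1 - Re x / norm x) / 2)"

lemma ray_gap_pos: "x \<notin> \<real>\<^sub>\<ge>\<^sub>0 \<Longrightarrow> ray_gap x > 0"
proof -
  assume x: "x \<notin> \<real>\<^sub>\<ge>\<^sub>0"
  then have "x \<noteq> 0" by auto
  have "Re x < norm x"
  proof (rule ccontr)
    assume "\<not> Re x < norm x"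
    then have "Re x = norm x" using complex_Re_le_cmod[of x] by linarith
    then have "(Im x)\<^sup>2 = 0" using cmod_power2[of x] by simp
    then have "Im x = 0" by simp
    moreover have "Re x \<ge> 0" using \<open>Re x = norm x\<close> by simp
    ultimately show False using x by (simp add: complex_nonneg_Reals_iff)
  qed
  then show ?thesis using \<open>x \<noteq> 0\<close> by (simp add: ray_gap_def)
qed

lemma ray_gap_le_1: "ray_gap x \<le> 1"
proof -
  have "- 1 \<le> Re x / norm x"
    using abs_Re_le_cmod[of x] by (cases "x = 0") (auto simp: field_simps)
  then show ?thesis by (simp add: ray_gap_def)
qed

lemma ray_gap_scale: "s > 0 \<Longrightarrow> ray_gap (of_real s * x) = ray_gap x"
  by (simp add: ray_gap_def norm_mult)

lemma isCont_ray_gap: "x \<noteq> 0 \<Longrightarrow> isCont ray_gap x"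
  unfolding ray_gap_def by (intro continuous_intros) auto

text \<open>With c the cosine of the argument of w, the square of |1 - w| equals (1 - c)/2 (1 +
  |w|)^2 + (1 + c)/2 (1 - |w|)^2; dropping the second summand leaves the claim. Thus
  \<open>ray_gap\<close> is the sine of half the angle to the positive axis.\<close>

lemma ray_gap_bound: "ray_gap w * (1 + norm w) \<le> norm (1 - w)"
proof (cases "w = 0")
  case False
  define c where "c = Re w / norm w"
  have c: "Re w = c * norm w" "c \<le> 1" "-1 \<le> c"
    using False complex_Re_le_cmod[of w] abs_Re_le_cmod[of w] by (auto simp: c_def field_simps)
  have "norm (1 - w) ^ 2 = 1 - 2 * Re w + norm w ^ 2"
  proof -
    have "norm (1 - w) ^ 2 = (1 - Re w) ^ 2 + (Im w) ^ 2" "norm w ^ 2 = (Re w) ^ 2 + (Im w) ^ 2"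
      by (simp_all add: cmod_power2)
    then show ?thesis by (simp add: power2_eq_square algebra_simps)
  qed
  also have "\<dots> = (1 - c) / 2 * (1 + norm w) ^ 2 + (1 + c) / 2 * (1 - norm w) ^ 2"
    by (simp add: c(1) power2_eq_square field_simps)
  also have "\<dots> \<ge> (1 - c) / 2 * (1 + norm w) ^ 2" using c by simp
  finally have "(ray_gap w * (1 + norm w)) ^ 2 \<le> norm (1 - w) ^ 2"
    using c(2) by (simp add: ray_gap_def c_def power_mult_distrib)
  then show ?thesis by (rule power2_le_imp_le) simp
qed (simp add: ray_gap_def)

lemma ray_gap_bound_scale:
  assumes "s \<ge> 0"
  shows "ray_gap x * (1 + s * norm x) \<le> norm (1 - of_real s * x)"
proof (cases "s = 0")
  case True then show ?thesis using ray_gap_le_1[of x] by simp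
next
  case False
  with assms show ?thesis using ray_gap_bound[of "of_real s * x"] ray_gap_scale[of s x]
    by (simp add: norm_mult)
qed

text \<open>The modulus is exp(Re a ln|z| - Im a Arg z), where |Arg z| is at most pi and |ln|z|| is
  at most ln(1/c) + ln R. Adding the two logarithms instead of taking their maximum covers both
  signs of Re a at once.\<close>

lemma norm_powr_le:
  assumes "z \<noteq> 0" "c > 0" "c \<le> 1" "R \<ge> 1" "c \<le> norm z" "norm z \<le> R"
  shows "norm (z powr a) \<le> exp (pi * \<bar>Im a\<bar>) * ((1 / c) powr \<bar>Re a\<bar> * R powr \<bar>Re a\<bar>)"
proof -
  have "norm (z powr a) = exp (Re a * ln (norm z) - Im a * Im (Ln z))"
    using assms(1) by (simp add: powr_def)
  also have "\<dots> \<le> exp (pi * \<bar>Im a\<bar> + \<bar>Re a\<bar> * ln (1 / c) + \<bar>Re a\<bar> * ln R)"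
  proof -
    have "- Im a * Im (Ln z) \<le> \<bar>Im a\<bar> * \<bar>Im (Ln z)\<bar>"
      by (metis abs_ge_self abs_minus_cancel abs_mult mult_minus_left)
    also have "\<dots> \<le> \<bar>Im a\<bar> * pi"
      by (intro mult_left_mono) (use mpi_less_Im_Ln[OF assms(1)] Im_Ln_le_pi[OF assms(1)] in auto)
    finally have 1: "- Im a * Im (Ln z) \<le> pi * \<bar>Im a\<bar>" by (simp add: mult.commute)
    have "\<bar>ln (norm z)\<bar> \<le> ln (1 / c) + ln R"
    proof -
      have "ln c \<le> ln (norm z)" "ln (norm z) \<le> ln R" "ln c \<le> 0" "0 \<le> ln R"
        using assms by auto
      then have "\<bar>ln (norm z)\<bar> \<le> ln R - ln c" by linarith
      then show ?thesis using assms by (simp add: ln_div)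
    qed
    then have "\<bar>Re a\<bar> * \<bar>ln (norm z)\<bar> \<le> \<bar>Re a\<bar> * (ln (1 / c) + ln R)"
      by (intro mult_left_mono) auto
    moreover have "Re a * ln (norm z) \<le> \<bar>Re a\<bar> * \<bar>ln (norm z)\<bar>"
      by (metis abs_ge_self abs_mult)
    ultimately have "Re a * ln (norm z) \<le> \<bar>Re a\<bar> * (ln (1 / c) + ln R)"
      by linarith
    with 1 show ?thesis by (simp add: algebra_simps)
  qed
  also have "\<dots> = exp (pi * \<bar>Im a\<bar>) * ((1 / c) powr \<bar>Re a\<bar> * R powr \<bar>Re a\<bar>)"
    using assms by (simp add: powr_def exp_add)
  finally show ?thesis .
qed

subsection \<open>Gamma and Beta weights\<close>

text \<open>The value 0 off the positive axis lets weights live on the whole real line, so that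
  translations and scalings of Lebesgue measure apply without adjusting domains.\<close>

definition cpow :: "complex \<Rightarrow> real \<Rightarrow> complex" where
  "cpow c s = (if 0 < s then exp (c * of_real (ln s)) else 0)"

lemma cpow_eq_powr: "s > 0 \<Longrightarrow> cpow c s = of_real s powr c"
  by (simp add: cpow_def powr_def Ln_of_real)

lemma cpow_nonpos [simp]: "s \<le> 0 \<Longrightarrow> cpow c s = 0"
  by (simp add: cpow_def)

lemma cpow_mult: "s > 0 \<Longrightarrow> t > 0 \<Longrightarrow> cpow c (s * t) = cpow c s * cpow c t"
  by (simp add: cpow_def ln_mult exp_add[symmetric] algebra_simps)

lemma cpow_add: "cpow (c + d) s = cpow c s * cpow d s"
  by (simp add: cpow_def exp_add[symmetric] algebra_simps)

lemma cpow_0: "s > 0 \<Longrightarrow> cpow 0 s = 1"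
  by (simp add: cpow_def)

lemma cpow_of_nat: "s > 0 \<Longrightarrow> cpow (of_nat n) s = of_real s ^ n"
  by (simp add: cpow_eq_powr powr_nat)

lemma norm_cpow: "s > 0 \<Longrightarrow> norm (cpow c s) = s powr Re c"
  by (simp add: cpow_def powr_def)

lemma cpow_measurable [measurable]: "cpow c \<in> borel_measurable borel"
  unfolding cpow_def by measurable

lemma continuous_on_cpow: "continuous_on {0<..} (cpow c)"
proof -
  have "continuous_on {0<..} (\<lambda>s. exp (c * complex_of_real (ln s)))"
    by (intro continuous_intros) auto
  then show ?thesis by (rule continuous_on_eq) (simp add: cpow_def)
qed

lemma Gamma_nonzero:
  fixes z :: complex
  assumes "Re z > 0"
  shows "Gamma z \<noteq> 0"
proof
  assume "Gamma z = 0"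
  then obtain n where "z = - of_nat n"
    by (auto simp: Gamma_eq_zero_iff elim!: nonpos_Ints_cases')
  with assms show False by simp
qed

definition gamma_weight :: "complex \<Rightarrow> real \<Rightarrow> complex" where
  "gamma_weight b s = cpow (b - 1) s * of_real (exp (- s))"

lemma gamma_weight_measurable [measurable]: "gamma_weight b \<in> borel_measurable borel"
  unfolding gamma_weight_def by measurable

lemma gamma_weight_nonpos [simp]: "s \<le> 0 \<Longrightarrow> gamma_weight b s = 0"
  by (simp add: gamma_weight_def)

lemma integrable_cpow_exp:
  assumes "Re b > 0" "c > 0"
  shows "integrable lborel (\<lambda>s. cpow (b - 1) s * of_real (exp (- c * s)))"
proof -
  have "set_integrable lebesgue {0<..} (\<lambda>t. complex_of_real t powr (b - 1) / of_real (exp (c * t)))"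
    using absolutely_integrable_Gamma_integral[OF assms] .
  moreover have "indicator {0<..} s *\<^sub>R (complex_of_real s powr (b - 1) / of_real (exp (c * s)))
      = cpow (b - 1) s * of_real (exp (- c * s))" for s
    by (cases "s > 0") (simp_all add: cpow_eq_powr exp_minus divide_inverse)
  ultimately have "integrable lebesgue (\<lambda>s. cpow (b - 1) s * of_real (exp (- c * s)))"
    by (simp add: set_integrable_def cong: Bochner_Integration.integrable_cong)
  then show ?thesis by (subst (asm) integrable_completion) measurable
qed

lemma gamma_weight_integrable: "Re b > 0 \<Longrightarrow> integrable lborel (gamma_weight b)"
  using integrable_cpow_exp[of b 1] by (simp add: gamma_weight_def[abs_def])

lemma integral_gamma_weight:
  assumes "Re b > 0"
  shows "(\<integral>s. gamma_weight b s \<partial>lborel) = Gamma b"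
proof -
  have "((\<lambda>t. of_real t powr (b - 1) / of_real (exp t)) has_integral Gamma b) {0<..}"
    by (rule Gamma_integral_complex'[OF assms])
  then have "((\<lambda>s. if s \<in> {0<..} then of_real s powr (b - 1) / of_real (exp s) else 0)
      has_integral Gamma b) UNIV"
    by (subst has_integral_restrict_UNIV)
  also have "(\<lambda>s. if s \<in> {0<..} then complex_of_real s powr (b - 1) / of_real (exp s) else 0)
      = gamma_weight b"
    by (auto simp: fun_eq_iff gamma_weight_def cpow_eq_powr exp_minus divide_inverse)
  finally have "(gamma_weight b has_integral Gamma b) UNIV" .
  with has_integral_integral_lborel[OF gamma_weight_integrable[OF assms]]
  show ?thesis by (metis has_integral_unique)
qed

text \<open>Apply ln y <= y - 1 to y = e (1 + R s) for a small factor e, and multiply by M.\<close>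

lemma powr_le_exp:
  fixes R M \<epsilon> :: real
  assumes "R \<ge> 0" "M \<ge> 0" "\<epsilon> > 0"
  obtains K where "K > 0" "\<And>s. s \<ge> 0 \<Longrightarrow> (1 + R * s) powr M \<le> K * exp (\<epsilon> * s)"
proof -
  \<comment> \<open>Chosen so that \<open>e * R * M \<le> \<epsilon>\<close>; the added ones keep
    the denominator positive when \<open>R\<close> or \<open>M\<close> is 0.\<close>
  define e where "e = \<epsilon> / ((R + 1) * (M + 1))"
  have e: "e > 0" using assms by (simp add: e_def)
  have eRM: "e * R * M \<le> \<epsilon>"
  proof -
    have "R * M \<le> (R + 1) * (M + 1)" using assms by (simp add: algebra_simps)
    then have "e * (R * M) \<le> e * ((R + 1) * (M + 1))" using e by (intro mult_left_mono) auto
    also have "\<dots> = \<epsilon>"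
      using assms by (simp add: e_def)
    finally show ?thesis by (simp add: mult_ac)
  qed
  have "(1 + R * s) powr M \<le> exp (M * (e - ln e)) * exp (\<epsilon> * s)" if "s \<ge> 0" for s
  proof -
    have p: "1 + R * s > 0" using assms that by (simp add: add_pos_nonneg)
    have "ln (1 + R * s) = ln (e * (1 + R * s)) - ln e" using p e by (simp add: ln_mult)
    also have "\<dots> \<le> e * (1 + R * s) - 1 - ln e"
      using ln_le_minus_one[of "e * (1 + R * s)"] p e by simp
    also have "\<dots> \<le> e * R * s + (e - ln e)" by (simp add: algebra_simps)
    finally have "M * ln (1 + R * s) \<le> M * (e * R * s + (e - ln e))"
      using assms by (intro mult_left_mono)
    also have "\<dots> \<le> \<epsilon> * s + M * (e - ln e)"
      using mult_right_mono[OF eRM, of s] that by (simp add: algebra_simps)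
    finally show ?thesis using p by (simp add: powr_def exp_add[symmetric] add.commute)
  qed
  then show thesis by (intro that[of "exp (M * (e - ln e))"]) auto
qed

text \<open>Half of the exponential decay absorbs the polynomial factor. This is the shape of every
  majorant used below.\<close>

lemma integrable_power_exp_poly:
  assumes "\<beta> > 0" "c > 0" "R \<ge> 0" "M \<ge> 0"
  shows "integrable lborel (\<lambda>s. norm (cpow (of_real \<beta> - 1) s) * exp (- c * s) * (1 + R * s) powr M)"
proof -
  obtain K where K: "K > 0" and poly: "\<And>s. s \<ge> 0 \<Longrightarrow> (1 + R * s) powr M \<le> K * exp (c / 2 * s)"
    using powr_le_exp[of R M "c / 2"] assms by auto
  show ?thesis
  proof (rule Bochner_Integration.integrable_bound)
    show "integrable lborel (\<lambda>s. K * norm (cpow (of_real \<beta> - 1) s * of_real (exp (- (c / 2) * s))))"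
      by (intro integrable_mult_right integrable_norm integrable_cpow_exp) (use assms in auto)
    show "AE s in lborel. norm (norm (cpow (of_real \<beta> - 1) s) * exp (- c * s) * (1 + R * s) powr M)
       \<le> norm (K * norm (cpow (of_real \<beta> - 1) s * of_real (exp (- (c / 2) * s))))"
    proof (rule AE_I2)
      fix s :: real
      show "norm (norm (cpow (of_real \<beta> - 1) s) * exp (- c * s) * (1 + R * s) powr M)
       \<le> norm (K * norm (cpow (of_real \<beta> - 1) s * of_real (exp (- (c / 2) * s))))"
      proof (cases "s > 0")
        case True
        have "exp (- c * s) * (1 + R * s) powr M \<le> exp (- c * s) * (K * exp (c / 2 * s))"
          using True by (intro mult_left_mono poly) auto
        also have "\<dots> = K * exp (- (c / 2) * s)" by (simp add: exp_add[symmetric] mult_ac)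
        finally have "norm (cpow (of_real \<beta> - 1) s) * (exp (- c * s) * (1 + R * s) powr M)
            \<le> norm (cpow (of_real \<beta> - 1) s) * (K * exp (- (c / 2) * s))"
          by (intro mult_left_mono) auto
        then show ?thesis using K by (simp add: norm_mult mult_ac)
      qed simp
    qed
  qed measurable
qed

text \<open>The normalised Beta density with parameters b and 2 - b; Gamma(2) = 1, so the product of
  the two Gamma values is the whole constant.\<close>

definition beta_weight :: "complex \<Rightarrow> real \<Rightarrow> complex" where
  "beta_weight b t = cpow (b - 1) t * cpow (1 - b) (1 - t) / (Gamma b * Gamma (2 - b))"

lemma beta_weight_measurable [measurable]: "beta_weight b \<in> borel_measurable borel"
  unfolding beta_weight_def by measurable

lemma beta_weight_outside: "t \<notin> {0<..<1} \<Longrightarrow> beta_weight b t = 0"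
  by (auto simp: beta_weight_def not_less)

lemma beta_weight_integrable:
  assumes "0 < Re b" "Re b < 2"
  shows "integrable lborel (beta_weight b)"
proof (rule Bochner_Integration.integrable_bound)
  have "set_integrable lborel {0..1} (\<lambda>t. t powr (Re b - 1) * (1 - t) powr ((2 - Re b) - 1))"
    using assms by (intro integrable_Beta) auto
  then show "integrable lborel (\<lambda>t. indicator {0..1} t *\<^sub>R (t powr (Re b - 1) * (1 - t) powr ((2 - Re b) - 1))
      / norm (Gamma b * Gamma (2 - b)))"
    unfolding set_integrable_def by (rule integrable_divide_zero) 
  show "AE t in lborel. norm (beta_weight b t) \<le> norm (indicator {0..1} t *\<^sub>R
      (t powr (Re b - 1) * (1 - t) powr ((2 - Re b) - 1)) / norm (Gamma b * Gamma (2 - b)))"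
  proof (rule AE_I2)
    fix t :: real
    show "norm (beta_weight b t) \<le> norm (indicator {0..1} t *\<^sub>R
      (t powr (Re b - 1) * (1 - t) powr ((2 - Re b) - 1)) / norm (Gamma b * Gamma (2 - b)))"
    proof (cases "t \<in> {0<..<1}")
      case True
      then show ?thesis by (simp add: beta_weight_def norm_mult norm_divide norm_cpow)
    qed (simp add: beta_weight_outside)
  qed
qed measurable

text \<open>If \<open>t\<close> is Beta distributed with parameters \<open>b\<close>, \<open>2 - b\<close> and \<open>u\<close> is Gamma distributed with
  parameter \<open>2\<close>, then \<open>t u\<close> is Gamma distributed with parameter \<open>b\<close> (here for complex weights).\<close>
lemma beta_gamma_integral:
  assumes b: "0 < Re b" "Re b < 2"
    and \<phi> [measurable]: "\<phi> \<in> borel_measurable borel"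
    and int: "integrable lborel (\<lambda>s. gamma_weight b s * \<phi> s)"
  shows "(\<integral>u. gamma_weight 2 u * (\<integral>t. beta_weight b t * \<phi> (u * t) \<partial>lborel) \<partial>lborel)
    = (\<integral>s. gamma_weight b s * \<phi> s \<partial>lborel) / Gamma b"
proof -
  define A where "A = Gamma b * Gamma (2 - b)"
  have G: "Gamma b \<noteq> 0" "Gamma (2 - b) \<noteq> 0"
    using b by (simp_all add: Gamma_nonzero)
  \<comment> \<open>The joint integrand in s = u t and u. Integrating over u, with u = s + v,
    produces the Gamma weight in s; integrating over s, with s = u t, produces the Beta weight.
    Fubini equates the two.\<close>
  define J where "J s u = \<phi> s * cpow (b - 1) s * cpow (1 - b) (u - s) * of_real (exp (- u)) / A"
    for s u :: real
  have J_meas [measurable]: "case_prod J \<in> borel_measurable (lborel \<Otimes>\<^sub>M lborel)"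
    unfolding J_def by measurable
  have shift: "J s (s + 1 * v) = gamma_weight b s * \<phi> s / A * gamma_weight (2 - b) v" for s v
  proof -
    have "exp (- (s + v)) = exp (- s) * exp (- v)" by (simp add: exp_add[symmetric])
    then show ?thesis by (simp add: J_def gamma_weight_def field_simps)
  qed
  have int2: "integrable lborel (gamma_weight (2 - b))"
    using b by (intro gamma_weight_integrable) auto
  have inner_int: "integrable lborel (J s)" for s
  proof -
    have "integrable lborel (\<lambda>v. J s (s + 1 * v))"
      unfolding shift using int2 by (intro integrable_mult_right)
    then show ?thesis by (subst (asm) lborel_integrable_real_affine_iff) auto
  qed
  have inner: "(\<integral>u. J s u \<partial>lborel) = gamma_weight b s * \<phi> s / Gamma b" for s
  proof -
    have "(\<integral>u. J s u \<partial>lborel) = (\<integral>v. gamma_weight b s * \<phi> s / A * gamma_weight (2 - b) v \<partial>lborel)"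
      by (subst lborel_integral_real_affine[where c = 1 and t = s]) (simp_all only: shift, simp)
    also have "\<dots> = gamma_weight b s * \<phi> s / A * Gamma (2 - b)"
      using integral_gamma_weight[of "2 - b"] b by simp
    finally show ?thesis using G by (simp add: A_def)
  qed
  have inner_norm: "(\<integral>u. norm (J s u) \<partial>lborel)
      = norm (gamma_weight b s * \<phi> s) * ((\<integral>v. norm (gamma_weight (2 - b) v) \<partial>lborel) / norm A)" for s
  proof -
    have "(\<integral>u. norm (J s u) \<partial>lborel) = (\<integral>v. norm (gamma_weight b s * \<phi> s / A * gamma_weight (2 - b) v) \<partial>lborel)"
      by (subst lborel_integral_real_affine[where c = 1 and t = s]) (simp_all only: shift, simp)
    also have "\<dots> = norm (gamma_weight b s * \<phi> s / A) * (\<integral>v. norm (gamma_weight (2 - b) v) \<partial>lborel)"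
      by (simp only: norm_mult[of "gamma_weight b s * \<phi> s / A"] integral_mult_right_zero)
    finally show ?thesis by (simp add: norm_divide)
  qed
  have "integrable (lborel \<Otimes>\<^sub>M lborel) (case_prod J)"
  proof (rule lborel_pair.Fubini_integrable)
    show "integrable lborel (\<lambda>s. \<integral>u. norm (case_prod J (s, u)) \<partial>lborel)"
      using int by (simp add: inner_norm)
  qed (use inner_int in \<open>auto\<close>)
  then have swap: "(\<integral>u. (\<integral>s. J s u \<partial>lborel) \<partial>lborel) = (\<integral>s. (\<integral>u. J s u \<partial>lborel) \<partial>lborel)"
    by (rule lborel_pair.Fubini_integral)
  have outer: "(\<integral>s. J s u \<partial>lborel) = gamma_weight 2 u * (\<integral>t. beta_weight b t * \<phi> (u * t) \<partial>lborel)" for u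
  proof (cases "u > 0")
    case True
    \<comment> \<open>The two powers of u cancel, so only the Jacobian u and exp(-u) remain, which
      is the Gamma weight with parameter 2.\<close>
    have cp: "cpow (b - 1) u * cpow (1 - b) u = 1"
      using True cpow_add[of "b - 1" "1 - b" u] by (simp add: cpow_0)
    have sc: "J (0 + u * t) u = of_real (exp (- u)) * (beta_weight b t * \<phi> (u * t))" for t
    proof (cases "t \<in> {0<..<1}")
      case t: True
      have "cpow (1 - b) (u - u * t) = cpow (1 - b) u * cpow (1 - b) (1 - t)"
        using cpow_mult[of u "1 - t" "1 - b"] True t by (simp add: right_diff_distrib)
      moreover have "cpow (b - 1) (u * t) = cpow (b - 1) u * cpow (b - 1) t"
        using cpow_mult[of u t "b - 1"] True t by simp
      ultimately have "J (0 + u * t) u = (cpow (b - 1) u * cpow (1 - b) u) *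
          (of_real (exp (- u)) * (cpow (b - 1) t * cpow (1 - b) (1 - t) / A * \<phi> (u * t)))"
        by (simp add: J_def mult_ac)
      then show ?thesis by (simp only: cp) (simp add: beta_weight_def A_def)
    next
      case False
      then have "u * t \<le> 0 \<or> u - u * t \<le> 0"
        using True by (auto simp: mult_le_0_iff not_less)
      then show ?thesis using False by (auto simp: J_def beta_weight_outside)
    qed
    have "(\<integral>s. J s u \<partial>lborel) = \<bar>u\<bar> *\<^sub>R (\<integral>t. J (0 + u * t) u \<partial>lborel)"
      using True by (intro lborel_integral_real_affine) simp
    also have "\<dots> = \<bar>u\<bar> *\<^sub>R (\<integral>t. of_real (exp (- u)) * (beta_weight b t * \<phi> (u * t)) \<partial>lborel)"
      by (simp only: sc)
    also have "\<dots> = of_real u * of_real (exp (- u)) * (\<integral>t. beta_weight b t * \<phi> (u * t) \<partial>lborel)"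
      using True by (simp add: scaleR_conv_of_real)
    finally show ?thesis using True by (simp add: gamma_weight_def cpow_eq_powr)
  next
    case False
    then have "J s u = 0" for s
      by (cases "s > 0") (auto simp: J_def)
    then show ?thesis using False by simp
  qed
  show ?thesis using swap unfolding inner outer by simp
qed

subsection \<open>The cut plane and Stieltjes transforms\<close>

text \<open>The plane without [1, \<infinity>), described by \<open>1 - \<xi>\<close> because the
  principal power of that expression is what has to be holomorphic.\<close>

definition cut_plane :: "complex set" where
  "cut_plane = {\<xi>. 1 - \<xi> \<notin> \<real>\<^sub>\<le>\<^sub>0}"

lemma open_cut_plane: "open cut_plane"
proof -
  have "cut_plane = (\<lambda>\<xi>. 1 - \<xi>) -` (- \<real>\<^sub>\<le>\<^sub>0)" by (auto simp: cut_plane_def)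
  moreover have "open ((\<lambda>\<xi>::complex. 1 - \<xi>) -` (- \<real>\<^sub>\<le>\<^sub>0))"
    by (intro open_vimage continuous_intros) (simp add: open_Compl)
  ultimately show ?thesis by simp
qed

lemma cut_plane_iff: "\<xi> \<in> cut_plane \<longleftrightarrow> (Im \<xi> = 0 \<longrightarrow> Re \<xi> < 1)"
  by (auto simp: cut_plane_def complex_nonpos_Reals_iff)

lemma cut_plane_scale:
  assumes "\<xi> \<in> cut_plane" "0 \<le> t" "t \<le> 1"
  shows "of_real t * \<xi> \<in> cut_plane"
proof -
  have "t * Re \<xi> < 1" if "Re \<xi> < 1"
  proof (cases "Re \<xi> \<ge> 0")
    case True
    then have "t * Re \<xi> \<le> 1 * Re \<xi>" using assms by (intro mult_right_mono) auto
    then show ?thesis using that by simp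
  next
    case False
    then have "t * Re \<xi> \<le> 0" using assms by (simp add: mult_nonneg_nonpos)
    then show ?thesis by simp
  qed
  then show ?thesis using assms by (auto simp: cut_plane_iff)
qed

lemma slit_scale: "x \<notin> \<real>\<^sub>\<ge>\<^sub>0 \<Longrightarrow> s \<ge> 0 \<Longrightarrow> of_real s * x \<in> cut_plane"
  by (auto simp: cut_plane_iff complex_nonneg_Reals_iff)
     (smt (verit) mult_nonneg_nonpos mult_nonneg_nonneg)

text \<open>\<open>ray_gap\<close> is constant along a ray, so a single \<open>\<delta>\<close>
  keeps 1 - s x away from 0 for all s; the bound is uniform over all x sharing the same
  \<open>\<delta>\<close> and \<open>R\<close>.\<close>

lemma norm_powr_ray:
  assumes "ray_gap x \<ge> \<delta>" "\<delta> > 0" "norm x \<le> R" "s \<ge> 0"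
  shows "norm ((1 - of_real s * x) powr c)
    \<le> exp (pi * \<bar>Im c\<bar>) * ((1 / \<delta>) powr \<bar>Re c\<bar> * (1 + R * s) powr \<bar>Re c\<bar>)"
proof (rule norm_powr_le)
  have R: "R \<ge> 0" using assms(3) norm_ge_zero order_trans by blast
  have "\<delta> * 1 \<le> ray_gap x * (1 + s * norm x)"
    using assms by (intro mult_mono) auto
  also have "\<dots> \<le> norm (1 - of_real s * x)"
    using assms by (intro ray_gap_bound_scale)
  finally show ge: "\<delta> \<le> norm (1 - of_real s * x)" by simp
  then show "1 - of_real s * x \<noteq> 0" using assms(2) by auto
  show "norm (1 - of_real s * x) \<le> 1 + R * s"
  proof -
    have "norm (1 - of_real s * x) \<le> 1 + s * norm x"
      using norm_triangle_ineq4[of 1 "of_real s * x"] assms by (simp add: norm_mult)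
    also have "\<dots> \<le> 1 + R * s" using mult_left_mono[OF assms(3,4)] by (simp add: mult.commute)
    finally show ?thesis .
  qed
  show "\<delta> \<le> 1" using assms ray_gap_le_1[of x] by simp
  show "1 \<le> 1 + R * s" using R assms by simp
qed (use assms in auto)

text \<open>A generalised Stieltjes transform. The weight is left arbitrary because differentiation
  replaces \<open>W\<close> by t W(t) and \<open>c\<close> by \<open>c - 1\<close>, which stays in
  the family.\<close>

definition stieltjes :: "(real \<Rightarrow> complex) \<Rightarrow> complex \<Rightarrow> complex \<Rightarrow> complex" where
  "stieltjes W c \<xi> = (\<integral>t. W t * (1 - of_real t * \<xi>) powr c \<partial>lborel)"

lemma one_minus_powr_holomorphic: "(\<lambda>v. (1 - v) powr c) holomorphic_on cut_plane"
  by (intro holomorphic_intros) (auto simp: cut_plane_def)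

lemma continuous_on_one_minus_powr:
  assumes "continuous_on S f" "\<And>p. p \<in> S \<Longrightarrow> f p \<in> cut_plane"
  shows "continuous_on S (\<lambda>p. (1 - f p) powr c)"
  by (rule continuous_on_compose2[OF holomorphic_on_imp_continuous_on[OF one_minus_powr_holomorphic]])
    (use assms in auto)

lemma stieltjes_measurable:
  assumes W: "W \<in> borel_measurable lborel" and W0: "\<And>t. t \<notin> {0<..<1} \<Longrightarrow> W t = 0"
    and "\<xi> \<in> cut_plane"
  shows "(\<lambda>t. W t * (1 - of_real t * \<xi>) powr c) \<in> borel_measurable lborel"
proof -
  have "(\<lambda>t. indicator {0<..<1} t *\<^sub>R (1 - of_real t * \<xi>) powr c) \<in> borel_measurable borel"
    using assms(3) by (intro borel_measurable_continuous_on_indicator continuous_on_one_minus_powr continuous_intros)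
      (auto intro: cut_plane_scale)
  then have "(\<lambda>t. W t * (indicator {0<..<1} t *\<^sub>R (1 - of_real t * \<xi>) powr c)) \<in> borel_measurable lborel"
    using W by measurable
  moreover have "W t * (indicator {0<..<1} t *\<^sub>R (1 - of_real t * \<xi>) powr c)
      = W t * (1 - of_real t * \<xi>) powr c" for t
    using W0[of t] by (auto simp: indicator_def)
  ultimately show ?thesis by simp
qed

lemma stieltjes_has_field_derivative:
  assumes W: "integrable lborel W" and W0: "\<And>t. t \<notin> {0<..<1} \<Longrightarrow> W t = 0"
    and \<xi>: "\<xi> \<in> cut_plane"
  shows "(stieltjes W c has_field_derivative - c * stieltjes (\<lambda>t. of_real t * W t) (c - 1) \<xi>) (at \<xi>)"
proof -
  obtain r where r: "r > 0" "cball \<xi> r \<subseteq> cut_plane"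
    using open_cut_plane \<xi> open_contains_cball by blast
  have in_cut: "of_real t * z \<in> cut_plane" if "t \<in> {0..1}" "z \<in> cball \<xi> r" for t z
    using cut_plane_scale r(2) that by auto
  \<comment> \<open>Continuity on the compact product of [0, 1] with a closed ball yields one
    constant \<open>B\<close>, so a multiple of |W| dominates the integrand near
    \<open>\<xi>\<close>.\<close>
  have "compact ((\<lambda>(t, z). (1 - complex_of_real t * z) powr c) ` ({0..1} \<times> cball \<xi> r))"
  proof (rule compact_continuous_image)
    show "continuous_on ({0..1} \<times> cball \<xi> r) (\<lambda>(t, z). (1 - complex_of_real t * z) powr c)"
      unfolding case_prod_beta
      by (intro continuous_on_one_minus_powr continuous_intros) (use in_cut in auto)
  qed (intro compact_Times compact_Icc compact_cball)
  then obtain B where B: "\<And>t z. t \<in> {0..1} \<Longrightarrow> z \<in> cball \<xi> r \<Longrightarrow> norm ((1 - complex_of_real t * z) powr c) \<le> B"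
    by (force simp: bounded_iff dest!: compact_imp_bounded)
  have deriv: "deriv (\<lambda>z. W t * (1 - of_real t * z) powr c) \<xi>
      = - c * (of_real t * W t * (1 - of_real t * \<xi>) powr (c - 1))" for t
  proof (cases "t \<in> {0<..<1}")
    case True
    then have "1 - of_real t * \<xi> \<notin> \<real>\<^sub>\<le>\<^sub>0"
      using in_cut[of t \<xi>] r by (auto simp: cut_plane_def)
    then have "((\<lambda>z. W t * (1 - of_real t * z) powr c) has_field_derivative
        W t * (c * (1 - of_real t * \<xi>) powr (c - 1) * (- of_real t))) (at \<xi>)"
      by (auto intro!: derivative_eq_intros)
    then show ?thesis by (simp add: DERIV_imp_deriv mult_ac)
  qed (simp add: W0)
  have "((\<lambda>z. \<integral>t. W t * (1 - of_real t * z) powr c \<partial>lborel) has_field_derivative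
      (\<integral>t. deriv (\<lambda>z. W t * (1 - of_real t * z) powr c) \<xi> \<partial>lborel)) (at \<xi>)"
  proof (rule has_field_derivative_integral)
    show "integrable lborel (\<lambda>t. norm (W t) * B)" using W by simp
    show "(\<lambda>t. W t * (1 - of_real t * z) powr c) \<in> borel_measurable lborel" if "z \<in> ball \<xi> r" for z
      using that r(2) W W0 by (intro stieltjes_measurable) (auto simp: subset_iff)
    show "(\<lambda>z. W t * (1 - of_real t * z) powr c) holomorphic_on ball \<xi> r" for t
    proof (cases "t \<in> {0<..<1}")
      case True
      show ?thesis
        by (intro holomorphic_intros) (use True in_cut[of t] in \<open>auto simp: cut_plane_def\<close>)
    qed (simp add: W0)
    show "norm (W t * (1 - of_real t * z) powr c) \<le> norm (W t) * B" if "z \<in> ball \<xi> r" for z t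
    proof (cases "t \<in> {0<..<1}")
      case True
      then show ?thesis using B[of t z] that by (auto simp: norm_mult intro!: mult_left_mono)
    qed (simp add: W0)
  qed (use r in auto)
  then show ?thesis unfolding deriv by (simp add: stieltjes_def[abs_def])
qed

lemma stieltjes_growth:
  assumes W: "integrable lborel W" and W0: "\<And>t. t \<notin> {0<..<1} \<Longrightarrow> W t = 0"
    and x: "x \<notin> \<real>\<^sub>\<ge>\<^sub>0"
  shows "\<exists>C\<ge>0. \<forall>r\<ge>0. norm (stieltjes W c (of_real r * x)) \<le> C * (1 + norm x * r) powr \<bar>Re c\<bar>"
proof -
  define E where "E = exp (pi * \<bar>Im c\<bar>) * (1 / ray_gap x) powr \<bar>Re c\<bar>"
  have "norm (stieltjes W c (of_real r * x)) \<le> ((\<integral>t. norm (W t) \<partial>lborel) * E) * (1 + norm x * r) powr \<bar>Re c\<bar>"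
    if r: "r \<ge> 0" for r
  proof -
    have bd: "norm (W t * (1 - of_real t * (of_real r * x)) powr c) \<le> norm (W t) * (E * (1 + norm x * r) powr \<bar>Re c\<bar>)" for t
    proof (cases "t \<in> {0<..<1}")
      case True
      have "norm ((1 - of_real (t * r) * x) powr c)
          \<le> exp (pi * \<bar>Im c\<bar>) * ((1 / ray_gap x) powr \<bar>Re c\<bar> * (1 + norm x * (t * r)) powr \<bar>Re c\<bar>)"
        using ray_gap_pos[OF x] True r by (intro norm_powr_ray) auto
      also have "\<dots> \<le> exp (pi * \<bar>Im c\<bar>) * ((1 / ray_gap x) powr \<bar>Re c\<bar> * (1 + norm x * r) powr \<bar>Re c\<bar>)"
        using True r by (intro mult_left_mono powr_mono2) (auto intro!: mult_left_mono simp: mult_left_le_one_le)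
      finally have "norm ((1 - of_real (t * r) * x) powr c) \<le> E * (1 + norm x * r) powr \<bar>Re c\<bar>"
        by (simp add: E_def)
      then have "norm (W t) * norm ((1 - of_real t * (of_real r * x)) powr c)
          \<le> norm (W t) * (E * (1 + norm x * r) powr \<bar>Re c\<bar>)"
        by (intro mult_left_mono) (simp_all add: mult.assoc)
      then show ?thesis by (simp add: norm_mult)
    qed (simp add: W0)
    have "norm (stieltjes W c (of_real r * x)) \<le> (\<integral>t. norm (W t) * (E * (1 + norm x * r) powr \<bar>Re c\<bar>) \<partial>lborel)"
      unfolding stieltjes_def
      by (rule order_trans[OF integral_norm_bound integral_mono'])
         (use W bd in \<open>auto simp: E_def\<close>)
    then show ?thesis by simp
  qed
  moreover have "(\<integral>t. norm (W t) \<partial>lborel) * E \<ge> 0" by (simp add: E_def)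
  ultimately show ?thesis by blast
qed

subsection \<open>The Borel transform for \<open>0 < Re b < 2\<close>\<close>

text \<open>Expanding the binomial and integrating term by term gives, formally, the divergent
  series 2F0(a, b; -; x).\<close>

definition euler_integral :: "complex \<Rightarrow> complex \<Rightarrow> complex \<Rightarrow> complex" where
  "euler_integral a b x = (\<integral>s. gamma_weight b s * (1 - of_real s * x) powr (-a) \<partial>lborel) / Gamma b"

lemma gamma_weight_times_measurable:
  assumes "x \<notin> \<real>\<^sub>\<ge>\<^sub>0"
  shows "(\<lambda>s. gamma_weight b s * (1 - of_real s * x) powr c) \<in> borel_measurable lborel"
proof -
  have "(\<lambda>s. indicator {0<..} s *\<^sub>R (1 - of_real s * x) powr c) \<in> borel_measurable borel"
    using assms
    by (intro borel_measurable_continuous_on_indicator continuous_on_one_minus_powr continuous_intros)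
      (auto intro: slit_scale)
  then have "(\<lambda>s. gamma_weight b s * (indicator {0<..} s *\<^sub>R (1 - of_real s * x) powr c)) \<in> borel_measurable lborel"
    by measurable
  moreover have "gamma_weight b s * (indicator {0<..} s *\<^sub>R (1 - of_real s * x) powr c)
      = gamma_weight b s * (1 - of_real s * x) powr c" for s
    by (cases "s > 0") (auto simp: indicator_def)
  ultimately show ?thesis by simp
qed

lemma norm_gamma_weight:
  "norm (gamma_weight b s) = norm (cpow (of_real (Re b) - 1) s) * exp (- 1 * s)"
  by (cases "s > 0") (simp_all add: gamma_weight_def norm_mult norm_cpow)

lemma gamma_weight_dominated:
  assumes "Re b > 0" "R \<ge> 0" "M \<ge> 0"
  shows "integrable lborel (\<lambda>s. norm (gamma_weight b s) * (K * (1 + R * s) powr M))"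
proof -
  have "integrable lborel (\<lambda>s. K * (norm (cpow (of_real (Re b) - 1) s) * exp (- 1 * s) * (1 + R * s) powr M))"
    by (intro integrable_mult_right integrable_power_exp_poly) (use assms in auto)
  then show ?thesis by (simp only: norm_gamma_weight mult_ac)
qed

lemma euler_integrand_integrable:
  assumes "Re b > 0" "x \<notin> \<real>\<^sub>\<ge>\<^sub>0"
  shows "integrable lborel (\<lambda>s. gamma_weight b s * (1 - of_real s * x) powr c)"
proof (rule Bochner_Integration.integrable_bound)
  show "integrable lborel (\<lambda>s. norm (gamma_weight b s) *
      (exp (pi * \<bar>Im c\<bar>) * (1 / ray_gap x) powr \<bar>Re c\<bar> * (1 + norm x * s) powr \<bar>Re c\<bar>))"
    using assms by (intro gamma_weight_dominated) auto
  show "AE s in lborel. norm (gamma_weight b s * (1 - of_real s * x) powr c) \<le> norm (norm (gamma_weight b s) *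
      (exp (pi * \<bar>Im c\<bar>) * (1 / ray_gap x) powr \<bar>Re c\<bar> * (1 + norm x * s) powr \<bar>Re c\<bar>))"
  proof (rule AE_I2)
    fix s :: real
    show "norm (gamma_weight b s * (1 - of_real s * x) powr c) \<le> norm (norm (gamma_weight b s) *
      (exp (pi * \<bar>Im c\<bar>) * (1 / ray_gap x) powr \<bar>Re c\<bar> * (1 + norm x * s) powr \<bar>Re c\<bar>))"
    proof (cases "s > 0")
      case True
      then show ?thesis using norm_powr_ray[of "ray_gap x" x "norm x" s c] ray_gap_pos[OF assms(2)]
        by (simp add: norm_mult mult_left_mono)
    qed simp
  qed
qed (rule gamma_weight_times_measurable[OF assms(2)])

text \<open>Since \<open>ray_gap\<close> is continuous away from 0, half of its value at x persists
  nearby. This supplies the common constants for majorants when x varies.\<close>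

lemma slit_neighbourhood:
  assumes "x \<notin> \<real>\<^sub>\<ge>\<^sub>0"
  obtains r where "r > 0" "\<And>y. y \<in> ball x r \<Longrightarrow> y \<notin> \<real>\<^sub>\<ge>\<^sub>0" "\<And>y. y \<in> ball x r \<Longrightarrow> ray_gap y \<ge> ray_gap x / 2"
    "\<And>y. y \<in> ball x r \<Longrightarrow> norm y \<le> norm x + 1"
proof -
  have "x \<noteq> 0" using assms by auto
  then have "\<forall>\<^sub>F y in at x. ray_gap y > ray_gap x / 2"
    using isCont_ray_gap ray_gap_pos[OF assms] by (intro order_tendstoD(1)[where y = "ray_gap x"]) (auto simp: isCont_def)
  then have 1: "\<forall>\<^sub>F y in nhds x. ray_gap y > ray_gap x / 2"
    using ray_gap_pos[OF assms] by (simp add: eventually_nhds_conv_at)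
  have 2: "\<forall>\<^sub>F y in nhds x. y \<in> - \<real>\<^sub>\<ge>\<^sub>0"
    using assms by (intro eventually_nhds_in_open) (auto simp: open_Compl)
  have 3: "\<forall>\<^sub>F y in nhds x. y \<in> ball x 1"
    by (intro eventually_nhds_in_open) auto
  have "\<forall>\<^sub>F y in nhds x. ray_gap y > ray_gap x / 2 \<and> y \<in> - \<real>\<^sub>\<ge>\<^sub>0 \<and> y \<in> ball x 1"
    using 1 2 3 by eventually_elim auto
  then obtain r where r: "r > 0" "\<And>y. dist y x < r \<Longrightarrow> ray_gap y > ray_gap x / 2 \<and> y \<in> - \<real>\<^sub>\<ge>\<^sub>0 \<and> y \<in> ball x 1"
    unfolding eventually_nhds_metric by blast
  show thesis
  proof (rule that[of r])
    fix y assume "y \<in> ball x r"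
    then have y: "ray_gap y > ray_gap x / 2" "y \<in> - \<real>\<^sub>\<ge>\<^sub>0" "y \<in> ball x 1"
      using r(2)[of y] by (auto simp: dist_commute)
    then show "y \<notin> \<real>\<^sub>\<ge>\<^sub>0" "ray_gap y \<ge> ray_gap x / 2" by auto
    show "norm y \<le> norm x + 1"
      using y(3) norm_triangle_ineq2[of y x] by (simp add: dist_norm norm_minus_commute)
  qed (use r in auto)
qed

lemma euler_integral_holomorphic:
  assumes b: "Re b > 0"
  shows "euler_integral a b holomorphic_on - \<real>\<^sub>\<ge>\<^sub>0"
proof -
  have "\<exists>D. ((\<lambda>x. \<integral>s. gamma_weight b s * (1 - of_real s * x) powr (-a) \<partial>lborel) has_field_derivative D) (at x)"
    if x: "x \<notin> \<real>\<^sub>\<ge>\<^sub>0" for x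
  proof -
    obtain r where r: "r > 0" "\<And>y. y \<in> ball x r \<Longrightarrow> y \<notin> \<real>\<^sub>\<ge>\<^sub>0" "\<And>y. y \<in> ball x r \<Longrightarrow> ray_gap y \<ge> ray_gap x / 2"
      "\<And>y. y \<in> ball x r \<Longrightarrow> norm y \<le> norm x + 1"
      using slit_neighbourhood[OF x] by metis
    define E where "E = exp (pi * \<bar>Im (-a)\<bar>) * (1 / (ray_gap x / 2)) powr \<bar>Re (-a)\<bar>"
    show ?thesis
    proof (rule exI, rule has_field_derivative_integral)
      show "r > 0" by fact
      show "(\<lambda>s. gamma_weight b s * (1 - of_real s * y) powr (-a)) \<in> borel_measurable lborel"
        if "y \<in> ball x r" for y
        using r(2)[OF that] by (rule gamma_weight_times_measurable)
      show "(\<lambda>y. gamma_weight b s * (1 - of_real s * y) powr (-a)) holomorphic_on ball x r" for s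
      proof (cases "s > 0")
        case True
        then show ?thesis
          using slit_scale r(2) by (intro holomorphic_intros) (force simp: cut_plane_def)+
      qed simp
      show "integrable lborel (\<lambda>s. norm (gamma_weight b s) * (E * (1 + (norm x + 1) * s) powr \<bar>Re (-a)\<bar>))"
        using b by (intro gamma_weight_dominated) auto
      show "norm (gamma_weight b s * (1 - of_real s * y) powr (-a))
          \<le> norm (gamma_weight b s) * (E * (1 + (norm x + 1) * s) powr \<bar>Re (-a)\<bar>)" if "y \<in> ball x r" for y s
      proof (cases "s > 0")
        case True
        then show ?thesis
          using norm_powr_ray[OF r(3)[OF that] _ r(4)[OF that], of s "-a"] ray_gap_pos[OF x]
          by (simp add: norm_mult E_def mult_left_mono)
      qed simp
    qed
  qed
  then have "(\<lambda>x. \<integral>s. gamma_weight b s * (1 - of_real s * x) powr (-a) \<partial>lborel) holomorphic_on - \<real>\<^sub>\<ge>\<^sub>0"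
    by (subst holomorphic_on_open) (auto simp: open_Compl)
  then show ?thesis
    unfolding euler_integral_def[abs_def] using Gamma_nonzero[OF b] by (intro holomorphic_intros) auto
qed

text \<open>On the cut plane this is the analytic continuation of 2F1(a, b; 2; \<xi>).\<close>

definition beta_kernel :: "complex \<Rightarrow> complex \<Rightarrow> complex \<Rightarrow> complex" where
  "beta_kernel a b = stieltjes (beta_weight b) (- a)"

text \<open>Put s^n into the Beta-Gamma identity: the moment times Gamma(n + 2) equals Gamma(b + n)
  / Gamma(b).\<close>

lemma beta_weight_moment:
  assumes b: "0 < Re b" "Re b < 2"
  shows "(\<integral>t. beta_weight b t * of_real t ^ n \<partial>lborel) = pochhammer b n / fact (Suc n)"
proof -
  have shift: "gamma_weight c s * of_real s ^ n = gamma_weight (c + of_nat n) s" for s c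
  proof (cases "s > 0")
    case True
    have "cpow (c + of_nat n - 1) s = cpow (c - 1) s * of_real s ^ n"
      using cpow_add[of "c - 1" "of_nat n" s] True by (simp add: cpow_of_nat diff_add_eq)
    then show ?thesis by (simp add: gamma_weight_def mult_ac)
  qed simp
  have "(\<integral>u. gamma_weight 2 u * (\<integral>t. beta_weight b t * of_real (u * t) ^ n \<partial>lborel) \<partial>lborel)
      = (\<integral>s. gamma_weight b s * of_real s ^ n \<partial>lborel) / Gamma b"
  proof (rule beta_gamma_integral[OF b])
    show "integrable lborel (\<lambda>s. gamma_weight b s * of_real s ^ n)"
      unfolding shift using b by (intro gamma_weight_integrable) auto
  qed measurable
  also have "\<dots> = Gamma (b + of_nat n) / Gamma b"
    unfolding shift using b by (simp add: integral_gamma_weight)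
  also have "\<dots> = pochhammer b n"
    using b by (subst pochhammer_Gamma) (auto elim!: nonpos_Ints_cases')
  finally have eq: "(\<integral>u. gamma_weight 2 u * (\<integral>t. beta_weight b t * of_real (u * t) ^ n \<partial>lborel) \<partial>lborel)
      = pochhammer b n" .
  have pull: "beta_weight b t * of_real (u * t) ^ n = of_real u ^ n * (beta_weight b t * of_real t ^ n)" for u t
    by (simp add: power_mult_distrib mult_ac)
  have "(\<lambda>u. gamma_weight 2 u * (\<integral>t. beta_weight b t * of_real (u * t) ^ n \<partial>lborel))
      = (\<lambda>u. gamma_weight (2 + of_nat n) u * (\<integral>t. beta_weight b t * of_real t ^ n \<partial>lborel))"
    by (simp only: pull integral_mult_right_zero shift[symmetric] mult.assoc)
  note eq = eq[unfolded this]
  have "(\<integral>u. gamma_weight (2 + of_nat n) u * (\<integral>t. beta_weight b t * of_real t ^ n \<partial>lborel) \<partial>lborel)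
      = Gamma (2 + of_nat n) * (\<integral>t. beta_weight b t * of_real t ^ n \<partial>lborel)"
    by (simp add: integral_gamma_weight)
  also have "Gamma (2 + of_nat n :: complex) = fact (Suc n)"
    using Gamma_fact[of "Suc n", where 'a = complex] by (simp add: add_ac del: fact_Suc)
  finally have "fact (Suc n) * (\<integral>t. beta_weight b t * of_real t ^ n \<partial>lborel) = pochhammer b n"
    using eq by (simp only:)
  then show ?thesis by (simp add: field_simps del: fact_Suc)
qed

lemma one_minus_powr_sums:
  fixes a v :: complex
  assumes "norm v < 1"
  shows "(\<lambda>n. pochhammer a n / fact n * v ^ n) sums ((1 - v) powr (- a))"
proof -
  have "(\<lambda>n. (-a gchoose n) * (- v) ^ n) sums (1 + - v) powr (- a)"
    using assms by (intro gen_binomial_complex) simp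
  moreover have "(-a gchoose n) * (- v) ^ n = pochhammer a n / fact n * v ^ n" for n
  proof -
    have "(- 1) ^ n * (- v) ^ n = v ^ n" by (simp add: power_mult_distrib[symmetric])
    moreover have "(-a gchoose n) * (- v) ^ n = pochhammer a n / fact n * ((- 1) ^ n * (- v) ^ n)"
      by (simp add: gbinomial_pochhammer)
    ultimately show ?thesis by simp
  qed
  ultimately show ?thesis by simp
qed

lemma beta_kernel_sums:
  assumes b: "0 < Re b" "Re b < 2" and \<xi>: "norm \<xi> < 1"
  shows "(\<lambda>n. pochhammer a n * pochhammer b n / (fact n * fact (Suc n)) * \<xi> ^ n) sums beta_kernel a b \<xi>"
proof -
  define c where "c n = pochhammer a n / fact n" for n
  define W where "W = (\<integral>t. norm (beta_weight b t) \<partial>lborel)"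
  \<comment> \<open>The midpoint between |\<xi>| and 1: the binomial series converges there, hence
    absolutely at \<open>\<xi>\<close>.\<close>
  have "norm (of_real ((1 + norm \<xi>) / 2) :: complex) = (1 + norm \<xi>) / 2"
    by (subst norm_of_real) simp
  then have "norm (of_real ((1 + norm \<xi>) / 2) :: complex) < 1" "norm \<xi> < norm (of_real ((1 + norm \<xi>) / 2) :: complex)"
    using \<xi> by auto
  then have summ: "summable (\<lambda>n. norm (c n * \<xi> ^ n))"
    using powser_insidea[OF sums_summable[OF one_minus_powr_sums[of "of_real ((1 + norm \<xi>) / 2)" a]]]
    by (simp add: c_def)
  have Wint: "integrable lborel (beta_weight b)" using beta_weight_integrable[OF b] .
  define F where "F n t = beta_weight b t * of_real t ^ n * (c n * \<xi> ^ n)" for n t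
  have bd: "norm (F n t) \<le> norm (beta_weight b t) * norm (c n * \<xi> ^ n)" for n t
  proof (cases "t \<in> {0<..<1}")
    case True
    then have "\<bar>t\<bar> ^ n \<le> 1" by (intro power_le_one) auto
    then have "norm (beta_weight b t) * \<bar>t\<bar> ^ n \<le> norm (beta_weight b t)"
      by (simp add: mult_left_le)
    then show ?thesis by (simp add: F_def norm_mult norm_power mult_right_mono)
  qed (simp add: F_def beta_weight_outside)
  have [measurable]: "F n \<in> borel_measurable lborel" for n
    unfolding F_def[abs_def] by measurable
  have Fint: "integrable lborel (F n)" for n
    by (rule Bochner_Integration.integrable_bound[of _ "\<lambda>t. norm (beta_weight b t) * norm (c n * \<xi> ^ n)"])
       (use Wint bd in auto)
  have "(\<lambda>n. integral\<^sup>L lborel (F n)) sums (\<integral>t. (\<Sum>n. F n t) \<partial>lborel)"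
  proof (rule sums_integral[OF Fint])
    show "AE t in lborel. summable (\<lambda>n. norm (F n t))"
      by (intro AE_I2 summable_comparison_test'[OF summable_mult[OF summ]]) (use bd in auto)
    show "summable (\<lambda>n. \<integral>t. norm (F n t) \<partial>lborel)"
    proof (rule summable_comparison_test'[OF summable_mult[OF summ]])
      fix n
      have "(\<integral>t. norm (F n t) \<partial>lborel) \<le> (\<integral>t. norm (beta_weight b t) * norm (c n * \<xi> ^ n) \<partial>lborel)"
        by (intro integral_mono) (use Fint Wint bd in auto)
      then show "norm (\<integral>t. norm (F n t) \<partial>lborel) \<le> W * norm (c n * \<xi> ^ n)"
        by (simp add: W_def)
    qed
  qed
  moreover have "(\<Sum>n. F n t) = beta_weight b t * (1 - of_real t * \<xi>) powr (- a)" for t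
  proof (cases "t \<in> {0<..<1}")
    case True
    have "t * norm \<xi> \<le> 1 * norm \<xi>" using True by (intro mult_right_mono) auto
    then have "norm (of_real t * \<xi>) < 1"
      using True \<xi> by (simp add: norm_mult)
    from sums_mult[OF one_minus_powr_sums[OF this, of a], of "beta_weight b t"]
    show ?thesis by (simp add: sums_iff F_def c_def power_mult_distrib mult_ac)
  qed (simp add: F_def beta_weight_outside)
  moreover have "integral\<^sup>L lborel (F n) = pochhammer a n * pochhammer b n / (fact n * fact (Suc n)) * \<xi> ^ n" for n
    unfolding F_def using beta_weight_moment[OF b, of n] by (simp add: c_def del: fact_Suc) (simp only: mult_ac)
  ultimately show ?thesis by (simp add: beta_kernel_def stieltjes_def)
qed

text \<open>The derivative of \<xi> 2F1(a, b; 2; \<xi>), which is 2F1(a, b; 1; \<xi>), written out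
  by the product rule so that its growth along rays can be read off from two Stieltjes
  transforms.\<close>

definition borel_branch :: "complex \<Rightarrow> complex \<Rightarrow> complex \<Rightarrow> complex" where
  "borel_branch a b \<xi> = beta_kernel a b \<xi>
     + \<xi> * (a * stieltjes (\<lambda>t. of_real t * beta_weight b t) (- a - 1) \<xi>)"

lemma beta_kernel_has_field_derivative:
  assumes "0 < Re b" "Re b < 2" "\<xi> \<in> cut_plane"
  shows "(beta_kernel a b has_field_derivative
    a * stieltjes (\<lambda>t. of_real t * beta_weight b t) (- a - 1) \<xi>) (at \<xi>)"
  using stieltjes_has_field_derivative[OF beta_weight_integrable[OF assms(1,2)] beta_weight_outside assms(3), of "- a"]
  by (simp add: beta_kernel_def)

lemma borel_branch_derivative:
  assumes "0 < Re b" "Re b < 2" "\<xi> \<in> cut_plane"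
  shows "((\<lambda>\<xi>. \<xi> * beta_kernel a b \<xi>) has_field_derivative borel_branch a b \<xi>) (at \<xi>)"
  by (auto intro!: derivative_eq_intros beta_kernel_has_field_derivative[OF assms] simp: borel_branch_def)

lemma beta_kernel_holomorphic:
  assumes "0 < Re b" "Re b < 2"
  shows "beta_kernel a b holomorphic_on cut_plane"
  using beta_kernel_has_field_derivative[OF assms] open_cut_plane
  by (subst holomorphic_on_open) auto

lemma borel_branch_holomorphic:
  assumes "0 < Re b" "Re b < 2"
  shows "borel_branch a b holomorphic_on cut_plane"
proof -
  have "deriv (\<lambda>\<xi>. \<xi> * beta_kernel a b \<xi>) holomorphic_on cut_plane"
    by (intro holomorphic_deriv holomorphic_intros beta_kernel_holomorphic[OF assms] open_cut_plane)
  then show ?thesis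
    by (rule holomorphic_transform) (use DERIV_imp_deriv[OF borel_branch_derivative[OF assms]] in auto)
qed

lemma borel_branch_expansion:
  assumes "0 < Re b" "Re b < 2"
  shows "borel_branch a b has_fps_expansion borel_transform (hyp2F0_fps a b)"
proof -
  define H where "H = Abs_fps (\<lambda>n. pochhammer a n * pochhammer b n / (fact n * fact (Suc n)))"
  have "\<forall>\<^sub>F \<xi> in nhds 0. \<xi> \<in> ball (0::complex) 1" by (intro eventually_nhds_in_open) auto
  then have "\<forall>\<^sub>F \<xi> in nhds 0. (\<lambda>n. fps_nth H n * \<xi> ^ n) sums beta_kernel a b \<xi>"
  proof eventually_elim
    case (elim \<xi>)
    then show ?case using beta_kernel_sums[OF assms, of \<xi> a] by (simp only: H_def fps_nth_Abs_fps mem_ball_0)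
  qed
  then have "beta_kernel a b has_fps_expansion H"
    by (rule has_fps_expansionI)
  then have "deriv (\<lambda>\<xi>. \<xi> * beta_kernel a b \<xi>) has_fps_expansion fps_deriv (fps_X * H)"
    by (intro fps_expansion_intros)
  moreover have "\<forall>\<^sub>F \<xi> in nhds 0. deriv (\<lambda>\<xi>. \<xi> * beta_kernel a b \<xi>) \<xi> = borel_branch a b \<xi>"
    using eventually_nhds_in_open[OF open_cut_plane, of 0]
    by (auto simp: cut_plane_iff elim!: eventually_mono intro!: DERIV_imp_deriv borel_branch_derivative assms)
  \<comment> \<open>Differentiation contributes n + 1, which turns n! (n + 1)! into (n!)^2, the
    denominator of the Borel transform.\<close>
  moreover have "fps_deriv (fps_X * H) = borel_transform (hyp2F0_fps a b)"
  proof (rule fps_ext)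
    fix n
    have "of_nat (Suc n) * (x / (fact n * fact (Suc n))) = x / (fact n * fact n)" for x :: complex
      by (simp add: field_simps del: of_nat_Suc)
    then have "of_nat n * x / (fact n * fact (Suc n)) + x / (fact n * fact (Suc n)) = x / (fact n * fact n)" for x :: complex
      by (simp add: add_divide_distrib[symmetric] distrib_right add.commute del: fact_Suc)
    then show "fps_nth (fps_deriv (fps_X * H)) n = fps_nth (borel_transform (hyp2F0_fps a b)) n"
      by (simp add: H_def borel_transform_def hyp2F0_fps_def del: of_nat_Suc fact_Suc)
  qed
  ultimately show ?thesis using has_fps_expansion_cong by blast
qed

section \<open>Laplace integrals of explicit functions and polynomial growth along rays\<close>

definition laplace_along :: "real \<Rightarrow> (complex \<Rightarrow> complex) \<Rightarrow> complex \<Rightarrow> complex" where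
  "laplace_along d g x = 1 / x * (LBINT t:{0..}. g (of_real t * cis d) *
     exp (- (of_real t * cis d) / x) * cis d)"

text \<open>The constants may depend on the direction: a Laplace integral sees one half line only,
  and near the cut no uniform bound is asked for. The class is closed under the linear combinations
  in the contiguous relations.\<close>

definition polynomial_growth :: "(complex \<Rightarrow> complex) \<Rightarrow> bool" where
  "polynomial_growth g \<longleftrightarrow> (\<forall>u. norm u = 1 \<longrightarrow> u \<notin> \<real>\<^sub>\<ge>\<^sub>0 \<longrightarrow>
     (\<exists>C\<ge>0. \<exists>M\<ge>0. \<forall>r\<ge>0. norm (g (of_real r * u)) \<le> C * (1 + r) powr M))"

text \<open>Rescaling: the point r x lies at distance |x| r in the direction x / |x|.\<close>

lemma polynomial_growthE:
  assumes "polynomial_growth g" "x \<notin> \<real>\<^sub>\<ge>\<^sub>0"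
  obtains C M where "C \<ge> 0" "M \<ge> 0" "\<And>r. r \<ge> 0 \<Longrightarrow> norm (g (of_real r * x)) \<le> C * (1 + norm x * r) powr M"
proof -
  have x: "x \<noteq> 0" using assms(2) by auto
  have "x / of_real (norm x) \<notin> \<real>\<^sub>\<ge>\<^sub>0"
    using assms(2) x nonneg_Reals_mult_I[of "x / of_real (norm x)" "of_real (norm x)"] by auto
  moreover have "norm (x / of_real (norm x)) = 1" using x by (simp add: norm_divide)
  ultimately obtain C M where *: "C \<ge> 0" "M \<ge> 0"
      "\<And>r. r \<ge> 0 \<Longrightarrow> norm (g (of_real r * (x / of_real (norm x)))) \<le> C * (1 + r) powr M"
    using assms(1) unfolding polynomial_growth_def by blast
  show thesis
  proof (rule that[OF *(1,2)])
    fix r :: real assume "r \<ge> 0"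
    then show "norm (g (of_real r * x)) \<le> C * (1 + norm x * r) powr M"
      using *(3)[of "norm x * r"] x by (simp add: mult.commute)
  qed
qed

lemma powr_growth_mono:
  fixes r :: real
  assumes "r \<ge> 0" "0 \<le> C" "M \<le> M'" "C \<le> C'"
  shows "C * (1 + r) powr M \<le> C' * (1 + r) powr M'"
  using assms by (intro mult_mono powr_mono) auto

lemma polynomial_growth_add:
  assumes "polynomial_growth f" "polynomial_growth g"
  shows "polynomial_growth (\<lambda>z. f z + g z)"
  unfolding polynomial_growth_def
proof (intro allI impI)
  fix u :: complex assume u: "norm u = 1" "u \<notin> \<real>\<^sub>\<ge>\<^sub>0"
  obtain C M where 1: "C \<ge> 0" "M \<ge> 0" "\<And>r. r \<ge> 0 \<Longrightarrow> norm (f (of_real r * u)) \<le> C * (1 + r) powr M"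
    using polynomial_growthE[OF assms(1) u(2)] u(1) by auto
  obtain D N where 2: "D \<ge> 0" "N \<ge> 0" "\<And>r. r \<ge> 0 \<Longrightarrow> norm (g (of_real r * u)) \<le> D * (1 + r) powr N"
    using polynomial_growthE[OF assms(2) u(2)] u(1) by auto
  have "norm (f (of_real r * u) + g (of_real r * u)) \<le> (C + D) * (1 + r) powr (M + N)" if "r \<ge> 0" for r
  proof -
    have "norm (f (of_real r * u) + g (of_real r * u)) \<le> C * (1 + r) powr M + D * (1 + r) powr N"
      using 1(3)[OF that] 2(3)[OF that] norm_triangle_ineq order_trans add_mono by meson
    also have "\<dots> \<le> C * (1 + r) powr (M + N) + D * (1 + r) powr (M + N)"
      using that 1 2 by (intro add_mono powr_growth_mono) auto
    finally show ?thesis by (simp add: distrib_right)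
  qed
  then show "\<exists>C\<ge>0. \<exists>M\<ge>0. \<forall>r\<ge>0. norm (f (of_real r * u) + g (of_real r * u)) \<le> C * (1 + r) powr M"
    using 1 2 by (intro exI[of _ "C + D"] conjI exI[of _ "M + N"]) auto
qed

lemma polynomial_growth_cmult:
  assumes "polynomial_growth f"
  shows "polynomial_growth (\<lambda>z. c * f z)"
  unfolding polynomial_growth_def
proof (intro allI impI)
  fix u :: complex assume u: "norm u = 1" "u \<notin> \<real>\<^sub>\<ge>\<^sub>0"
  obtain C M where 1: "C \<ge> 0" "M \<ge> 0" "\<And>r. r \<ge> 0 \<Longrightarrow> norm (f (of_real r * u)) \<le> C * (1 + r) powr M"
    using polynomial_growthE[OF assms(1) u(2)] u(1) by auto
  show "\<exists>C\<ge>0. \<exists>M\<ge>0. \<forall>r\<ge>0. norm (c * f (of_real r * u)) \<le> C * (1 + r) powr M"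
    using 1 by (intro exI[of _ "norm c * C"] conjI exI[of _ "M"])
      (auto simp: norm_mult mult.assoc intro!: mult_left_mono)
qed

lemma polynomial_growth_times_id:
  assumes "polynomial_growth f"
  shows "polynomial_growth (\<lambda>z. z * f z)"
  unfolding polynomial_growth_def
proof (intro allI impI)
  fix u :: complex assume u: "norm u = 1" "u \<notin> \<real>\<^sub>\<ge>\<^sub>0"
  obtain C M where 1: "C \<ge> 0" "M \<ge> 0" "\<And>r. r \<ge> 0 \<Longrightarrow> norm (f (of_real r * u)) \<le> C * (1 + r) powr M"
    using polynomial_growthE[OF assms(1) u(2)] u(1) by auto
  have "norm (of_real r * u * f (of_real r * u)) \<le> C * (1 + r) powr (M + 1)" if "r \<ge> 0" for r
  proof -
    have "norm (of_real r * u * f (of_real r * u)) = r * norm (f (of_real r * u))"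
      using that u by (simp add: norm_mult)
    also have "\<dots> \<le> (1 + r) * (C * (1 + r) powr M)"
      using that 1 by (intro mult_mono) auto
    also have "\<dots> = C * (1 + r) powr (M + 1)" using that by (simp add: powr_add)
    finally show ?thesis .
  qed
  then show "\<exists>C\<ge>0. \<exists>M\<ge>0. \<forall>r\<ge>0. norm (of_real r * u * f (of_real r * u)) \<le> C * (1 + r) powr M"
    using 1 by (intro exI[of _ C] conjI exI[of _ "M + 1"]) auto
qed

lemma stieltjes_polynomial_growth:
  assumes W: "integrable lborel W" and W0: "\<And>t. t \<notin> {0<..<1} \<Longrightarrow> W t = 0"
  shows "polynomial_growth (stieltjes W c)"
  unfolding polynomial_growth_def
proof (intro allI impI)
  fix u :: complex assume u: "norm u = 1" "u \<notin> \<real>\<^sub>\<ge>\<^sub>0"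
  obtain C where "C \<ge> 0" "\<forall>r\<ge>0. norm (stieltjes W c (of_real r * u)) \<le> C * (1 + norm u * r) powr \<bar>Re c\<bar>"
    using stieltjes_growth[OF W W0 u(2), of c] by blast
  then show "\<exists>C\<ge>0. \<exists>M\<ge>0. \<forall>r\<ge>0. norm (stieltjes W c (of_real r * u)) \<le> C * (1 + r) powr M"
    using u by (intro exI[of _ C] conjI exI[of _ "\<bar>Re c\<bar>"]) auto
qed

lemma beta_kernel_polynomial_growth:
  "0 < Re b \<Longrightarrow> Re b < 2 \<Longrightarrow> polynomial_growth (beta_kernel a b)"
  unfolding beta_kernel_def
  by (intro stieltjes_polynomial_growth beta_weight_integrable beta_weight_outside)

lemma borel_branch_polynomial_growth:
  assumes "0 < Re b" "Re b < 2"
  shows "polynomial_growth (borel_branch a b)"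
proof -
  have "integrable lborel (\<lambda>t. of_real t * beta_weight b t)"
  proof (rule Bochner_Integration.integrable_bound[OF beta_weight_integrable[OF assms]])
    show "AE t in lborel. norm (of_real t * beta_weight b t) \<le> norm (beta_weight b t)"
    proof (rule AE_I2)
      fix t :: real
      show "norm (of_real t * beta_weight b t) \<le> norm (beta_weight b t)"
        by (cases "t \<in> {0<..<1}") (auto simp: norm_mult beta_weight_outside mult_left_le_one_le)
    qed
  qed measurable
  then show ?thesis
    unfolding borel_branch_def[abs_def] using assms
    by (intro polynomial_growth_add polynomial_growth_times_id polynomial_growth_cmult
        beta_kernel_polynomial_growth stieltjes_polynomial_growth)
       (auto simp: beta_weight_outside)
qed

section \<open>Geometry of the sector\<close>

lemma cis_not_nonneg: "0 < d \<Longrightarrow> d < 2 * pi \<Longrightarrow> cis d \<notin> \<real>\<^sub>\<ge>\<^sub>0"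
proof
  assume d: "0 < d" "d < 2 * pi" and "cis d \<in> \<real>\<^sub>\<ge>\<^sub>0"
  then have "Arg2pi (cis d) = 0" by (simp add: Arg2pi_eq_0 complex_nonneg_Reals_iff complex_is_Real_iff)
  moreover have "Arg2pi (cis d) = d"
    by (rule Arg2pi_unique[of 1]) (use d in \<open>auto simp: cis_conv_exp\<close>)
  ultimately show False using d by simp
qed

lemma slit_iff_Arg2pi: "x \<notin> \<real>\<^sub>\<ge>\<^sub>0 \<longleftrightarrow> 0 < Arg2pi x"
proof -
  have "x \<in> \<real>\<^sub>\<ge>\<^sub>0 \<longleftrightarrow> Arg2pi x = 0"
    by (auto simp: Arg2pi_eq_0 complex_nonneg_Reals_iff complex_is_Real_iff)
  then show ?thesis using Arg2pi_ge_0[of x] by auto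
qed

lemma sector_iff: "x \<in> sector d \<longleftrightarrow> x \<notin> \<real>\<^sub>\<ge>\<^sub>0 \<and> d - pi/2 < Arg2pi x \<and> Arg2pi x < d + pi/2"
  unfolding sector_def mem_Collect_eq abs_diff_less_iff slit_iff_Arg2pi by auto

lemma sector_not_nonneg: "x \<in> sector d \<Longrightarrow> x \<notin> \<real>\<^sub>\<ge>\<^sub>0"
  by (simp add: sector_iff)

text \<open>The real part is cos(d - arg x) / |x|; its positivity is the convergence condition of
  the Laplace integral in direction d.\<close>

lemma sector_Re_pos:
  assumes "x \<in> sector d"
  shows "Re (cis d / x) > 0"
proof -
  have x: "x \<noteq> 0" using sector_not_nonneg[OF assms] by auto
  have "x = of_real (norm x) * cis (Arg2pi x)"
    using Arg2pi_eq[of x] by (simp add: cis_conv_exp)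
  then have "cis d / x = cis (d - Arg2pi x) / of_real (norm x)"
    by (metis cis_divide divide_divide_eq_left mult.commute)
  then have "Re (cis d / x) = cos (d - Arg2pi x) / norm x" by simp
  moreover have "cos (d - Arg2pi x) > 0"
    using assms by (intro cos_gt_zero_pi) (auto simp: sector_iff)
  ultimately show ?thesis using x by simp
qed

text \<open>Polar coordinates exhibit the sector as a continuous image of a convex rectangle.
  Connectedness, needed for the identity theorem, is read off from this.\<close>

lemma sector_eq:
  assumes "0 < d" "d < 2 * pi"
  shows "sector d = (\<lambda>(r, \<theta>). of_real r * cis \<theta>) ` ({0<..} \<times> {max 0 (d - pi/2)<..<min (2 * pi) (d + pi/2)})"
proof (intro equalityI subsetI)
  fix x assume x: "x \<in> sector d"
  have "x \<noteq> 0" using sector_not_nonneg[OF x] by auto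
  then have "(norm x, Arg2pi x) \<in> {0<..} \<times> {max 0 (d - pi/2)<..<min (2 * pi) (d + pi/2)}"
    using x Arg2pi_lt_2pi[of x] by (simp add: sector_iff slit_iff_Arg2pi)
  moreover have "x = (\<lambda>(r, \<theta>). of_real r * cis \<theta>) (norm x, Arg2pi x)"
    using Arg2pi_eq[of x] by (simp add: cis_conv_exp)
  ultimately show "x \<in> (\<lambda>(r, \<theta>). of_real r * cis \<theta>) ` ({0<..} \<times> {max 0 (d - pi/2)<..<min (2 * pi) (d + pi/2)})"
    by (rule rev_image_eqI)
next
  fix x assume "x \<in> (\<lambda>(r, \<theta>). complex_of_real r * cis \<theta>) ` ({0<..} \<times> {max 0 (d - pi/2)<..<min (2 * pi) (d + pi/2)})"
  then obtain r \<theta> where r: "r > 0" "0 < \<theta>" "d - pi/2 < \<theta>" "\<theta> < 2 * pi" "\<theta> < d + pi/2" "x = of_real r * cis \<theta>"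
    by auto
  have "Arg2pi x = \<theta>" by (rule Arg2pi_unique[of r]) (use r in \<open>auto simp: cis_conv_exp\<close>)
  then show "x \<in> sector d" using r by (auto simp: sector_iff slit_iff_Arg2pi)
qed

lemma connected_sector: "0 < d \<Longrightarrow> d < 2 * pi \<Longrightarrow> connected (sector d)"
  unfolding sector_eq case_prod_beta
  by (rule connected_continuous_image) (auto intro!: convex_connected convex_Times continuous_intros)

lemma open_sector: "open (sector d)"
proof -
  have "sector d = (- \<real>\<^sub>\<ge>\<^sub>0) \<inter> Arg2pi -` {d - pi/2<..<d + pi/2}"
    by (auto simp: sector_iff)
  moreover have "continuous_on (- \<real>\<^sub>\<ge>\<^sub>0) Arg2pi"
    by (intro continuous_at_imp_continuous_on ballI continuous_at_Arg2pi) auto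
  moreover have "open (- \<real>\<^sub>\<ge>\<^sub>0 :: complex set)" by (simp add: open_Compl)
  ultimately show ?thesis
    using continuous_open_preimage[OF _ _ open_greaterThanLessThan] by metis
qed

subsection \<open>Laplace integrals along a half line\<close>

lemma continuous_on_ray:
  assumes "g holomorphic_on cut_plane" "x \<notin> \<real>\<^sub>\<ge>\<^sub>0" "\<And>t. t \<in> S \<Longrightarrow> t \<ge> 0"
  shows "continuous_on S (\<lambda>t. g (of_real t * x))"
  by (rule continuous_on_compose2[OF holomorphic_on_imp_continuous_on[OF assms(1)]])
     (use slit_scale[OF assms(2)] assms(3) in \<open>auto intro!: continuous_intros\<close>)

text \<open>This form isolates the variable p = e^(i d) / x, in which the integral is an ordinary
  Laplace transform on the right half plane. The endpoint 0 is dropped as a null set.\<close>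

lemma laplace_along_eq:
  assumes g: "g holomorphic_on cut_plane" and d: "0 < d" "d < 2 * pi" and x: "x \<noteq> 0"
  shows "laplace_along d g x = cis d / x *
     (\<integral>t. indicator {0<..} t *\<^sub>R (g (of_real t * cis d) * exp (- (of_real t * (cis d / x)))) \<partial>lborel)"
proof -
  have meas: "(\<lambda>t. indicator S t *\<^sub>R (g (of_real t * cis d) * exp (- (of_real t * (cis d / x))))) \<in> borel_measurable borel"
    if "S \<in> sets borel" "\<And>t. t \<in> S \<Longrightarrow> t \<ge> 0" for S
    by (intro borel_measurable_continuous_on_indicator continuous_intros
        continuous_on_ray[OF g cis_not_nonneg[OF d]] that) auto
  have "(\<integral>t. indicator {0..} t *\<^sub>R (g (of_real t * cis d) * exp (- (of_real t * cis d) / x) * cis d) \<partial>lborel)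
      = (\<integral>t. cis d * (indicator {0..} t *\<^sub>R (g (of_real t * cis d) * exp (- (of_real t * (cis d / x))))) \<partial>lborel)"
    by (rule Bochner_Integration.integral_cong) (auto simp: mult_ac)
  also have "\<dots> = cis d * (\<integral>t. indicator {0..} t *\<^sub>R (g (of_real t * cis d) * exp (- (of_real t * (cis d / x)))) \<partial>lborel)"
    by (rule integral_mult_right_zero)
  also have "(\<integral>t. indicator {0..} t *\<^sub>R (g (of_real t * cis d) * exp (- (of_real t * (cis d / x)))) \<partial>lborel)
      = (\<integral>t. indicator {0<..} t *\<^sub>R (g (of_real t * cis d) * exp (- (of_real t * (cis d / x)))) \<partial>lborel)"
  proof (rule integral_cong_AE)
    show "AE t in lborel. indicator {0..} t *\<^sub>R (g (of_real t * cis d) * exp (- (of_real t * (cis d / x))))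
      = indicator {0<..} t *\<^sub>R (g (of_real t * cis d) * exp (- (of_real t * (cis d / x))))"
      using AE_lborel_singleton[of "0::real"] by eventually_elim (auto simp: indicator_def)
  qed (use meas in auto)
  finally show ?thesis
    unfolding laplace_along_def set_lebesgue_integral_def by (simp only: times_divide_eq_left mult_1)
qed

lemma laplace_dominated:
  fixes c R M C :: real
  assumes "c > 0" "R \<ge> 0" "M \<ge> 0"
  shows "integrable lborel (\<lambda>t. indicator {0<..} t *\<^sub>R (C * (1 + R * t) powr M * exp (- c * t)))"
proof -
  have "integrable lborel (\<lambda>t. C * (norm (cpow (of_real 1 - 1) t) * exp (- c * t) * (1 + R * t) powr M))"
    by (intro integrable_mult_right integrable_power_exp_poly) (use assms in auto)
  also have "(\<lambda>t. C * (norm (cpow (of_real 1 - 1) t) * exp (- c * t) * (1 + R * t) powr M))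
      = (\<lambda>t. indicator {0<..} t *\<^sub>R (C * (1 + R * t) powr M * exp (- c * t)))"
  proof
    show "C * (norm (cpow (of_real 1 - 1) t) * exp (- c * t) * (1 + R * t) powr M)
        = indicator {0<..} t *\<^sub>R (C * (1 + R * t) powr M * exp (- c * t))" for t
      by (cases "t > 0") (simp_all add: cpow_0)
  qed
  finally show ?thesis .
qed

lemma laplace_bound:
  fixes G :: "real \<Rightarrow> complex"
  assumes "\<And>t. t > 0 \<Longrightarrow> norm (G t) \<le> C * (1 + R * t) powr M" "Re p \<ge> c"
  shows "norm (indicator {0<..} t *\<^sub>R (G t * exp (- (of_real t * p))))
    \<le> indicator {0<..} t *\<^sub>R (C * (1 + R * t) powr M * exp (- c * t))"
proof (cases "t > 0")
  case True
  have "exp (- (t * Re p)) \<le> exp (- c * t)" using True assms(2) by (simp add: mult.commute)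
  then have "norm (G t) * exp (- (t * Re p)) \<le> C * (1 + R * t) powr M * exp (- c * t)"
    using assms(1)[OF True] by (intro mult_mono) (auto intro: order_trans[OF norm_ge_zero])
  then show ?thesis using True by (simp add: norm_mult)
qed simp

lemma laplace_measurable:
  fixes G :: "real \<Rightarrow> complex"
  assumes "continuous_on {0<..} G"
  shows "(\<lambda>t. indicator {0<..} t *\<^sub>R (G t * exp (- (of_real t * p)))) \<in> borel_measurable lborel"
proof -
  have "(\<lambda>t. indicator {0<..} t *\<^sub>R (G t * exp (- (of_real t * p)))) \<in> borel_measurable borel"
    by (intro borel_measurable_continuous_on_indicator continuous_intros assms) auto
  then show ?thesis by simp
qed

lemma laplace_integrable:
  assumes "continuous_on {0<..} G" "\<And>t. t > 0 \<Longrightarrow> norm (G t) \<le> C * (1 + R * t) powr M"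
    "R \<ge> 0" "M \<ge> 0" "Re p > 0"
  shows "integrable lborel (\<lambda>t. indicator {0<..} t *\<^sub>R (G t * exp (- (of_real t * p))))"
proof (rule Bochner_Integration.integrable_bound)
  show "integrable lborel (\<lambda>t. indicator {0<..} t *\<^sub>R (C * (1 + R * t) powr M * exp (- Re p * t)))"
    using assms by (intro laplace_dominated)
  show "AE t in lborel. norm (indicator {0<..} t *\<^sub>R (G t * exp (- (of_real t * p))))
      \<le> norm (indicator {0<..} t *\<^sub>R (C * (1 + R * t) powr M * exp (- Re p * t)))"
    by (intro AE_I2 order_trans[OF laplace_bound[OF assms(2) order_refl]]) (auto simp: abs_ge_self)
qed (rule laplace_measurable[OF assms(1)])

lemma laplace_holomorphic:
  assumes G: "continuous_on {0<..} G" "\<And>t. t > 0 \<Longrightarrow> norm (G t) \<le> C * (1 + R * t) powr M"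
    "R \<ge> 0" "M \<ge> 0"
  shows "(\<lambda>p. \<integral>t. indicator {0<..} t *\<^sub>R (G t * exp (- (of_real t * p))) \<partial>lborel) holomorphic_on {p. Re p > 0}"
proof -
  have "\<exists>D. ((\<lambda>p. \<integral>t. indicator {0<..} t *\<^sub>R (G t * exp (- (of_real t * p))) \<partial>lborel) has_field_derivative D) (at p)"
    if p: "Re p > 0" for p
  proof (rule exI, rule has_field_derivative_integral)
    show "Re p / 2 > 0" using p by simp
    show "integrable lborel (\<lambda>t. indicator {0<..} t *\<^sub>R (C * (1 + R * t) powr M * exp (- (Re p / 2) * t)))"
      using assms p by (intro laplace_dominated) auto
    fix z assume z: "z \<in> ball p (Re p / 2)"
    \<comment> \<open>The radius Re p / 2 keeps at least half of the exponential decay for every z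
      in the ball.\<close>
    then have "Re z \<ge> Re p / 2"
      using abs_Re_le_cmod[of "p - z"] by (simp add: dist_norm)
    then show "norm (indicator {0<..} t *\<^sub>R (G t * exp (- (of_real t * z))))
      \<le> indicator {0<..} t *\<^sub>R (C * (1 + R * t) powr M * exp (- (Re p / 2) * t))" for t
      using assms(2) by (intro laplace_bound) auto
    show "(\<lambda>t. indicator {0<..} t *\<^sub>R (G t * exp (- (of_real t * z)))) \<in> borel_measurable lborel"
      by (rule laplace_measurable[OF G(1)])
  next
    show "(\<lambda>z. indicator {0<..} t *\<^sub>R (G t * exp (- (of_real t * z)))) holomorphic_on ball p (Re p / 2)" for t
      by (cases "t > 0") (auto intro!: holomorphic_intros)
  qed
  moreover have "open {p. Re p > 0}" by (rule open_halfspace_Re_gt)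
  ultimately show ?thesis by (subst holomorphic_on_open) auto
qed

lemma laplace_along_holomorphic:
  assumes "g holomorphic_on cut_plane" "polynomial_growth g" "0 < d" "d < 2 * pi"
  shows "laplace_along d g holomorphic_on sector d"
proof -
  note cis = cis_not_nonneg[OF assms(3,4)]
  obtain C M where "C \<ge> 0" "M \<ge> 0" "\<And>t. t \<ge> 0 \<Longrightarrow> norm (g (of_real t * cis d)) \<le> C * (1 + norm (cis d) * t) powr M"
    using polynomial_growthE[OF assms(2) cis] by metis
  then have "(\<lambda>p. \<integral>t. indicator {0<..} t *\<^sub>R (g (of_real t * cis d) * exp (- (of_real t * p))) \<partial>lborel)
      holomorphic_on {p. Re p > 0}"
    by (intro laplace_holomorphic[where R = "norm (cis d)" and C = C and M = M] continuous_on_ray assms cis) auto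
  moreover have inv: "(\<lambda>x. cis d / x) holomorphic_on sector d"
    using sector_not_nonneg by (intro holomorphic_intros) force
  ultimately have "(\<lambda>p. \<integral>t. indicator {0<..} t *\<^sub>R (g (of_real t * cis d) * exp (- (of_real t * p))) \<partial>lborel)
      \<circ> (\<lambda>x. cis d / x) holomorphic_on sector d"
    by (intro holomorphic_on_compose_gen) (use sector_Re_pos in auto)
  from holomorphic_on_mult[OF inv this] show ?thesis
  proof (rule holomorphic_transform)
    fix y assume "y \<in> sector d"
    then have "y \<noteq> 0" using sector_not_nonneg by fastforce
    from laplace_along_eq[OF assms(1,3,4) this]
    show "cis d / y * ((\<lambda>p. \<integral>t. indicator {0<..} t *\<^sub>R (g (of_real t * cis d) * exp (- (of_real t * p))) \<partial>lborel)
      \<circ> (\<lambda>x. cis d / x)) y = laplace_along d g y" by (simp only: o_def)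
  qed
qed

text \<open>Integration by parts: with h = \<open>beta_kernel a b\<close>, the product of s h(s x)
  and exp(-s) has as derivative the difference of the two integrands and vanishes at both ends of
  the half line.\<close>

lemma beta_kernel_ibp:
  assumes b: "0 < Re b" "Re b < 2" and x: "x \<notin> \<real>\<^sub>\<ge>\<^sub>0"
  shows "(\<integral>s. indicator {0<..} s *\<^sub>R (borel_branch a b (of_real s * x) * exp (- of_real s)) \<partial>lborel)
    = (\<integral>s. indicator {0<..} s *\<^sub>R (of_real s * beta_kernel a b (of_real s * x) * exp (- of_real s)) \<partial>lborel)"
proof -
  define h g where "h = beta_kernel a b" and "g = borel_branch a b"
  have hg_hol: "h holomorphic_on cut_plane" "g holomorphic_on cut_plane"
    using beta_kernel_holomorphic[OF b] borel_branch_holomorphic[OF b] by (auto simp: h_def g_def)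
  have growth: "polynomial_growth h" "polynomial_growth g"
    using beta_kernel_polynomial_growth[OF b] borel_branch_polynomial_growth[OF b] by (auto simp: h_def g_def)
  have x0: "x \<noteq> 0" using x by auto
  obtain C M where CM: "C \<ge> 0" "M \<ge> 0" "\<And>t. t \<ge> 0 \<Longrightarrow> norm (h (of_real t * x)) \<le> C * (1 + norm x * t) powr M"
    using polynomial_growthE[OF growth(1) x] by metis
  obtain D N where DN: "D \<ge> 0" "N \<ge> 0" "\<And>t. t \<ge> 0 \<Longrightarrow> norm (g (of_real t * x)) \<le> D * (1 + norm x * t) powr N"
    using polynomial_growthE[OF growth(2) x] by metis
  have growth_sh: "polynomial_growth (\<lambda>z. z * h z)" by (rule polynomial_growth_times_id[OF growth(1)])
  obtain C' M' where CM': "C' \<ge> 0" "M' \<ge> 0"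
      "\<And>t. t \<ge> 0 \<Longrightarrow> norm (of_real t * x * h (of_real t * x)) \<le> C' * (1 + norm x * t) powr M'"
    using polynomial_growthE[OF growth_sh x] by metis
  have int_g: "integrable lborel (\<lambda>s. indicator {0<..} s *\<^sub>R (g (of_real s * x) * exp (- (of_real s * 1))))"
    by (rule laplace_integrable[where R = "norm x", OF continuous_on_ray[OF hg_hol(2) x] DN(3)]) (use DN in auto)
  have "integrable lborel (\<lambda>s. indicator {0<..} s *\<^sub>R ((of_real s * x * h (of_real s * x)) * exp (- (of_real s * 1))))"
    by (rule laplace_integrable[where R = "norm x", OF _ CM'(3)])
       (use CM' in \<open>auto intro!: continuous_intros continuous_on_ray[OF hg_hol(1) x]\<close>)
  \<comment> \<open>The growth statement concerns z h(z) at z = s x and so carries a factor x, which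
    is divided out here.\<close>
  then have "integrable lborel (\<lambda>s. (1 / x) * (indicator {0<..} s *\<^sub>R ((of_real s * x * h (of_real s * x)) * exp (- (of_real s * 1)))))"
    by (rule integrable_mult_right)
  then have int_h: "integrable lborel (\<lambda>s. indicator {0<..} s *\<^sub>R (of_real s * h (of_real s * x) * exp (- of_real s)))"
    using x0 by (simp add: mult_ac)
  define F where "F s = of_real s * h (of_real s * x) * exp (- of_real s)" for s :: real
  define F' where "F' s = g (of_real s * x) * exp (- of_real s) - of_real s * h (of_real s * x) * exp (- of_real s)" for s :: real
  have deriv: "(F has_vector_derivative F' s) (at s)" if s: "s > 0" for s
  proof -
    have "((\<lambda>\<xi>. \<xi> * h \<xi>) has_field_derivative g (of_real s * x)) (at (of_real s * x))"
      using borel_branch_derivative[OF b slit_scale[OF x]] s by (simp add: h_def g_def)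
    then have "((\<lambda>z. (z * x) * h (z * x)) has_field_derivative g (of_real s * x) * x) (at (of_real s))"
      by (rule DERIV_chain2) (auto intro!: derivative_eq_intros)
    moreover have "((\<lambda>z. exp (- z)) has_field_derivative - exp (- of_real s)) (at (complex_of_real s))"
      by (auto intro!: derivative_eq_intros)
    ultimately
    have "((\<lambda>z. (z * x) * h (z * x) * exp (- z) / x) has_field_derivative
        (g (of_real s * x) * x * exp (- of_real s) + - exp (- of_real s) * (of_real s * x * h (of_real s * x))) / x)
        (at (of_real s))"
      by (intro DERIV_cdivide DERIV_mult)
    then have "((\<lambda>z. (z * x) * h (z * x) * exp (- z) / x) has_field_derivative F' s) (at (of_real s))"
      by (rule DERIV_cong) (use x0 in \<open>simp add: F'_def field_simps\<close>)
    moreover have "(\<lambda>z. (z * x) * h (z * x) * exp (- z) / x) = (\<lambda>z. z * h (z * x) * exp (- z))"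
      using x0 by (simp add: fun_eq_iff)
    ultimately have "((\<lambda>z. z * h (z * x) * exp (- z)) has_field_derivative F' s) (at (of_real s))" by simp
    from has_vector_derivative_real_field[OF this] show ?thesis by (simp add: F_def[abs_def])
  qed
  have int_F': "set_integrable lborel {0<..} F'"
    using Bochner_Integration.integrable_diff[OF int_g int_h]
    by (simp add: set_integrable_def F'_def scaleR_diff_right)
  obtain K where K: "K > 0" "\<And>s. s \<ge> 0 \<Longrightarrow> (1 + norm x * s) powr M \<le> K * exp (1/2 * s)"
    using powr_le_exp[of "norm x" M "1/2"] CM by auto
  \<comment> \<open>Half of the decay pays for the growth of h; the remaining multiple of (s/2)
    exp(-s/2) tends to 0 at infinity and at 0 alike, so one bound settles both boundary
    terms.\<close>
  have F_bound: "norm (F s) \<le> 2 * C * K * ((s / 2) ^ 1 / exp (s / 2))" if "s > 0" for s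
  proof -
    have "norm (F s) = s * norm (h (of_real s * x)) * exp (- s)"
      using that by (simp add: F_def norm_mult)
    also have "\<dots> \<le> s * (C * (K * exp (1/2 * s))) * exp (- s)"
      using that CM(3)[of s] K(2)[of s] CM(1)
      by (intro mult_right_mono mult_left_mono) (auto intro: order_trans mult_left_mono)
    also have "\<dots> = 2 * C * K * ((s / 2) ^ 1 * (exp (1/2 * s) * exp (- s)))" by simp
    also have "exp (1/2 * s) * exp (- s) = 1 / exp (s / 2)"
    proof -
      have "exp (1/2 * s) * exp (- s) = exp (- (s / 2))" unfolding exp_add[symmetric] by simp
      then show ?thesis by (simp add: exp_minus inverse_eq_divide)
    qed
    finally show ?thesis by simp
  qed
  have half: "filterlim (\<lambda>s::real. s / 2) at_top at_top"
    using filterlim_tendsto_pos_mult_at_top[OF tendsto_const[of "1/2::real"] _ filterlim_ident] by simp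
  have top: "((\<lambda>s. 2 * C * K * ((s / 2) ^ 1 / exp (s / 2))) \<longlongrightarrow> 2 * C * K * 0) at_top"
    by (intro tendsto_mult tendsto_const filterlim_compose[OF tendsto_power_div_exp_0 half])
  have F_top: "(F \<longlongrightarrow> 0) at_top"
    by (rule Lim_null_comparison[OF eventually_mono[OF eventually_gt_at_top[of 0] F_bound]
        top[unfolded mult_zero_right]])
  have "((\<lambda>s. 2 * C * K * ((s / 2) ^ 1 / exp (s / 2))) \<longlongrightarrow> 2 * C * K * ((0 / 2) ^ 1 / exp (0 / 2))) (at_right 0)"
    by (intro tendsto_intros) auto
  also have "2 * C * K * ((0 / 2) ^ 1 / exp (0 / 2)) = (0 :: real)" by simp
  finally have right: "((\<lambda>s. 2 * C * K * ((s / 2) ^ 1 / exp (s / 2))) \<longlongrightarrow> 0) (at_right 0)" .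
  have F_0: "(F \<longlongrightarrow> 0) (at_right 0)"
    by (rule Lim_null_comparison[OF eventually_mono[OF eventually_at_right_less[of 0] F_bound] right])
  have "(LBINT s=0..\<infinity>. F' s) = 0 - 0"
  proof (rule interval_integral_FTC_integrable)
    show "(F has_vector_derivative F' s) (at s)" if "0 < ereal s" for s
      using that by (intro deriv) simp
    show "isCont F' s" if "0 < ereal s" for s
    proof -
      have "continuous_on {0<..} F'"
        unfolding F'_def by (intro continuous_intros continuous_on_ray[OF hg_hol(1) x] continuous_on_ray[OF hg_hol(2) x]) auto
      then show ?thesis using that by (simp add: continuous_on_eq_continuous_at)
    qed
    show "set_integrable lborel (einterval 0 \<infinity>) F'"
      using int_F' by (simp add: zero_ereal_def)
    show "((F \<circ> real_of_ereal) \<longlongrightarrow> 0) (at_right 0)"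
      using F_0 unfolding zero_ereal_def ereal_tendsto_simps .
    show "((F \<circ> real_of_ereal) \<longlongrightarrow> 0) (at_left \<infinity>)"
      using F_top unfolding ereal_tendsto_simps .
  qed simp
  then have "(\<integral>s. indicator {0<..} s *\<^sub>R F' s \<partial>lborel) = 0"
    by (simp add: interval_lebesgue_integral_0_infty set_lebesgue_integral_def)
  also have "(\<integral>s. indicator {0<..} s *\<^sub>R F' s \<partial>lborel)
      = (\<integral>s. indicator {0<..} s *\<^sub>R (g (of_real s * x) * exp (- of_real s)) \<partial>lborel)
      - (\<integral>s. indicator {0<..} s *\<^sub>R (of_real s * h (of_real s * x) * exp (- of_real s)) \<partial>lborel)"
    using int_g int_h by (simp add: F'_def scaleR_diff_right)
  finally show ?thesis by (simp add: h_def g_def)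
qed

text \<open>For x on the half line itself, e^(i d) / x is the real number 1 / \<open>\<rho>\<close>,
  so t = \<open>\<rho>\<close> s is a real substitution. Integration by parts trades the Borel
  transform for s times the Beta kernel, and the Beta-Gamma identity with (1 - s x)^(-a)
  finishes.\<close>

lemma laplace_borel_branch_ray:
  assumes b: "0 < Re b" "Re b < 2" and d: "0 < d" "d < 2 * pi" and \<rho>: "\<rho> > 0"
  shows "laplace_along d (borel_branch a b) (of_real \<rho> * cis d) = euler_integral a b (of_real \<rho> * cis d)"
proof -
  define x where "x = of_real \<rho> * cis d"
  have x: "x \<notin> \<real>\<^sub>\<ge>\<^sub>0"
    using cis_not_nonneg[OF d] nonneg_Reals_divide_I[of x "of_real \<rho>"] \<rho> by (auto simp: x_def)
  have x0: "x \<noteq> 0" using x by auto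
  have p: "cis d / x = 1 / of_real \<rho>" using \<rho> by (simp add: x_def)
  define \<phi> where "\<phi> s = indicator {0<..} s *\<^sub>R (1 - of_real s * x) powr (- a)" for s :: real
  have "\<phi> \<in> borel_measurable borel"
    unfolding \<phi>_def using x
    by (intro borel_measurable_continuous_on_indicator continuous_on_one_minus_powr continuous_intros)
      (auto intro: slit_scale)
  moreover have g\<phi>: "gamma_weight b s * \<phi> s = gamma_weight b s * (1 - of_real s * x) powr (- a)" for s
    by (cases "s > 0") (auto simp: \<phi>_def)
  ultimately have bg: "(\<integral>u. gamma_weight 2 u * (\<integral>t. beta_weight b t * \<phi> (u * t) \<partial>lborel) \<partial>lborel)
      = (\<integral>s. gamma_weight b s * \<phi> s \<partial>lborel) / Gamma b"
    using euler_integrand_integrable[OF b(1) x] by (intro beta_gamma_integral[OF b]) (simp_all add: g\<phi>)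
  have "laplace_along d (borel_branch a b) x = 1 / of_real \<rho> *
     (\<integral>t. indicator {0<..} t *\<^sub>R (borel_branch a b (of_real t * cis d) * exp (- (of_real t * (1 / of_real \<rho>)))) \<partial>lborel)"
    using laplace_along_eq[OF borel_branch_holomorphic[OF b] d x0] unfolding p by simp
  also have "\<dots> = 1 / of_real \<rho> * (\<bar>\<rho>\<bar> *\<^sub>R
     (\<integral>s. indicator {0<..} (0 + \<rho> * s) *\<^sub>R (borel_branch a b (of_real (0 + \<rho> * s) * cis d) *
        exp (- (of_real (0 + \<rho> * s) * (1 / of_real \<rho>)))) \<partial>lborel))"
    using \<rho> by (subst lborel_integral_real_affine[where c = \<rho> and t = 0]) auto
  also have "\<dots> = (\<integral>s. indicator {0<..} s *\<^sub>R (borel_branch a b (of_real s * x) * exp (- of_real s)) \<partial>lborel)"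
  proof -
    have "indicator {0<..} (0 + \<rho> * s) *\<^sub>R (borel_branch a b (of_real (0 + \<rho> * s) * cis d) *
        exp (- (of_real (0 + \<rho> * s) * (1 / of_real \<rho>))))
      = indicator {0<..} s *\<^sub>R (borel_branch a b (of_real s * x) * exp (- of_real s))" for s
      using \<rho> by (simp add: x_def indicator_def zero_less_mult_iff mult_ac)
    then show ?thesis using \<rho> by (simp only: abs_of_pos) (simp add: scaleR_conv_of_real)
  qed
  also have "\<dots> = (\<integral>s. indicator {0<..} s *\<^sub>R (of_real s * beta_kernel a b (of_real s * x) * exp (- of_real s)) \<partial>lborel)"
    by (rule beta_kernel_ibp[OF b x])
  also have "\<dots> = (\<integral>u. gamma_weight 2 u * (\<integral>t. beta_weight b t * \<phi> (u * t) \<partial>lborel) \<partial>lborel)"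
  proof (rule Bochner_Integration.integral_cong[OF refl])
    fix u :: real
    show "indicator {0<..} u *\<^sub>R (of_real u * beta_kernel a b (of_real u * x) * exp (- of_real u))
        = gamma_weight 2 u * (\<integral>t. beta_weight b t * \<phi> (u * t) \<partial>lborel)"
    proof (cases "u > 0")
      case True
      have "beta_weight b t * \<phi> (u * t) = beta_weight b t * (1 - of_real t * (of_real u * x)) powr (- a)" for t
        using True by (cases "t \<in> {0<..<1}") (auto simp: beta_weight_outside \<phi>_def mult_ac)
      then have "beta_kernel a b (of_real u * x) = (\<integral>t. beta_weight b t * \<phi> (u * t) \<partial>lborel)"
        by (simp only: beta_kernel_def stieltjes_def)
      then show ?thesis using True
        by (simp add: gamma_weight_def cpow_eq_powr exp_of_real[symmetric] mult_ac)
    qed simp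
  qed
  also have "\<dots> = euler_integral a b x"
    unfolding bg g\<phi> euler_integral_def ..
  finally show ?thesis by (simp add: x_def)
qed

lemma laplace_borel_branch:
  assumes b: "0 < Re b" "Re b < 2" and d: "0 < d" "d < 2 * pi" and x: "x \<in> sector d"
  shows "laplace_along d (borel_branch a b) x = euler_integral a b x"
proof -
  have ray: "of_real \<rho> * cis d \<in> sector d" if "\<rho> > 0" for \<rho>
    unfolding sector_eq[OF d] using that d by (intro image_eqI[of _ _ "(\<rho>, d)"]) auto
  have "laplace_along d (borel_branch a b) x - euler_integral a b x = 0"
  proof (rule analytic_continuation[where f = "\<lambda>x. laplace_along d (borel_branch a b) x - euler_integral a b x"
        and U = "(\<lambda>\<rho>. of_real \<rho> * cis d) ` {0<..}" and \<xi> = "of_real 1 * cis d"])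
    have "euler_integral a b holomorphic_on sector d"
      by (rule holomorphic_on_subset[OF euler_integral_holomorphic[OF b(1)]]) (auto dest: sector_not_nonneg)
    then show "(\<lambda>x. laplace_along d (borel_branch a b) x - euler_integral a b x) holomorphic_on sector d"
      by (intro holomorphic_intros laplace_along_holomorphic borel_branch_holomorphic
          borel_branch_polynomial_growth b d)
    show "of_real 1 * cis d islimpt (\<lambda>\<rho>. of_real \<rho> * cis d) ` {0<..}"
      unfolding islimpt_approachable
    proof (intro allI impI)
      fix e :: real assume e: "e > 0"
      have "dist (of_real (1 + e/2) * cis d) (of_real 1 * cis d) = norm (of_real (e/2) * cis d)"
        by (simp add: dist_norm algebra_simps)
      also have "\<dots> = e / 2" unfolding norm_mult norm_of_real norm_cis using e by simp
      finally have "dist (of_real (1 + e/2) * cis d) (of_real 1 * cis d) = e / 2" .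
      moreover have "of_real (1 + e/2) * cis d \<in> (\<lambda>\<rho>. of_real \<rho> * cis d) ` {0<..}"
        using e by (intro imageI) simp
      ultimately show "\<exists>x'\<in>(\<lambda>\<rho>. of_real \<rho> * cis d) ` {0<..}. x' \<noteq> of_real 1 * cis d \<and> dist x' (of_real 1 * cis d) < e"
        using e by (intro bexI[of _ "of_real (1 + e/2) * cis d"]) auto
    qed
    show "(\<lambda>\<rho>. of_real \<rho> * cis d) ` {0<..} \<subseteq> sector d" "of_real 1 * cis d \<in> sector d"
      by (use ray in blast) (rule ray, simp)
    show "laplace_along d (borel_branch a b) z - euler_integral a b z = 0"
      if "z \<in> (\<lambda>\<rho>. of_real \<rho> * cis d) ` {0<..}" for z
      using that laplace_borel_branch_ray[OF b d, of _ a] by force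
  qed (fact connected_sector[OF d] open_sector x)+
  then show ?thesis by simp
qed

section \<open>Borel sums without reference to the chosen continuation\<close>

lemma continuation_along_eq:
  assumes g: "g analytic_on half_line d" "g has_fps_expansion G" and z: "z \<in> half_line d"
  shows "continuation_along d G z = g z"
proof -
  define f where "f = continuation_along d G"
  have f: "f analytic_on half_line d" "f has_fps_expansion G"
    using someI[of "\<lambda>g. g analytic_on half_line d \<and> g has_fps_expansion G" g] g
    by (auto simp: f_def continuation_along_def)
  have "(\<lambda>z. f z - g z) analytic_on half_line d" by (intro analytic_intros f g)
  then obtain U where U: "open U" "half_line d \<subseteq> U" "(\<lambda>z. f z - g z) holomorphic_on U"
    unfolding analytic_on_holomorphic by blast
  have hl: "half_line d = (\<lambda>t. of_real t * cis d) ` {0..}" by (auto simp: half_line_def)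
  have conn: "connected (half_line d)"
    unfolding hl by (intro connected_continuous_image continuous_intros) auto
  have 0: "0 \<in> half_line d" unfolding hl by force
  \<comment> \<open>\<open>U\<close> may be disconnected; its component at 0 contains the whole half
    line because the half line is connected, and the identity theorem applies on that
    component.\<close>
  define V where "V = connected_component_set U 0"
  have "half_line d \<subseteq> V" unfolding V_def by (rule connected_component_maximal[OF 0 conn U(2)])
  then have V: "open V" "connected V" "V \<subseteq> U" "half_line d \<subseteq> V"
    using U(1) by (simp_all add: V_def open_connected_component connected_component_subset)
  have "f z - g z = 0"
  proof (rule has_fps_expansion_0_analytic_continuation[where f = "\<lambda>z. f z - g z" and A = V])
    show "(\<lambda>z. f z - g z) has_fps_expansion 0"
      using has_fps_expansion_diff[OF f(2) g(2)] by simp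
    show "(\<lambda>z. f z - g z) holomorphic_on V" using U(3) V(3) by (rule holomorphic_on_subset)
  qed (use V 0 z in auto)
  then show ?thesis by (simp add: f_def)
qed

text \<open>One continuation \<open>g\<close> and one sum \<open>f\<close> serve all directions at
  once. Naming \<open>g\<close> existentially lets relations between parameters be proved for
  functions before passing to the choice made in \<open>borel_sum\<close>.\<close>

definition borel_summable_to :: "complex \<Rightarrow> complex \<Rightarrow> (complex \<Rightarrow> complex) \<Rightarrow> bool" where
  "borel_summable_to a b f \<longleftrightarrow> (\<exists>g. g holomorphic_on cut_plane \<and> polynomial_growth g \<and>
     g has_fps_expansion borel_transform (hyp2F0_fps a b) \<and>
     (\<forall>d x. 0 < d \<longrightarrow> d < 2 * pi \<longrightarrow> x \<in> sector d \<longrightarrow> laplace_along d g x = f x))"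

lemma borel_summable_to_euler:
  "0 < Re b \<Longrightarrow> Re b < 2 \<Longrightarrow> borel_summable_to a b (euler_integral a b)"
  unfolding borel_summable_to_def
  by (intro exI[of _ "borel_branch a b"])
     (auto intro: borel_branch_holomorphic borel_branch_polynomial_growth borel_branch_expansion laplace_borel_branch)

lemma half_line_subset_cut_plane:
  assumes "0 < d" "d < 2 * pi"
  shows "half_line d \<subseteq> cut_plane"
  using slit_scale[OF cis_not_nonneg[OF assms]] by (auto simp: half_line_def)

lemma borel_sum_eq:
  assumes "borel_summable_to a b f" and d: "0 < d" "d < 2 * pi" and x: "x \<in> sector d"
  shows "borel_sum d (hyp2F0_fps a b) x = f x"
proof -
  obtain g where g: "g holomorphic_on cut_plane" "g has_fps_expansion borel_transform (hyp2F0_fps a b)"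
      "laplace_along d g x = f x"
    using assms unfolding borel_summable_to_def by blast
  have "g analytic_on half_line d"
    using g(1) open_cut_plane half_line_subset_cut_plane[OF d]
    by (auto simp: analytic_on_holomorphic)
  then have "continuation_along d (borel_transform (hyp2F0_fps a b)) (of_real t * cis d) = g (of_real t * cis d)"
    if "t \<ge> 0" for t
    using continuation_along_eq[OF _ g(2)] that by (auto simp: half_line_def)
  then have "borel_sum d (hyp2F0_fps a b) x = laplace_along d g x"
    unfolding borel_sum_def laplace_along_def set_lebesgue_integral_def
    by (intro arg_cong2[of _ _ _ _ "(*)"] refl Bochner_Integration.integral_cong) (auto simp: indicator_def)
  with g(3) show ?thesis by simp
qed

lemma laplace_along_integrable:
  assumes g: "g holomorphic_on cut_plane" "polynomial_growth g"
    and d: "0 < d" "d < 2 * pi" and x: "x \<in> sector d"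
  shows "integrable lborel (\<lambda>t. indicator {0<..} t *\<^sub>R (g (of_real t * cis d) * exp (- (of_real t * (cis d / x)))))"
proof -
  note cis = cis_not_nonneg[OF d]
  obtain C M where CM: "C \<ge> 0" "M \<ge> 0" "\<And>t. t \<ge> 0 \<Longrightarrow> norm (g (of_real t * cis d)) \<le> C * (1 + norm (cis d) * t) powr M"
    using polynomial_growthE[OF g(2) cis] by metis
  show ?thesis
    by (rule laplace_integrable[where R = "norm (cis d)" and C = C and M = M])
       (use CM sector_Re_pos[OF x] in \<open>auto intro!: continuous_on_ray[OF g(1) cis]\<close>)
qed

lemma laplace_along_linear:
  assumes f: "f holomorphic_on cut_plane" "polynomial_growth f"
    and g: "g holomorphic_on cut_plane" "polynomial_growth g"
    and d: "0 < d" "d < 2 * pi" and x: "x \<in> sector d"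
  shows "laplace_along d (\<lambda>z. c1 * f z + c2 * g z) x = c1 * laplace_along d f x + c2 * laplace_along d g x"
proof -
  have x0: "x \<noteq> 0" using sector_not_nonneg[OF x] by auto
  have fg: "(\<lambda>z. c1 * f z + c2 * g z) holomorphic_on cut_plane" by (intro holomorphic_intros f g)
  let ?I = "\<lambda>f t. indicator {0<..} t *\<^sub>R (f (of_real t * cis d) * exp (- (of_real t * (cis d / x))))"
  have "(\<integral>t. ?I (\<lambda>z. c1 * f z + c2 * g z) t \<partial>lborel) = (\<integral>t. c1 * ?I f t + c2 * ?I g t \<partial>lborel)"
    by (intro Bochner_Integration.integral_cong refl) (simp add: scaleR_conv_of_real algebra_simps)
  also have "\<dots> = (\<integral>t. c1 * ?I f t \<partial>lborel) + (\<integral>t. c2 * ?I g t \<partial>lborel)"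
    by (intro Bochner_Integration.integral_add integrable_mult_right laplace_along_integrable f g d x)
  also have "\<dots> = c1 * (\<integral>t. ?I f t \<partial>lborel) + c2 * (\<integral>t. ?I g t \<partial>lborel)"
    by (simp only: integral_mult_right_zero)
  finally show ?thesis
    unfolding laplace_along_eq[OF fg d x0] laplace_along_eq[OF f(1) d x0] laplace_along_eq[OF g(1) d x0]
    by (simp only: distrib_left mult.left_commute)
qed

text \<open>Dividing the coefficient identity by (n!)^2 makes it one between Borel transforms;
  analyticity, growth and the Laplace integral are all linear.\<close>

lemma borel_summable_to_linear:
  assumes 1: "borel_summable_to a1 b1 f1" and 2: "borel_summable_to a2 b2 f2"
    and eq: "\<And>n. pochhammer a n * pochhammer b n
      = c1 * (pochhammer a1 n * pochhammer b1 n) + c2 * (pochhammer a2 n * pochhammer b2 n)"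
  shows "borel_summable_to a b (\<lambda>x. c1 * f1 x + c2 * f2 x)"
proof -
  obtain g1 where g1: "g1 holomorphic_on cut_plane" "polynomial_growth g1"
     "g1 has_fps_expansion borel_transform (hyp2F0_fps a1 b1)"
     "\<And>d x. 0 < d \<Longrightarrow> d < 2 * pi \<Longrightarrow> x \<in> sector d \<Longrightarrow> laplace_along d g1 x = f1 x"
    using 1 unfolding borel_summable_to_def by blast
  obtain g2 where g2: "g2 holomorphic_on cut_plane" "polynomial_growth g2"
     "g2 has_fps_expansion borel_transform (hyp2F0_fps a2 b2)"
     "\<And>d x. 0 < d \<Longrightarrow> d < 2 * pi \<Longrightarrow> x \<in> sector d \<Longrightarrow> laplace_along d g2 x = f2 x"
    using 2 unfolding borel_summable_to_def by blast
  have "borel_transform (hyp2F0_fps a b) = fps_const c1 * borel_transform (hyp2F0_fps a1 b1)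
      + fps_const c2 * borel_transform (hyp2F0_fps a2 b2)"
    by (rule fps_ext) (simp add: borel_transform_def hyp2F0_fps_def eq add_divide_distrib)
  then have "(\<lambda>z. c1 * g1 z + c2 * g2 z) has_fps_expansion borel_transform (hyp2F0_fps a b)"
    using g1(3) g2(3) by (auto intro!: fps_expansion_intros)
  moreover have "(\<lambda>z. c1 * g1 z + c2 * g2 z) holomorphic_on cut_plane"
    by (intro holomorphic_intros g1 g2)
  moreover have "polynomial_growth (\<lambda>z. c1 * g1 z + c2 * g2 z)"
    by (intro polynomial_growth_add polynomial_growth_cmult g1 g2)
  moreover have "laplace_along d (\<lambda>z. c1 * g1 z + c2 * g2 z) x = c1 * f1 x + c2 * f2 x"
    if "0 < d" "d < 2 * pi" "x \<in> sector d" for d x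
    using laplace_along_linear[OF g1(1,2) g2(1,2) that] g1(4)[OF that] g2(4)[OF that] by simp
  ultimately show ?thesis unfolding borel_summable_to_def by blast
qed

lemma borel_summable_to_commute: "borel_summable_to a b f \<Longrightarrow> borel_summable_to b a f"
  by (simp add: borel_summable_to_def hyp2F0_fps_def mult.commute)

subsection \<open>Infinite \<open>q\<close>-products\<close>

text \<open>A product majorant makes the double family absolutely summable. It is needed for the
  exchange of sums in Heine's transformation.\<close>

lemma suminf_swap_dominated:
  fixes f :: "nat \<Rightarrow> nat \<Rightarrow> 'a :: banach"
  assumes le: "\<And>n k. norm (f n k) \<le> A n * B k" and A: "summable A" "\<And>n. A n \<ge> 0"
    and B: "summable B" "\<And>n. B n \<ge> 0"
  shows "(\<lambda>n. \<Sum>k. f n k) sums (\<Sum>k. \<Sum>n. f n k)"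
proof -
  have has_sum: "(g has_sum suminf g) UNIV" if "summable (\<lambda>n. norm (g n))" for g :: "nat \<Rightarrow> 'a"
    using norm_summable_imp_has_sum[OF that] summable_norm_cancel[OF that] by (simp add: summable_sums)
  have "(\<lambda>(n, k). A n * B k) summable_on UNIV \<times> UNIV"
  proof (rule summable_on_SigmaI)
    show "((\<lambda>k. case (n, k) of (n, k) \<Rightarrow> A n * B k) has_sum A n * suminf B) UNIV" for n
      using norm_summable_imp_has_sum[of B "suminf B"] B has_sum_cmult_right[of B UNIV "suminf B" "A n"]
      by (simp add: summable_sums)
    have "(\<lambda>n. A n * suminf B) summable_on UNIV"
      by (intro norm_summable_imp_summable_on)
         (use A B in \<open>auto simp: abs_mult suminf_nonneg intro!: summable_mult2\<close>)
    then show "(\<lambda>n. A n * suminf B) summable_on UNIV" .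
  qed (use A B in auto)
  then have "(\<lambda>p. norm ((\<lambda>(n, k). f n k) p)) summable_on UNIV \<times> UNIV"
    by (rule Infinite_Sum.abs_summable_on_comparison_test') (use le in auto)
  then have "(\<lambda>(n, k). f n k) summable_on UNIV \<times> UNIV"
    by (rule abs_summable_summable)
  then have swap: "(\<Sum>\<^sub>\<infinity>n. \<Sum>\<^sub>\<infinity>k. f n k) = (\<Sum>\<^sub>\<infinity>k. \<Sum>\<^sub>\<infinity>n. f n k)"
    by (rule infsum_swap_banach)
  have sk: "summable (\<lambda>k. norm (f n k))" for n
    by (rule summable_comparison_test'[OF summable_mult[OF B(1), of "A n"]]) (use le in auto)
  have sn: "summable (\<lambda>n. norm (f n k))" for k
    by (rule summable_comparison_test'[OF summable_mult2[OF A(1), of "B k"]]) (use le in auto)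
  have bn: "norm (\<Sum>k. f n k) \<le> A n * suminf B" for n
  proof -
    have "norm (\<Sum>k. f n k) \<le> (\<Sum>k. norm (f n k))" by (rule summable_norm[OF sk])
    also have "\<dots> \<le> (\<Sum>k. A n * B k)" by (intro suminf_le le sk summable_mult B)
    finally show ?thesis by (simp add: suminf_mult B)
  qed
  have bk: "norm (\<Sum>n. f n k) \<le> suminf A * B k" for k
  proof -
    have "norm (\<Sum>n. f n k) \<le> (\<Sum>n. norm (f n k))" by (rule summable_norm[OF sn])
    also have "\<dots> \<le> (\<Sum>n. A n * B k)" by (intro suminf_le le sn summable_mult2 A)
    finally show ?thesis by (simp add: suminf_mult2 A)
  qed
  have s1: "summable (\<lambda>n. norm (\<Sum>k. f n k))"
    by (rule summable_comparison_test'[OF summable_mult2[OF A(1), of "suminf B"]]) (use bn in auto)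
  have s2: "summable (\<lambda>k. norm (\<Sum>n. f n k))"
    by (rule summable_comparison_test'[OF summable_mult[OF B(1), of "suminf A"]]) (use bk in auto)
  have "(\<Sum>n. \<Sum>k. f n k) = (\<Sum>k. \<Sum>n. f n k)"
    using swap infsumI[OF has_sum[OF s1]] infsumI[OF has_sum[OF s2]]
    by (simp add: infsumI[OF has_sum[OF sk]] infsumI[OF has_sum[OF sn]])
  then show ?thesis using summable_norm_cancel[OF s1] by (simp add: sums_iff)
qed

lemma qpoch_0 [simp]: "qpoch z q 0 = 1"
  by (simp add: qpoch_def)

lemma qpoch_Suc: "qpoch z q (Suc n) = qpoch z q n * (1 - q ^ n * z)"
  by (simp add: qpoch_def)

lemma qpoch_Suc': "qpoch z q (Suc n) = (1 - z) * qpoch (q * z) q n"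
  unfolding qpoch_def prod.lessThan_Suc_shift by (simp add: mult_ac)

lemma qpoch_add: "qpoch z q (m + n) = qpoch z q m * qpoch (q ^ m * z) q n"
proof (induction m arbitrary: z)
  case (Suc m)
  have "q ^ m * (q * z) = q ^ Suc m * z" by (simp add: mult_ac)
  then show ?case using Suc[of "q * z"] by (simp only: add_Suc qpoch_Suc' mult.assoc)
qed simp

locale q_base =
  fixes q :: real
  assumes q: "0 < q" "q < 1"
begin

abbreviation Q :: complex where "Q \<equiv> complex_of_real q"

definition qinf :: "complex \<Rightarrow> complex" where
  "qinf z = lim (\<lambda>n. qpoch z Q n)"

text \<open>On a disc of radius R the n-th factor differs from 1 by at most R q^n, so the M-test
  applies; local uniformity makes the limit (z; q)_\<infinity> entire.\<close>

lemma qpoch_uniform_limit: "uniform_limit (cball 0 R) (\<lambda>n z. qpoch z Q n) qinf sequentially"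
proof -
  have "uniformly_convergent_on (cball 0 R) (\<lambda>N z. \<Prod>n<N. 1 + (- (Q ^ n * z)))"
  proof (rule uniformly_convergent_on_prod)
    show "uniformly_convergent_on (cball 0 R) (\<lambda>N x. \<Sum>n<N. norm (- (Q ^ n * x)))"
    proof (rule Weierstrass_m_test')
      show "norm (norm (- (Q ^ n * x))) \<le> R * q ^ n" if "x \<in> cball 0 R" for n x
        using that q by (simp add: norm_mult norm_power mult.commute mult_right_mono)
      show "summable (\<lambda>n. R * q ^ n)" using q by (intro summable_mult summable_geometric) auto
    qed
  qed (auto intro!: continuous_intros)
  also have "(\<lambda>N z. \<Prod>n<N. 1 + (- (Q ^ n * z))) = (\<lambda>n z. qpoch z Q n)"
    by (simp add: qpoch_def)
  finally show ?thesis
    by (simp only: uniformly_convergent_uniform_limit_iff qinf_def[abs_def])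
qed

lemma qpoch_LIMSEQ: "(\<lambda>n. qpoch z Q n) \<longlonglongrightarrow> qinf z"
  by (rule tendsto_uniform_limitI[OF qpoch_uniform_limit[of "norm z"]]) simp

lemma qinf_holomorphic: "qinf holomorphic_on UNIV"
proof -
  have "qinf holomorphic_on ball 0 R" for R
  proof -
    have "continuous_on (cball 0 R) qinf \<and> qinf holomorphic_on ball 0 R"
      by (rule holomorphic_uniform_limit[OF _ qpoch_uniform_limit])
         (auto simp: qpoch_def intro!: always_eventually continuous_intros holomorphic_intros)
    then show ?thesis by simp
  qed
  from holomorphic_on_imp_differentiable_at[OF this open_ball] have "qinf field_differentiable at z" for z
    using gt_ex[of "norm z"] by auto
  then show ?thesis by (simp add: holomorphic_on_def)
qed

lemma qinf_0 [simp]: "qinf 0 = 1"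
  by (rule LIMSEQ_unique[OF qpoch_LIMSEQ]) (simp add: qpoch_def)

lemma qinf_split: "qinf z = qpoch z Q n * qinf (Q ^ n * z)"
proof (rule LIMSEQ_unique)
  show "(\<lambda>m. qpoch z Q (n + m)) \<longlonglongrightarrow> qinf z"
    using LIMSEQ_ignore_initial_segment[OF qpoch_LIMSEQ, of z n] by (simp add: add.commute)
  show "(\<lambda>m. qpoch z Q (n + m)) \<longlonglongrightarrow> qpoch z Q n * qinf (Q ^ n * z)"
    unfolding qpoch_add by (intro tendsto_intros qpoch_LIMSEQ)
qed

text \<open>From 1 + y <= exp y and the geometric series. The bound is free of n and passes to the
  infinite product.\<close>

lemma norm_qpoch_le: "norm (qpoch z Q n) \<le> exp (norm z / (1 - q))"
proof -
  have "norm (qpoch z Q n) \<le> (\<Prod>k<n. 1 + q ^ k * norm z)"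
    unfolding qpoch_def prod_norm[symmetric]
  proof (rule prod_mono, intro conjI)
    fix k
    show "norm (1 - Q ^ k * z) \<le> 1 + q ^ k * norm z"
      using norm_triangle_ineq4[of 1 "Q ^ k * z"] q by (simp add: norm_mult norm_power)
  qed simp
  also have "\<dots> \<le> (\<Prod>k<n. exp (q ^ k * norm z))"
    using q by (intro prod_mono) auto
  also have "\<dots> = exp (norm z * (\<Sum>k<n. q ^ k))"
    by (simp add: exp_sum[symmetric] sum_distrib_left mult.commute)
  also have "\<dots> \<le> exp (norm z * (1 / (1 - q)))"
  proof -
    have "(\<Sum>k<n. q ^ k) \<le> (\<Sum>k. q ^ k)"
      using q by (intro sum_le_suminf summable_geometric) auto
    also have "\<dots> = 1 / (1 - q)" using q by (intro suminf_geometric) auto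
    finally show ?thesis using mult_left_mono[of _ _ "norm z"] by fastforce
  qed
  finally show ?thesis by simp
qed

lemma norm_qinf_le: "norm (qinf z) \<le> exp (norm z / (1 - q))"
  by (rule LIMSEQ_le_const2[OF tendsto_norm[OF qpoch_LIMSEQ]]) (use norm_qpoch_le in auto)

lemma qpoch_Q_nonzero: "qpoch Q Q n \<noteq> 0"
proof -
  have "Q ^ k * Q \<noteq> 1" for k
  proof -
    have "q ^ Suc k < 1" using q by (intro power_Suc_less_one) auto
    then have "Q ^ Suc k \<noteq> 1" by (metis less_irrefl of_real_1 of_real_eq_iff of_real_power)
    then show ?thesis by (simp add: mult.commute)
  qed
  then show ?thesis by (auto simp: qpoch_def)
qed

text \<open>The \<open>q\<close>-binomial coefficients; the recursion below turns into the functional equation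
  \<open>(1 - z) S z = (1 - \<alpha> z) S (q z)\<close> of their generating function.\<close>
definition qbin :: "complex \<Rightarrow> nat \<Rightarrow> complex" where
  "qbin \<alpha> n = qpoch \<alpha> Q n / qpoch Q Q n"

lemma qbin_Suc: "qbin \<alpha> (Suc n) * (1 - Q ^ Suc n) = qbin \<alpha> n * (1 - \<alpha> * Q ^ n)"
proof -
  have "1 - Q ^ n * Q \<noteq> 0" using qpoch_Q_nonzero[of "Suc n"] by (simp add: qpoch_Suc)
  then show ?thesis using qpoch_Q_nonzero[of n] by (simp add: qbin_def qpoch_Suc field_simps)
qed

lemma qbin_norm_summable:
  assumes z: "norm z < 1"
  shows "summable (\<lambda>n. norm (qbin \<alpha> n * z ^ n))"
proof -
  have "(\<lambda>n. norm (1 - \<alpha> * Q ^ n) / norm (1 - Q ^ Suc n) * norm z) \<longlonglongrightarrow> norm (1 - \<alpha> * 0) / norm (1 - 0 :: complex) * norm z"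
    using q by (intro tendsto_intros LIMSEQ_Suc LIMSEQ_power_zero) auto
  \<comment> \<open>The ratio of consecutive terms tends to |z|; the midpoint between |z| and 1
    serves as the ratio in the test.\<close>
  moreover define c where "c = (1 + norm z) / 2"
  moreover have "norm z < c" "c < 1" using z by (auto simp: c_def)
  ultimately have "\<forall>\<^sub>F n in sequentially. norm (1 - \<alpha> * Q ^ n) / norm (1 - Q ^ Suc n) * norm z < c"
    by (intro order_tendstoD(2)) auto
  then obtain N where N: "\<And>n. n \<ge> N \<Longrightarrow> norm (1 - \<alpha> * Q ^ n) / norm (1 - Q ^ Suc n) * norm z < c"
    by (auto simp: eventually_sequentially)
  show ?thesis
  proof (rule summable_ratio_test[OF \<open>c < 1\<close>])
    fix n assume "n \<ge> N"
    have nz: "1 - Q ^ Suc n \<noteq> 0" using qpoch_Q_nonzero[of "Suc n"] by (simp add: qpoch_Suc mult.commute)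
    have "norm (norm (qbin \<alpha> (Suc n) * z ^ Suc n)) = norm (qbin \<alpha> (Suc n)) * norm z * norm (z ^ n)"
      by (simp add: norm_mult)
    also have "norm (qbin \<alpha> (Suc n)) = norm (qbin \<alpha> n) * norm (1 - \<alpha> * Q ^ n) / norm (1 - Q ^ Suc n)"
    proof -
      have "norm (qbin \<alpha> (Suc n)) * norm (1 - Q ^ Suc n) = norm (qbin \<alpha> n) * norm (1 - \<alpha> * Q ^ n)"
        using arg_cong[OF qbin_Suc[of \<alpha> n], of norm] by (simp only: norm_mult)
      then show ?thesis using nz by (simp add: eq_divide_eq del: power_Suc)
    qed
    finally have "norm (norm (qbin \<alpha> (Suc n) * z ^ Suc n))
        = (norm (1 - \<alpha> * Q ^ n) / norm (1 - Q ^ Suc n) * norm z) * norm (qbin \<alpha> n * z ^ n)"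
      by (simp add: norm_mult del: power_Suc)
    also have "\<dots> \<le> c * norm (qbin \<alpha> n * z ^ n)"
      using N[OF \<open>n \<ge> N\<close>] by (intro mult_right_mono) auto
    finally show "norm (norm (qbin \<alpha> (Suc n) * z ^ Suc n)) \<le> c * norm (norm (qbin \<alpha> n * z ^ n))" by simp
  qed
qed

lemma qbin_functional_equation:
  fixes \<alpha> :: complex
  assumes z: "norm z < 1"
  defines "S \<equiv> \<lambda>z. \<Sum>n. qbin \<alpha> n * z ^ n"
  shows "(1 - z) * S z = (1 - \<alpha> * z) * S (Q * z)"
proof -
  have qz: "norm (Q * z) < 1" using mult_right_mono[of q 1 "norm z"] z q by (simp add: norm_mult)
  have 1: "(\<lambda>n. qbin \<alpha> n * z ^ n) sums S z"
    using summable_norm_cancel[OF qbin_norm_summable[OF z]] by (simp add: S_def summable_sums)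
  have 2: "(\<lambda>n. qbin \<alpha> n * (Q * z) ^ n) sums S (Q * z)"
    using summable_norm_cancel[OF qbin_norm_summable[OF qz]] by (simp add: S_def summable_sums)
  have "(\<lambda>n. qbin \<alpha> (Suc n) * z ^ Suc n - qbin \<alpha> (Suc n) * (Q * z) ^ Suc n) sums (S z - S (Q * z))"
    using sums_diff[OF 1 2] by (subst sums_Suc_iff) simp
  moreover have "qbin \<alpha> (Suc n) * z ^ Suc n - qbin \<alpha> (Suc n) * (Q * z) ^ Suc n
      = z * (qbin \<alpha> n * z ^ n - \<alpha> * (qbin \<alpha> n * (Q * z) ^ n))" for n
  proof -
    have "qbin \<alpha> (Suc n) * z ^ Suc n - qbin \<alpha> (Suc n) * (Q * z) ^ Suc n
        = (qbin \<alpha> (Suc n) * (1 - Q ^ Suc n)) * z ^ Suc n"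
      by (simp add: power_mult_distrib algebra_simps)
    also have "\<dots> = z * (qbin \<alpha> n * z ^ n - \<alpha> * (qbin \<alpha> n * (Q * z) ^ n))"
      unfolding qbin_Suc by (simp add: power_mult_distrib algebra_simps)
    finally show ?thesis .
  qed
  moreover have "(\<lambda>n. z * (qbin \<alpha> n * z ^ n - \<alpha> * (qbin \<alpha> n * (Q * z) ^ n))) sums (z * (S z - \<alpha> * S (Q * z)))"
    by (intro sums_mult sums_diff 1 2)
  ultimately have "S z - S (Q * z) = z * (S z - \<alpha> * S (Q * z))"
    using sums_unique2 by auto
  then show ?thesis by (simp add: algebra_simps)
qed

text \<open>Iterating the functional equation n times moves the argument to q^n z; the series is
  continuous at 0 with value 1, and the factors collected on the way converge to the two infinite
  products.\<close>

lemma q_binomial: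
  assumes z: "norm z < 1"
  shows "qinf z * (\<Sum>n. qbin \<alpha> n * z ^ n) = qinf (\<alpha> * z)"
proof -
  define S where "S z = (\<Sum>n. qbin \<alpha> n * z ^ n)" for z
  have small: "norm (Q ^ n * z) < 1" for n
  proof -
    have "q ^ n * norm z \<le> 1 * norm z" using q by (intro mult_right_mono power_le_one) auto
    then show ?thesis using z q by (simp add: norm_mult norm_power)
  qed
  have iter: "qpoch z Q n * S z = qpoch (\<alpha> * z) Q n * S (Q ^ n * z)" for n
  proof (induction n)
    case (Suc n)
    have "qpoch z Q (Suc n) * S z = (1 - Q ^ n * z) * (qpoch (\<alpha> * z) Q n * S (Q ^ n * z))"
      unfolding Suc.IH[symmetric] by (simp add: qpoch_Suc)
    also have "\<dots> = qpoch (\<alpha> * z) Q n * ((1 - Q ^ n * z) * S (Q ^ n * z))" by simp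
    also have "(1 - Q ^ n * z) * S (Q ^ n * z) = (1 - \<alpha> * (Q ^ n * z)) * S (Q * (Q ^ n * z))"
      unfolding S_def by (rule qbin_functional_equation[OF small])
    finally show ?case by (simp add: qpoch_Suc mult_ac)
  qed simp
  have "isCont S 0"
    unfolding S_def
  proof (rule isCont_powser)
    show "summable (\<lambda>n. qbin \<alpha> n * (1/2) ^ n)"
      by (rule summable_norm_cancel[OF qbin_norm_summable]) simp
  qed simp
  moreover have "(\<lambda>n. Q ^ n * z) \<longlonglongrightarrow> 0 * z"
    using q by (intro tendsto_intros LIMSEQ_power_zero) auto
  ultimately have "(\<lambda>n. S (Q ^ n * z)) \<longlonglongrightarrow> S 0"
    by (intro isCont_tendsto_compose[where g = S and l = 0]) simp_all
  moreover have "S 0 = 1" unfolding S_def by (subst powser_zero) (simp add: qbin_def)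
  ultimately have "(\<lambda>n. qpoch (\<alpha> * z) Q n * S (Q ^ n * z)) \<longlonglongrightarrow> qinf (\<alpha> * z) * 1"
    by (intro tendsto_mult qpoch_LIMSEQ) simp
  then have "(\<lambda>n. qpoch z Q n * S z) \<longlonglongrightarrow> qinf (\<alpha> * z)" by (simp add: iter)
  moreover have "(\<lambda>n. qpoch z Q n * S z) \<longlonglongrightarrow> qinf z * S z" by (intro tendsto_intros qpoch_LIMSEQ)
  ultimately show ?thesis unfolding S_def by (rule LIMSEQ_unique[rotated])
qed

text \<open>After finitely many factors the argument has modulus below 1, and there the q-binomial
  theorem with \<alpha> = 0 exhibits an inverse.\<close>

lemma qinf_nonzero:
  assumes "\<And>k. Q ^ k * z \<noteq> 1"
  shows "qinf z \<noteq> 0"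
proof -
  have "(\<lambda>n. Q ^ n * z) \<longlonglongrightarrow> 0 * z"
    using q by (intro tendsto_intros LIMSEQ_power_zero) auto
  then have "(\<lambda>n. norm (Q ^ n * z)) \<longlonglongrightarrow> 0" by (simp add: tendsto_norm_zero)
  then have "\<forall>\<^sub>F n in sequentially. norm (Q ^ n * z) < 1" by (rule order_tendstoD) simp
  then obtain n where "norm (Q ^ n * z) < 1" by (auto simp: eventually_sequentially)
  then have "qinf (Q ^ n * z) \<noteq> 0" using q_binomial[of "Q ^ n * z" 0] by auto
  moreover have "qpoch z Q n \<noteq> 0" using assms by (auto simp: qpoch_def)
  ultimately show ?thesis by (simp add: qinf_split[of z n])
qed

lemma qinf_nonzero_small: "norm z < 1 \<Longrightarrow> qinf z \<noteq> 0"
  using q_binomial[of z 0] by auto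

text \<open>Heine's transformation: expanding \<open>(\<beta>; q)\<^sub>n\<close> by the \<open>q\<close>-binomial theorem and summing over
  \<open>n\<close> first; multiplication with \<open>qinf z\<close> removes the poles.\<close>
definition heine_num :: "complex \<Rightarrow> complex \<Rightarrow> complex \<Rightarrow> complex" where
  "heine_num \<alpha> \<beta> z = qinf \<beta> * (\<Sum>k. qbin 0 k * \<beta> ^ k * (qpoch z Q k * qinf (\<alpha> * (Q ^ k * z))))"

lemma norm_Q_power_le: "norm (Q ^ k * z) \<le> norm z"
  using q power_le_one[of q k] by (simp add: norm_mult norm_power mult_left_le_one_le)

lemma heine_term_bound:
  assumes "norm z \<le> R"
  shows "norm (qbin 0 k * \<beta> ^ k * (qpoch z Q k * qinf (\<alpha> * (Q ^ k * z))))
    \<le> norm (qbin 0 k * \<beta> ^ k) * (exp (R / (1 - q)) * exp (norm \<alpha> * R / (1 - q)))"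
proof -
  have "norm (qpoch z Q k) \<le> exp (R / (1 - q))"
    using assms q norm_qpoch_le[of z k] by (elim order_trans) (simp add: divide_right_mono)
  moreover have "norm (qinf (\<alpha> * (Q ^ k * z))) \<le> exp (norm \<alpha> * R / (1 - q))"
  proof -
    have "norm (\<alpha> * (Q ^ k * z)) \<le> norm \<alpha> * R"
      using norm_Q_power_le[of k z] assms by (simp only: norm_mult[of \<alpha>]) (intro mult_left_mono, auto)
    then show ?thesis using norm_qinf_le[of "\<alpha> * (Q ^ k * z)"] q
      by (elim order_trans) (simp add: divide_right_mono)
  qed
  ultimately show ?thesis unfolding norm_mult[of "qbin 0 k * \<beta> ^ k"] norm_mult[of "qpoch z Q k"]
    by (intro mult_left_mono mult_mono) auto
qed

text \<open>On each disc the entire factors are bounded independently of k, and the coefficients are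
  absolutely summable because |\<beta>| < 1; the series of entire functions converges locally
  uniformly.\<close>

lemma heine_num_holomorphic:
  assumes \<beta>: "norm \<beta> < 1"
  shows "heine_num \<alpha> \<beta> holomorphic_on UNIV"
proof -
  let ?t = "\<lambda>k z. qbin 0 k * \<beta> ^ k * (qpoch z Q k * qinf (\<alpha> * (Q ^ k * z)))"
  have hol: "(\<lambda>z. ?t k z) holomorphic_on A" for k A
    unfolding qpoch_def
    by (intro holomorphic_intros holomorphic_on_compose_gen[OF _ qinf_holomorphic, unfolded o_def]) auto
  have "(\<lambda>z. \<Sum>k. ?t k z) holomorphic_on ball 0 R" for R
  proof -
    have "uniform_limit (cball 0 R) (\<lambda>n z. \<Sum>k<n. ?t k z) (\<lambda>z. \<Sum>k. ?t k z) sequentially"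
    proof (rule Weierstrass_m_test)
      show "norm (?t k z) \<le> norm (qbin 0 k * \<beta> ^ k) * (exp (R / (1 - q)) * exp (norm \<alpha> * R / (1 - q)))"
        if "z \<in> cball 0 R" for k z using that by (intro heine_term_bound) simp
      show "summable (\<lambda>k. norm (qbin 0 k * \<beta> ^ k) * (exp (R / (1 - q)) * exp (norm \<alpha> * R / (1 - q))))"
        by (intro summable_mult2 qbin_norm_summable \<beta>)
    qed
    then have "continuous_on (cball 0 R) (\<lambda>z. \<Sum>k. ?t k z) \<and> (\<lambda>z. \<Sum>k. ?t k z) holomorphic_on ball 0 R"
      by (rule holomorphic_uniform_limit[rotated])
         (auto intro!: always_eventually holomorphic_on_imp_continuous_on holomorphic_on_sum hol)
    then show ?thesis by simp
  qed
  from holomorphic_on_imp_differentiable_at[OF this open_ball]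
  have "(\<lambda>z. \<Sum>k. ?t k z) field_differentiable at z" for z
    using gt_ex[of "norm z"] by auto
  then have "(\<lambda>z. \<Sum>k. ?t k z) holomorphic_on UNIV" by (simp add: holomorphic_on_def)
  then show ?thesis unfolding heine_num_def[abs_def] by (intro holomorphic_intros)
qed

text \<open>Off the poles, (z; q)_k is the quotient of \<open>qinf z\<close> by
  \<open>qinf (Q ^ k * z)\<close>, so \<open>qinf z\<close> factors out of every term.\<close>

lemma heine_num_eq:
  assumes \<beta>: "norm \<beta> < 1" and z: "\<And>k. Q ^ k * z \<noteq> 1"
  shows "summable (\<lambda>k. norm (qbin 0 k * \<beta> ^ k * (qinf (\<alpha> * (Q ^ k * z)) / qinf (Q ^ k * z))))"
    and "heine_num \<alpha> \<beta> z / qinf z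
      = qinf \<beta> * (\<Sum>k. qbin 0 k * \<beta> ^ k * (qinf (\<alpha> * (Q ^ k * z)) / qinf (Q ^ k * z)))"
proof -
  let ?f = "\<lambda>k. qbin 0 k * \<beta> ^ k * (qinf (\<alpha> * (Q ^ k * z)) / qinf (Q ^ k * z))"
  let ?t = "\<lambda>k. qbin 0 k * \<beta> ^ k * (qpoch z Q k * qinf (\<alpha> * (Q ^ k * z)))"
  have nz: "qinf z \<noteq> 0" by (rule qinf_nonzero[OF z])
  have "qpoch z Q k * qinf (\<alpha> * (Q ^ k * z)) = qinf z * (qinf (\<alpha> * (Q ^ k * z)) / qinf (Q ^ k * z))" for k
    using nz qinf_split[of z k] by auto
  then have eq: "?t = (\<lambda>k. qinf z * ?f k)" by (simp add: mult_ac)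
  have "summable (\<lambda>k. norm (?t k))"
  proof (rule summable_comparison_test')
    show "summable (\<lambda>k. norm (qbin 0 k * \<beta> ^ k) * (exp (norm z / (1 - q)) * exp (norm \<alpha> * norm z / (1 - q))))"
      by (intro summable_mult2 qbin_norm_summable \<beta>)
  qed (simp only: real_norm_def abs_norm_cancel, intro heine_term_bound order_refl)
  moreover have "norm (?t k) = norm (qinf z) * norm (?f k)" for k
    using fun_cong[OF eq, of k] by (simp only: norm_mult[of "qinf z"])
  ultimately have "summable (\<lambda>k. norm (qinf z) * norm (?f k))" by (simp only:)
  then show norm_f: "summable (\<lambda>k. norm (?f k))" using nz by (subst (asm) summable_cmult_iff) simp
  then have f: "summable ?f" by (rule summable_norm_cancel)
  have "suminf ?t = qinf z * suminf ?f" unfolding eq by (rule suminf_mult[OF f])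
  then show "heine_num \<alpha> \<beta> z / qinf z = qinf \<beta> * suminf ?f"
    using nz by (simp add: heine_num_def)
qed

end

subsection \<open>The meromorphic continuation\<close>

text \<open>After removal of singularities the difference vanishes near 0, hence everywhere, so the
  functions agree on a punctured neighbourhood of each point. The normalisation, 0 at poles and the
  limit elsewhere, then forces equality at the point itself.\<close>

lemma nicely_meromorphic_fps_unique:
  assumes F: "F nicely_meromorphic_on UNIV" "F has_fps_expansion A"
    and G: "G nicely_meromorphic_on UNIV" "G has_fps_expansion A"
  shows "F = G"
proof
  fix z
  have mero: "(\<lambda>z. F z - G z) meromorphic_on UNIV"
    using F(1) G(1) by (intro meromorphic_intros) (auto simp: nicely_meromorphic_on_def)
  have iso: "isolated_singularity_at (\<lambda>z. F z - G z) w" for w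
    using mero by (meson UNIV_I meromorphic_on_isolated_singularity meromorphic_on_subset subset_UNIV)
  have ev: "\<forall>\<^sub>F w in at z. remove_sings (\<lambda>z. F z - G z) w = F w - G w" for z
    by (rule eventually_remove_sings_eq_at[OF iso])
  have "(\<lambda>z. F z - G z) has_fps_expansion 0"
    using has_fps_expansion_diff[OF F(2) G(2)] by simp
  then have "\<forall>\<^sub>F w in nhds 0. F w - G w = 0"
    by (auto simp: has_fps_expansion_def elim: eventually_mono)
  then have "\<forall>\<^sub>F w in at 0. F w - G w = 0"
    by (simp add: eventually_nhds_conv_at)
  with ev[of 0] have "\<forall>\<^sub>F w in at 0. remove_sings (\<lambda>z. F z - G z) w = 0"
    by eventually_elim simp
  then have "\<exists>\<^sub>F w in at 0. remove_sings (\<lambda>z. F z - G z) w = 0"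
    by (intro eventually_frequently) auto
  then have zero: "remove_sings (\<lambda>z. F z - G z) w = 0" for w
    by (rule frequently_eq_meromorphic_imp_constant[OF _ remove_sings_nicely_meromorphic[OF mero]
        open_UNIV connected_UNIV UNIV_I UNIV_I])
  have eq: "\<forall>\<^sub>F w in at z. F w = G w"
    using ev[of z] by eventually_elim (simp add: zero)
  have pole: "is_pole F z \<longleftrightarrow> is_pole G z"
    using eq by (intro is_pole_cong) auto
  have F': "is_pole F z \<and> F z = 0 \<or> F \<midarrow>z\<rightarrow> F z" and G': "is_pole G z \<and> G z = 0 \<or> G \<midarrow>z\<rightarrow> G z"
    using F(1) G(1) by (auto simp: nicely_meromorphic_on_def)
  show "F z = G z"
  proof (cases "is_pole F z")
    case True
    have "\<not> f \<midarrow>z\<rightarrow> c" if "is_pole f z" for f :: "complex \<Rightarrow> complex" and c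
      using that not_tendsto_and_filterlim_at_infinity[of "at z" f c] by (auto simp: is_pole_def)
    then show ?thesis using True pole F' G' by auto
  next
    case False
    then have "F \<midarrow>z\<rightarrow> F z" "G \<midarrow>z\<rightarrow> G z" using pole F' G' by auto
    then show ?thesis using tendsto_cong[OF eq] LIM_unique by blast
  qed
qed

text \<open>The description defining \<open>Phi\<close> says something only once a continuation
  exists. Existence is recorded here together with analyticity off the positive axis, where
  \<open>Phi\<close> can be computed with pointwise.\<close>

definition Phi_regular :: "complex \<Rightarrow> complex \<Rightarrow> real \<Rightarrow> bool" where
  "Phi_regular a b q \<longleftrightarrow> Phi a b q nicely_meromorphic_on UNIV \<and>
     Phi a b q has_fps_expansion Phi_fps a b q \<and> Phi a b q analytic_on - \<real>\<^sub>\<ge>\<^sub>0"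

text \<open>Removing singularities normalises a meromorphic \<open>F\<close> and changes nothing
  where \<open>F\<close> is analytic, in particular near 0 and off the positive axis; uniqueness
  identifies the result with \<open>Phi\<close>.\<close>

lemma Phi_eqI:
  assumes "F meromorphic_on UNIV" "F has_fps_expansion Phi_fps a b q" "F analytic_on - \<real>\<^sub>\<ge>\<^sub>0"
  shows "Phi_regular a b q" and "x \<notin> \<real>\<^sub>\<ge>\<^sub>0 \<Longrightarrow> Phi a b q x = F x"
proof -
  define G where "G = remove_sings F"
  have nice: "G nicely_meromorphic_on UNIV"
    unfolding G_def by (rule remove_sings_nicely_meromorphic[OF assms(1)])
  have "F analytic_on {0}" by (rule has_fps_expansion_imp_analytic_0[OF assms(2)])
  then obtain S where S: "open S" "0 \<in> S" "F holomorphic_on S" unfolding analytic_at by blast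
  then have "\<forall>\<^sub>F w in nhds 0. w \<in> S" by (intro eventually_nhds_in_open)
  then have "\<forall>\<^sub>F w in nhds 0. F analytic_on {w}"
    by eventually_elim (use S in \<open>auto simp: analytic_at\<close>)
  then have "\<forall>\<^sub>F w in nhds 0. F w = G w"
    by eventually_elim (simp add: G_def remove_sings_at_analytic)
  then have fps: "G has_fps_expansion Phi_fps a b q"
    using assms(2) has_fps_expansion_cong[OF _ refl] by blast
  have Phi: "Phi a b q = G"
    unfolding Phi_def
    by (rule the_equality) (use nice fps nicely_meromorphic_fps_unique in blast)+
  have eq: "G x = F x" if "x \<notin> \<real>\<^sub>\<ge>\<^sub>0" for x
    using assms(3) that by (auto simp: G_def intro!: remove_sings_at_analytic analytic_on_subset[OF assms(3)])
  have "open (- \<real>\<^sub>\<ge>\<^sub>0 :: complex set)" by (simp add: open_Compl)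
  then have "G analytic_on - \<real>\<^sub>\<ge>\<^sub>0"
    using holomorphic_transform[OF analytic_imp_holomorphic[OF assms(3)], of G] eq
    by (simp add: analytic_on_open)
  then show "Phi_regular a b q" using nice fps by (simp add: Phi_regular_def Phi)
  show "x \<notin> \<real>\<^sub>\<ge>\<^sub>0 \<Longrightarrow> Phi a b q x = F x" by (simp add: Phi eq)
qed

text \<open>A linear relation between the power series extends to the continuations. It is asserted
  off the positive axis, where all three are analytic and no normalised pole values can break
  additivity.\<close>

lemma Phi_linear:
  assumes 1: "Phi_regular a1 b1 q" and 2: "Phi_regular a2 b2 q"
    and eq: "Phi_fps a b q = fps_const c1 * Phi_fps a1 b1 q + fps_const c2 * Phi_fps a2 b2 q"
  shows "Phi_regular a b q"
    and "x \<notin> \<real>\<^sub>\<ge>\<^sub>0 \<Longrightarrow> Phi a b q x = c1 * Phi a1 b1 q x + c2 * Phi a2 b2 q x"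
proof -
  have *: "(\<lambda>x. c1 * Phi a1 b1 q x + c2 * Phi a2 b2 q x) meromorphic_on UNIV"
    "(\<lambda>x. c1 * Phi a1 b1 q x + c2 * Phi a2 b2 q x) has_fps_expansion Phi_fps a b q"
    "(\<lambda>x. c1 * Phi a1 b1 q x + c2 * Phi a2 b2 q x) analytic_on - \<real>\<^sub>\<ge>\<^sub>0"
    using 1 2 unfolding Phi_regular_def eq
    by (auto intro!: meromorphic_intros fps_expansion_intros analytic_intros simp: nicely_meromorphic_on_def)
  show "Phi_regular a b q" by (rule Phi_eqI(1)[OF *])
  show "x \<notin> \<real>\<^sub>\<ge>\<^sub>0 \<Longrightarrow> Phi a b q x = c1 * Phi a1 b1 q x + c2 * Phi a2 b2 q x"
    by (rule Phi_eqI(2)[OF *])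
qed

section \<open>Heine's transformation and the continued \<open>Phi\<close>\<close>

context q_base begin

lemma heine_sums:
  assumes \<beta>: "norm \<beta> < 1" and z: "norm z < 1"
  shows "(\<lambda>n. qbin \<alpha> n * qpoch \<beta> Q n * z ^ n) sums (heine_num \<alpha> \<beta> z / qinf z)"
proof -
  \<comment> \<open>The q-binomial theorem with \<alpha> = 0 expands (\<beta>; q)_n, which is the
    quotient of \<open>qinf \<beta>\<close> by \<open>qinf (Q ^ n * \<beta>)\<close>, in powers of
    q^n \<beta>.\<close>
  define f where "f n k = qbin \<alpha> n * z ^ n * (qinf \<beta> * (qbin 0 k * (Q ^ n * \<beta>) ^ k))" for n k
  have less1: "norm (Q ^ n * w) < 1" if "norm w < 1" for n w
    using norm_Q_power_le[of n w] that by simp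
  have "(\<lambda>n. \<Sum>k. f n k) sums (\<Sum>k. \<Sum>n. f n k)"
  proof (rule suminf_swap_dominated)
    \<comment> \<open>The modulus of q^n \<beta> is at most that of \<beta>, which separates n from
      k in the majorant.\<close>
    show "norm (f n k) \<le> norm (qbin \<alpha> n * z ^ n) * (norm (qinf \<beta>) * norm (qbin 0 k * \<beta> ^ k))" for n k
    proof -
      have "norm ((Q ^ n * \<beta>) ^ k) \<le> norm (\<beta> ^ k)"
        unfolding norm_power by (intro power_mono norm_Q_power_le) auto
      then show ?thesis unfolding f_def norm_mult by (intro mult_left_mono) auto
    qed
    show "summable (\<lambda>n. norm (qbin \<alpha> n * z ^ n))" by (rule qbin_norm_summable[OF z])
    show "summable (\<lambda>k. norm (qinf \<beta>) * norm (qbin 0 k * \<beta> ^ k))"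
      by (intro summable_mult qbin_norm_summable \<beta>)
  qed auto
  moreover have "(\<Sum>k. f n k) = qbin \<alpha> n * qpoch \<beta> Q n * z ^ n" for n
  proof -
    have s: "summable (\<lambda>k. qbin 0 k * (Q ^ n * \<beta>) ^ k)"
      by (rule summable_norm_cancel[OF qbin_norm_summable[OF less1[OF \<beta>]]])
    have "(\<Sum>k. f n k) = qbin \<alpha> n * z ^ n * (qinf \<beta> * (\<Sum>k. qbin 0 k * (Q ^ n * \<beta>) ^ k))"
      unfolding f_def by (simp only: suminf_mult[OF s] suminf_mult[OF summable_mult[OF s]])
    also have "qinf \<beta> * (\<Sum>k. qbin 0 k * (Q ^ n * \<beta>) ^ k)
        = qpoch \<beta> Q n * (qinf (Q ^ n * \<beta>) * (\<Sum>k. qbin 0 k * (Q ^ n * \<beta>) ^ k))"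
      by (subst qinf_split[of \<beta> n]) (simp only: mult.assoc)
    also have "qinf (Q ^ n * \<beta>) * (\<Sum>k. qbin 0 k * (Q ^ n * \<beta>) ^ k) = 1"
      using q_binomial[OF less1[OF \<beta>, of n], of 0] by simp
    finally show ?thesis by (simp add: mult_ac)
  qed
  moreover have "(\<Sum>n. f n k) = qinf \<beta> * (qbin 0 k * \<beta> ^ k * (qinf (\<alpha> * (Q ^ k * z)) / qinf (Q ^ k * z)))" for k
  proof -
    have nz: "qinf (Q ^ k * z) \<noteq> 0" by (intro qinf_nonzero_small less1 z)
    have s: "summable (\<lambda>n. qbin \<alpha> n * (Q ^ k * z) ^ n)"
      by (rule summable_norm_cancel[OF qbin_norm_summable[OF less1[OF z]]])
    have "f n k = qinf \<beta> * (qbin 0 k * \<beta> ^ k) * (qbin \<alpha> n * (Q ^ k * z) ^ n)" for n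
      by (simp add: f_def power_mult_distrib power_mult[symmetric] mult_ac)
    then have "(\<Sum>n. f n k) = qinf \<beta> * (qbin 0 k * \<beta> ^ k) * (\<Sum>n. qbin \<alpha> n * (Q ^ k * z) ^ n)"
      by (simp only: suminf_mult[OF s])
    also have "(\<Sum>n. qbin \<alpha> n * (Q ^ k * z) ^ n) = qinf (\<alpha> * (Q ^ k * z)) / qinf (Q ^ k * z)"
      using q_binomial[OF less1[OF z, of k], of \<alpha>] nz by (simp add: field_simps)
    finally show ?thesis by (simp add: mult.assoc)
  qed
  moreover have ne: "Q ^ k * z \<noteq> 1" for k using less1[OF z, of k] by auto
  note h = heine_num_eq[OF \<beta> ne, of \<alpha>]
  ultimately show ?thesis by (simp only: suminf_mult[OF summable_norm_cancel[OF h(1)]] h(2))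
qed

lemma slit_not_q_power:
  assumes "z \<notin> \<real>\<^sub>\<ge>\<^sub>0"
  shows "Q ^ k * z \<noteq> 1"
proof
  assume "Q ^ k * z = 1"
  then have "z = 1 / Q ^ k" using q by (simp add: field_simps)
  then have "z = of_real (1 / q ^ k)" by simp
  then have "z \<in> \<real>\<^sub>\<ge>\<^sub>0" using q by (simp only: nonneg_Reals_of_real_iff) simp
  with assms show False ..
qed

lemma norm_q_powr: "norm (Q powr b) = q powr Re b"
  using q by (simp add: norm_powr_real_powr)

lemma norm_q_powr_less_1: "Re b > 0 \<Longrightarrow> norm (Q powr b) < 1"
  unfolding norm_q_powr using q by (simp add: powr_def mult_pos_neg)

lemma slit_divide: "x \<notin> \<real>\<^sub>\<ge>\<^sub>0 \<Longrightarrow> x / (1 - Q) \<notin> \<real>\<^sub>\<ge>\<^sub>0"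
proof
  assume "x \<notin> \<real>\<^sub>\<ge>\<^sub>0" "x / (1 - Q) \<in> \<real>\<^sub>\<ge>\<^sub>0"
  moreover have "(1 - Q) \<in> \<real>\<^sub>\<ge>\<^sub>0" using q by (simp add: complex_nonneg_Reals_iff)
  ultimately have "x / (1 - Q) * (1 - Q) \<in> \<real>\<^sub>\<ge>\<^sub>0" by (intro nonneg_Reals_mult_I)
  then show False using q \<open>x \<notin> \<real>\<^sub>\<ge>\<^sub>0\<close> by (simp add: divide_eq_0_iff)
qed

text \<open>Heine's transformation at \<alpha> = q^a, \<beta> = q^b, z = x / (1 - q). Positivity of
  Re b is the condition |\<beta>| < 1, and the zeros of the denominator lie on the positive
  axis.\<close>

lemma Phi_heine:
  assumes b: "Re b > 0"
  shows "Phi_regular a b q"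
    and "x \<notin> \<real>\<^sub>\<ge>\<^sub>0 \<Longrightarrow> Phi a b q x
      = heine_num (Q powr a) (Q powr b) (x / (1 - Q)) / qinf (x / (1 - Q))"
proof -
  define F where "F x = heine_num (Q powr a) (Q powr b) (x / (1 - Q)) / qinf (x / (1 - Q))" for x
  have Q1: "Q \<noteq> 1" using q by simp
  note \<beta> = norm_q_powr_less_1[OF b]
  have hol: "(\<lambda>x. heine_num (Q powr a) (Q powr b) (x / (1 - Q))) holomorphic_on UNIV"
    "(\<lambda>x. qinf (x / (1 - Q))) holomorphic_on UNIV"
    using Q1 by (auto intro!: holomorphic_intros
        holomorphic_on_compose_gen[OF _ heine_num_holomorphic[OF \<beta>], unfolded o_def]
        holomorphic_on_compose_gen[OF _ qinf_holomorphic, unfolded o_def])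
  then have ana: "(\<lambda>x. heine_num (Q powr a) (Q powr b) (x / (1 - Q))) analytic_on UNIV"
    "(\<lambda>x. qinf (x / (1 - Q))) analytic_on UNIV"
    by (auto simp: analytic_on_open)
  have "F meromorphic_on UNIV"
    unfolding F_def[abs_def] by (intro meromorphic_intros analytic_on_imp_meromorphic_on ana)
  moreover have "F has_fps_expansion Phi_fps a b q"
  proof (rule has_fps_expansionI)
    have "\<forall>\<^sub>F x in nhds 0. x \<in> ball (0::complex) (1 - q)"
      using q by (intro eventually_nhds_in_open) auto
    then show "\<forall>\<^sub>F x in nhds 0. (\<lambda>n. fps_nth (Phi_fps a b q) n * x ^ n) sums F x"
    proof eventually_elim
      case (elim x)
      have "norm (1 - Q) = 1 - q" using q by (metis abs_of_pos diff_gt_0_iff_gt norm_of_real of_real_1 of_real_diff)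
      then have "norm (x / (1 - Q)) < 1" using elim q by (simp add: norm_divide)
      from heine_sums[OF \<beta> this, of "Q powr a"] show ?case
        by (simp add: F_def Phi_fps_def qbin_def power_divide mult_ac)
    qed
  qed
  moreover have "F analytic_on - \<real>\<^sub>\<ge>\<^sub>0"
    unfolding F_def[abs_def]
    by (intro analytic_intros analytic_on_subset[OF ana(1)] analytic_on_subset[OF ana(2)] qinf_nonzero slit_not_q_power slit_divide) auto
  ultimately show "Phi_regular a b q"
    and "x \<notin> \<real>\<^sub>\<ge>\<^sub>0 \<Longrightarrow> Phi a b q x
      = heine_num (Q powr a) (Q powr b) (x / (1 - Q)) / qinf (x / (1 - Q))"
    using Phi_eqI unfolding F_def by blast+
qed

text \<open>The normalising denominator is the value at \<open>a = 0\<close>; in this form no limit of a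
  \<open>q\<close>-Gamma function is needed.\<close>
lemma Phi_ratio:
  assumes b: "Re b > 0" and x: "x \<notin> \<real>\<^sub>\<ge>\<^sub>0"
  defines "f \<equiv> \<lambda>a k. (Q powr b) ^ k * qinf (Q ^ Suc k) *
     (qinf (Q powr a * (Q ^ k * (x / (1 - Q)))) / qinf (Q ^ k * (x / (1 - Q))))"
  shows "summable (\<lambda>k. norm (f a k))" "Phi a b q x = suminf (f a) / suminf (f 0)"
proof -
  note \<beta> = norm_q_powr_less_1[OF b]
  define g where "g a k = qbin 0 k * (Q powr b) ^ k *
     (qinf (Q powr a * (Q ^ k * (x / (1 - Q)))) / qinf (Q ^ k * (x / (1 - Q))))" for a k
  have nQ: "qinf Q \<noteq> 0" using q by (intro qinf_nonzero_small) simp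
  \<comment> \<open>Since \<open>qbin 0 k\<close> is 1 / (q; q)_k, the coefficient becomes an
    infinite product, which will tend to an exponential.\<close>
  have "qinf (Q ^ Suc k) = qinf Q * qbin 0 k" for k
    using qinf_split[of Q k] qpoch_Q_nonzero[of k] by (simp add: qbin_def qpoch_def mult.commute)
  then have f: "f a k = qinf Q * g a k" for a k by (simp add: f_def g_def mult_ac)
  note h = heine_num_eq[OF \<beta> slit_not_q_power[OF slit_divide[OF x]]]
  have sg: "summable (\<lambda>k. norm (g a k))" for a unfolding g_def by (rule h(1))
  then show "summable (\<lambda>k. norm (f a k))" unfolding f norm_mult by (intro summable_mult) simp
  have sf: "suminf (f a) = qinf Q * suminf (g a)" for a
    unfolding f by (rule suminf_mult[OF summable_norm_cancel[OF sg]])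
  have Phi: "Phi a b q x = qinf (Q powr b) * suminf (g a)" for a
    using Phi_heine(2)[OF b x, of a] h(2)[of "Q powr a"] by (simp only: g_def[abs_def])
  \<comment> \<open>For a = 0 the quotient of products is 1, so the q-binomial theorem sums the
    series: the normalising sum is that of a function equal to 1.\<close>
  have "g 0 k = qbin 0 k * (Q powr b) ^ k" for k
    using qinf_nonzero[of "Q ^ k * (x / (1 - Q))"] slit_not_q_power[OF slit_divide[OF x]] q
    by (simp add: g_def mult.assoc[symmetric] power_add[symmetric])
  then have "g 0 = (\<lambda>k. qbin 0 k * (Q powr b) ^ k)" by (simp add: fun_eq_iff)
  then have one: "qinf (Q powr b) * suminf (g 0) = 1"
    using q_binomial[OF \<beta>, of 0] by simp
  then have "suminf (g 0) \<noteq> 0" by auto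
  with one show "Phi a b q x = suminf (f a) / suminf (f 0)"
    using nQ unfolding sf Phi by (simp add: field_simps)
qed

end

subsection \<open>Limits of infinite products\<close>

lemma Ln_one_plus_approx:
  fixes z :: complex
  assumes "norm z \<le> 1/2"
  shows "norm (Ln (1 + z) - z) \<le> 2 * (norm z)\<^sup>2"
proof -
  have "norm (Ln (1 + z) - z) \<le> (norm z)\<^sup>2 / (1 - norm z)"
    using assms by (intro Ln_approx_linear) auto
  also have "\<dots> \<le> (norm z)\<^sup>2 / (1/2)" using assms by (intro divide_left_mono) auto
  finally show ?thesis by simp
qed

lemma suminf_norm_diff_le:
  fixes f g :: "nat \<Rightarrow> complex"
  assumes fg: "\<And>j. norm (f j - g j) \<le> K * r ^ j" and r: "0 \<le> r" "r < 1" and g: "summable g"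
  shows "summable f" "norm (suminf f - suminf g) \<le> K / (1 - r)"
proof -
  have geo: "summable (\<lambda>j. K * r ^ j)" using r by (intro summable_mult summable_geometric) auto
  have n: "summable (\<lambda>j. norm (f j - g j))"
    by (rule summable_comparison_test'[OF geo]) (use fg in auto)
  have d: "summable (\<lambda>j. f j - g j)" by (rule summable_norm_cancel[OF n])
  from summable_add[OF d g] show f: "summable f" by simp
  have "norm (suminf f - suminf g) = norm (\<Sum>j. f j - g j)" by (simp add: suminf_diff[OF f g])
  also have "\<dots> \<le> (\<Sum>j. norm (f j - g j))" by (rule summable_norm[OF n])
  also have "\<dots> \<le> (\<Sum>j. K * r ^ j)" by (intro suminf_le fg n geo)
  also have "\<dots> = K / (1 - r)" using r by (simp add: suminf_mult summable_geometric suminf_geometric)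
  finally show "norm (suminf f - suminf g) \<le> K / (1 - r)" .
qed

text \<open>The error of each logarithm is quadratic, of order (1 - q)^2 q^(2j); summing over j
  costs one factor 1 / (1 - q), so an error of order 1 - q remains.\<close>

lemma log_sum_approx:
  fixes u :: "nat \<Rightarrow> complex" and q C :: real
  assumes q: "0 < q" "q < 1" and u: "\<And>j. norm (u j) \<le> C * (1 - q) * q ^ j"
    and small: "C * (1 - q) \<le> 1/2" and C: "C \<ge> 0"
  shows "summable u" "summable (\<lambda>j. Ln (1 + u j))"
    "norm ((\<Sum>j. Ln (1 + u j)) - suminf u) \<le> 2 * C\<^sup>2 * (1 - q)"
proof -
  show su: "summable u"
    by (rule summable_norm_cancel, rule summable_comparison_test'[where g = "\<lambda>j. C * (1 - q) * q ^ j"])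
       (use u q in \<open>auto intro!: summable_mult summable_geometric\<close>)
  have "norm (Ln (1 + u j) - u j) \<le> (2 * C\<^sup>2 * (1 - q)\<^sup>2) * q ^ j" for j
  proof -
    have qj: "q ^ j \<le> 1" "q ^ j \<ge> 0" using q by (auto intro: power_le_one)
    have "C * (1 - q) * q ^ j \<le> C * (1 - q) * 1" using qj C q by (intro mult_left_mono) auto
    then have "norm (u j) \<le> 1/2" using u[of j] small by linarith
    then have "norm (Ln (1 + u j) - u j) \<le> 2 * (norm (u j))\<^sup>2" by (rule Ln_one_plus_approx)
    also have "\<dots> \<le> 2 * (C * (1 - q) * q ^ j)\<^sup>2"
      using u[of j] by (intro mult_left_mono power_mono) auto
    also have "\<dots> = (2 * C\<^sup>2 * (1 - q)\<^sup>2) * (q ^ j * q ^ j)" by (simp add: power_mult_distrib power2_eq_square)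
    also have "\<dots> \<le> (2 * C\<^sup>2 * (1 - q)\<^sup>2) * (q ^ j * 1)"
      using qj by (intro mult_left_mono) auto
    finally show ?thesis by simp
  qed
  from suminf_norm_diff_le[OF this _ q(2) su] q
  show "summable (\<lambda>j. Ln (1 + u j))"
    and "norm ((\<Sum>j. Ln (1 + u j)) - suminf u) \<le> 2 * C\<^sup>2 * (1 - q)"
    by (auto simp: power2_eq_square)
qed

lemma mult_one_minus_tendsto_0:
  assumes "(qs \<longlonglongrightarrow> (1::real))"
  shows "(\<lambda>n. C * (1 - qs n)) \<longlonglongrightarrow> 0"
proof -
  have "(\<lambda>n. C * (1 - qs n)) \<longlonglongrightarrow> C * (1 - 1)" by (intro tendsto_intros assms)
  then show ?thesis by simp
qed

text \<open>Replacing the logarithm of each factor by its deviation from 1 costs O(1 - q) in total,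
  so the product behaves like the exponential of the sum of deviations. Both limits of q-products
  below are instances.\<close>

lemma infinite_product_limit:
  fixes u :: "nat \<Rightarrow> nat \<Rightarrow> complex" and qs :: "nat \<Rightarrow> real"
  assumes q: "\<And>n. 0 < qs n" "\<And>n. qs n < 1" "qs \<longlonglongrightarrow> 1"
    and u: "\<And>n j. norm (u n j) \<le> C * (1 - qs n) * qs n ^ j"
    and P: "\<And>n. (\<lambda>m. \<Prod>j<m. 1 + u n j) \<longlonglongrightarrow> P n"
    and L: "(\<lambda>n. \<Sum>j. u n j) \<longlonglongrightarrow> L"
  shows "P \<longlonglongrightarrow> exp L"
proof -
  have C: "C \<ge> 0"
    using order_trans[OF norm_ge_zero u[of 0 0]] q(2)[of 0] by (simp add: zero_le_mult_iff)
  have "\<forall>\<^sub>F n in sequentially. C * (1 - qs n) < 1/2"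
    by (rule order_tendstoD(2)[OF mult_one_minus_tendsto_0[OF q(3)]]) simp
  then have ev: "\<forall>\<^sub>F n in sequentially. C * (1 - qs n) \<le> 1/2" by eventually_elim simp
  define S where "S n = (\<Sum>j. Ln (1 + u n j))" for n
  have "(\<lambda>n. S n - suminf (u n)) \<longlonglongrightarrow> 0"
  proof (rule Lim_null_comparison)
    show "\<forall>\<^sub>F n in sequentially. norm (S n - suminf (u n)) \<le> 2 * C\<^sup>2 * (1 - qs n)"
      using ev by eventually_elim (use log_sum_approx(3)[OF q(1,2) u _ C] in \<open>auto simp: S_def\<close>)
  qed (rule mult_one_minus_tendsto_0[OF q(3)])
  from tendsto_add[OF this L] have "S \<longlonglongrightarrow> L" by simp
  then have "(\<lambda>n. exp (S n)) \<longlonglongrightarrow> exp L" by (rule tendsto_exp)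
  moreover have "\<forall>\<^sub>F n in sequentially. P n = exp (S n)"
    using ev
  proof eventually_elim
    case (elim n)
    \<comment> \<open>Deviations are eventually at most 1/2 in modulus, so no factor vanishes and
      each is the exponential of its logarithm.\<close>
    have "1 + u n j \<noteq> 0" for j
    proof
      assume "1 + u n j = 0"
      then have "norm (u n j) = 1" by (metis add_eq_0_iff norm_minus_cancel norm_one)
      moreover have "C * (1 - qs n) * qs n ^ j \<le> C * (1 - qs n) * 1"
        using C q(1,2)[of n] by (intro mult_left_mono power_le_one) auto
      ultimately show False using u[of n j] elim by linarith
    qed
    then have "(\<Prod>j<m. 1 + u n j) = exp (\<Sum>j<m. Ln (1 + u n j))" for m
      by (simp add: exp_sum)
    moreover have "(\<lambda>m. exp (\<Sum>j<m. Ln (1 + u n j))) \<longlonglongrightarrow> exp (S n)"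
      unfolding S_def by (intro tendsto_exp summable_LIMSEQ log_sum_approx(2)[OF q(1,2) u elim C])
    ultimately show ?case using P[of n] LIMSEQ_unique by auto
  qed
  ultimately show ?thesis by (simp add: tendsto_cong)
qed

text \<open>Arguments of two points in the same open half plane, upper or lower, or both on the
  positive axis, differ by less than pi, so the difference of principal logarithms is again
  principal.\<close>

lemma Ln_diff_eq:
  assumes "A \<noteq> 0" "B \<noteq> 0" "Im A > 0 \<and> Im B > 0 \<or> Im A < 0 \<and> Im B < 0 \<or> Im A = 0 \<and> Im B = 0 \<and> Re A > 0 \<and> Re B > 0"
  shows "Ln (B / A) = Ln B - Ln A"
proof (rule Ln_unique)
  have neg: "- pi < Im (Ln z) \<and> Im (Ln z) < 0" if "Im z < 0" for z
    using that mpi_less_Im_Ln[of z] Im_Ln_pos_le[of z] Im_Ln_le_pi[of z] by (cases "z = 0") auto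
  have "\<bar>Im (Ln B) - Im (Ln A)\<bar> < pi"
    using assms(3) neg[of A] neg[of B] Im_Ln_pos_lt_imp[of A] Im_Ln_pos_lt_imp[of B]
      Im_Ln_eq_0[OF assms(1)] Im_Ln_eq_0[OF assms(2)] by (auto simp: abs_less_iff)
  then show "- pi < Im (Ln B - Ln A)" "Im (Ln B - Ln A) \<le> pi" by auto
qed (use assms in \<open>simp add: exp_diff\<close>)

lemma ray_denominator_bound:
  assumes "ray_gap w \<ge> \<delta>" "\<delta> > 0" "0 \<le> s"
  shows "\<delta> * (1 + s * norm w) \<le> norm (1 - of_real s * w)"
  using ray_gap_bound_scale[OF assms(3), of w] mult_right_mono[OF assms(1), of "1 + s * norm w"] assms by simp

text \<open>The sum of \<open>v\<close> is a Jackson sum for the integral of w / (1 - t w) over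
  [0, 1], that is for -Ln(1 - w). Since 1 + v j is a quotient of consecutive values of 1 - q^j w,
  its logarithms telescope exactly to this value.\<close>

lemma geometric_log_sum:
  assumes q: "0 < q" "q < 1" and w: "w \<notin> \<real>\<^sub>\<ge>\<^sub>0" "ray_gap w \<ge> \<delta>" "\<delta> > 0" "norm w \<le> W"
    and small: "W / \<delta> * (1 - q) \<le> 1/2"
  defines "v \<equiv> \<lambda>j. of_real ((1 - q) * q ^ j) * w / (1 - of_real (q ^ j) * w)"
  shows "norm (suminf v + Ln (1 - w)) \<le> 2 * (W / \<delta>)\<^sup>2 * (1 - q)"
proof -
  have W: "W \<ge> 0" using w(4) norm_ge_zero order_trans by blast
  have den: "\<delta> \<le> norm (1 - of_real (q ^ j) * w)" for j
  proof -
    have "\<delta> * 1 \<le> \<delta> * (1 + q ^ j * norm w)" using w q by (intro mult_left_mono) auto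
    then show ?thesis using ray_denominator_bound[OF w(2,3), of "q ^ j"] q by simp
  qed
  have den0: "1 - of_real (q ^ j) * w \<noteq> 0" for j using den[of j] w(3) by auto
  have bound: "norm (v j) \<le> W / \<delta> * (1 - q) * q ^ j" for j
  proof -
    have "norm (v j) = (1 - q) * q ^ j * norm w / norm (1 - of_real (q ^ j) * w)"
      using q by (simp add: v_def norm_mult norm_divide del: of_real_mult of_real_power)
    also have "\<dots> \<le> (1 - q) * q ^ j * W / \<delta>"
      using den[of j] w q W by (intro frac_le mult_left_mono) auto
    finally show ?thesis by (simp add: mult_ac)
  qed
  have Wd: "W / \<delta> \<ge> 0" using W w by simp
  note approx = log_sum_approx[OF q bound small Wd]
  have step: "Ln (1 + v j) = Ln (1 - of_real (q ^ Suc j) * w) - Ln (1 - of_real (q ^ j) * w)" for j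
  proof -
    have "1 + v j = (1 - of_real (q ^ Suc j) * w) / (1 - of_real (q ^ j) * w)"
      using den0[of j] by (simp add: v_def field_simps)
    moreover have "Ln ((1 - of_real (q ^ Suc j) * w) / (1 - of_real (q ^ j) * w))
        = Ln (1 - of_real (q ^ Suc j) * w) - Ln (1 - of_real (q ^ j) * w)"
    proof (rule Ln_diff_eq[OF den0 den0])
      \<comment> \<open>The numbers 1 - c w with c > 0 share a half plane determined by the sign of
        Im w, or lie on the positive axis when w is negative.\<close>
      have sgn: "Im w < 0 \<Longrightarrow> Im (1 - of_real c * w) > 0" "Im w > 0 \<Longrightarrow> Im (1 - of_real c * w) < 0"
        "Im w = 0 \<Longrightarrow> Im (1 - of_real c * w) = 0" "Re w < 0 \<Longrightarrow> Re (1 - of_real c * w) > 0"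
        if "c > 0" for c :: real
        using that by (auto simp: mult_pos_neg intro: less_trans[OF mult_pos_neg zero_less_one])
      have "Im w < 0 \<or> Im w > 0 \<or> Im w = 0 \<and> Re w < 0"
        using w(1) by (auto simp: complex_nonneg_Reals_iff not_le)
      moreover have "q ^ j > 0" "q ^ Suc j > 0" using q by auto
      ultimately show "Im (1 - of_real (q ^ j) * w) > 0 \<and> Im (1 - of_real (q ^ Suc j) * w) > 0 \<or>
          Im (1 - of_real (q ^ j) * w) < 0 \<and> Im (1 - of_real (q ^ Suc j) * w) < 0 \<or>
          Im (1 - of_real (q ^ j) * w) = 0 \<and> Im (1 - of_real (q ^ Suc j) * w) = 0 \<and>
          Re (1 - of_real (q ^ j) * w) > 0 \<and> Re (1 - of_real (q ^ Suc j) * w) > 0"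
        using sgn by metis
    qed
    ultimately show ?thesis by simp
  qed
  have "(\<Sum>j<m. Ln (1 + v j)) = Ln (1 - of_real (q ^ m) * w) - Ln (1 - w)" for m
    by (induction m) (simp_all add: step del: power_Suc)
  moreover have "(\<lambda>m. Ln (1 - of_real (q ^ m) * w) - Ln (1 - w)) \<longlonglongrightarrow> Ln (1 - of_real 0 * w) - Ln (1 - w)"
    using q by (intro tendsto_intros LIMSEQ_power_zero) auto
  ultimately have "(\<Sum>j. Ln (1 + v j)) = - Ln (1 - w)"
    using summable_LIMSEQ[OF approx(2)] LIMSEQ_unique by fastforce
  then show ?thesis using approx(3) norm_minus_cancel[of "(\<Sum>j. Ln (1 + v j)) - suminf v"]
    by (simp add: norm_minus_commute add.commute)
qed

section \<open>Bounds and limits of q-products, uniform in q\<close>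

context q_base begin

text \<open>For y in [0, 1] every factor is nonnegative, and 1 - t <= exp(-t) with the geometric
  series gives the decay. This furnishes the exponential in the majorant of the Jackson
  sums.\<close>

lemma norm_qinf_real_le:
  assumes y: "0 \<le> y" "y \<le> 1"
  shows "norm (qinf (of_real y)) \<le> exp (- y / (1 - q))"
proof -
  have "(\<lambda>n. exp (- y * (\<Sum>k<n. q ^ k))) \<longlonglongrightarrow> exp (- y * (1 / (1 - q)))"
    using q sums_def[of "\<lambda>k. q ^ k"] geometric_sums[of q] by (intro tendsto_intros) auto
  moreover have "norm (qpoch (of_real y) Q n) \<le> exp (- y * (\<Sum>k<n. q ^ k))" for n
  proof -
    have "norm (qpoch (of_real y) Q n) = (\<Prod>k<n. norm (1 - Q ^ k * of_real y))"
      by (simp add: qpoch_def prod_norm)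
    also have "\<dots> \<le> (\<Prod>k<n. exp (- (y * q ^ k)))"
    proof (rule prod_mono, intro conjI)
      fix k
      have le: "q ^ k * y \<le> 1" using q y by (intro mult_le_one power_le_one) auto
      have "1 - Q ^ k * of_real y = of_real (1 - q ^ k * y)" by simp
      then have "norm (1 - Q ^ k * of_real y) = 1 - q ^ k * y"
        using le by (simp only: norm_of_real)
      also have "\<dots> \<le> exp (- (y * q ^ k))"
        using exp_ge_add_one_self[of "- (y * q ^ k)"] by (simp add: mult.commute)
      finally show "norm (1 - Q ^ k * of_real y) \<le> exp (- (y * q ^ k))" .
    qed simp
    also have "\<dots> = exp (- y * (\<Sum>k<n. q ^ k))"
      by (simp add: exp_sum[symmetric] sum_distrib_left sum_negf)
    finally show ?thesis .
  qed
  ultimately have "norm (qinf (of_real y)) \<le> exp (- y * (1 / (1 - q)))"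
    by (intro LIMSEQ_le[OF tendsto_norm[OF qpoch_LIMSEQ]]) auto
  then show ?thesis by simp
qed

text \<open>Each factor (1 - \<alpha> q^j w) / (1 - q^j w) is written as 1 plus a deviation
  proportional to 1 - \<alpha>, which is of order 1 - q for \<alpha> = q^a.\<close>

lemma qratio_factor:
  assumes "w \<notin> \<real>\<^sub>\<ge>\<^sub>0"
  shows "(\<lambda>m. \<Prod>j<m. 1 + (1 - \<alpha>) * (of_real (q ^ j) * w / (1 - of_real (q ^ j) * w)))
    \<longlonglongrightarrow> qinf (\<alpha> * w) / qinf w"
proof -
  have nz: "1 - Q ^ j * w \<noteq> 0" for j using slit_not_q_power[OF assms, of j] by simp
  have "(\<Prod>j<m. 1 + (1 - \<alpha>) * (of_real (q ^ j) * w / (1 - of_real (q ^ j) * w)))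
      = qpoch (\<alpha> * w) Q m / qpoch w Q m" for m
    unfolding qpoch_def prod_dividef[symmetric]
    by (intro prod.cong refl) (use nz in \<open>simp add: field_simps\<close>)
  moreover have "(\<lambda>m. qpoch (\<alpha> * w) Q m / qpoch w Q m) \<longlonglongrightarrow> qinf (\<alpha> * w) / qinf w"
    by (intro tendsto_intros qpoch_LIMSEQ qinf_nonzero slit_not_q_power assms)
  ultimately show ?thesis by simp
qed

text \<open>The ray bound reduces the j-th deviation to (A / \<delta>) (x - y) / x with x = 1 + q^j
  |w| and y = 1 + q^(j+1) |w|. Since (x - y) / x <= ln x - ln y, the sum telescopes to (A /
  \<delta>) ln(1 + |w|): a polynomial bound with no trace of q.\<close>

lemma norm_qratio_le:
  assumes w: "w \<notin> \<real>\<^sub>\<ge>\<^sub>0" "ray_gap w \<ge> \<delta>" "\<delta> > 0" and \<alpha>: "norm (1 - \<alpha>) \<le> A * (1 - q)"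
  shows "norm (qinf (\<alpha> * w) / qinf w) \<le> (1 + norm w) powr (A / \<delta>)"
proof (rule LIMSEQ_le_const2[OF tendsto_norm[OF qratio_factor[OF w(1)]]], intro exI allI impI)
  fix m
  have A: "A \<ge> 0" using order_trans[OF norm_ge_zero \<alpha>] q by (simp add: zero_le_mult_iff)
  define l where "l j = ln (1 + q ^ j * norm w)" for j
  have pos: "1 + q ^ j * norm w > 0" for j using q by (simp add: add_pos_nonneg)
  have factor: "norm (1 + (1 - \<alpha>) * (of_real (q ^ j) * w / (1 - of_real (q ^ j) * w)))
      \<le> exp (A / \<delta> * (l j - l (Suc j)))" for j
  proof -
    have den: "\<delta> * (1 + q ^ j * norm w) \<le> norm (1 - of_real (q ^ j) * w)"
      using q by (intro ray_denominator_bound w) auto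
    have "norm ((1 - \<alpha>) * (of_real (q ^ j) * w / (1 - of_real (q ^ j) * w)))
        = norm (1 - \<alpha>) * (q ^ j * norm w / norm (1 - of_real (q ^ j) * w))"
      using q by (simp add: norm_mult norm_divide norm_power)
    also have "\<dots> \<le> (A * (1 - q)) * (q ^ j * norm w / (\<delta> * (1 + q ^ j * norm w)))"
    proof (rule mult_mono[OF \<alpha> divide_left_mono[OF den]])
      have dp: "0 < \<delta> * (1 + q ^ j * norm w)" using w(3) pos[of j] by simp
      then show "0 < norm (1 - of_real (q ^ j) * w) * (\<delta> * (1 + q ^ j * norm w))"
        using less_le_trans[OF dp den] by (rule mult_pos_pos[rotated])
      show "0 \<le> A * (1 - q)" using A q by simp
    qed (use q in auto)
    also have "\<dots> = A / \<delta> * ((1 + q ^ j * norm w - (1 + q ^ Suc j * norm w)) / (1 + q ^ j * norm w))"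
      using w(3) pos[of j] by (simp add: field_simps)
    also have "\<dots> \<le> A / \<delta> * (l j - l (Suc j))"
    proof (rule mult_left_mono)
      have "(x - y) / x \<le> ln x - ln y" if "x > 0" "y > 0" for x y :: real
        using ln_le_minus_one[of "y / x"] that by (simp add: ln_div diff_divide_distrib)
      from this[OF pos pos] show "(1 + q ^ j * norm w - (1 + q ^ Suc j * norm w)) / (1 + q ^ j * norm w) \<le> l j - l (Suc j)"
        by (simp only: l_def)
    qed (use A w in auto)
    finally have "norm (1 + (1 - \<alpha>) * (of_real (q ^ j) * w / (1 - of_real (q ^ j) * w)))
        \<le> 1 + A / \<delta> * (l j - l (Suc j))"
      by (intro order_trans[OF norm_triangle_ineq]) simp
    also have "\<dots> \<le> exp (A / \<delta> * (l j - l (Suc j)))" by (rule exp_ge_add_one_self)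
    finally show ?thesis .
  qed
  have "norm (\<Prod>j<m. 1 + (1 - \<alpha>) * (of_real (q ^ j) * w / (1 - of_real (q ^ j) * w)))
      \<le> (\<Prod>j<m. exp (A / \<delta> * (l j - l (Suc j))))"
    unfolding prod_norm[symmetric] by (intro prod_mono conjI factor) auto
  also have "\<dots> = exp (A / \<delta> * (\<Sum>j<m. l j - l (Suc j)))"
    by (simp add: exp_sum[symmetric] sum_distrib_left)
  also have "(\<Sum>j<m. l j - l (Suc j)) = l 0 - l m" by (induction m) auto
  also have "exp (A / \<delta> * (l 0 - l m)) \<le> exp (A / \<delta> * l 0)"
  proof -
    have "l m \<ge> 0" using q by (simp add: l_def)
    then show ?thesis using A w(3) by (simp add: mult_left_mono divide_right_mono)
  qed
  also have "\<dots> = (1 + norm w) powr (A / \<delta>)"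
    using pos[of 0] by (simp add: l_def powr_def)
  finally show "norm (\<Prod>j<m. 1 + (1 - \<alpha>) * (of_real (q ^ j) * w / (1 - of_real (q ^ j) * w)))
      \<le> (1 + norm w) powr (A / \<delta>)" .
qed

end

text \<open>The quotient is a difference quotient of z^a at 1, where the derivative is a.\<close>

lemma one_minus_q_powr_at_left:
  "((\<lambda>q. (1 - of_real q powr a) / (1 - complex_of_real q)) \<longlongrightarrow> a) (at_left 1)"
proof -
  have "((\<lambda>z. z powr a) has_field_derivative a) (at (1::complex))"
    by (auto intro!: derivative_eq_intros)
  then have "((\<lambda>z. (z powr a - 1) / (z - 1)) \<longlongrightarrow> a) (at (1::complex))"
    by (simp add: has_field_derivative_iff)
  moreover have "filterlim complex_of_real (at 1) (at_left 1)"
    using tendsto_of_real[OF tendsto_ident_at, where 'a = complex, of 1 "{..<1}"]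
    by (auto simp: filterlim_at eventually_at_filter)
  ultimately have "((\<lambda>q. (of_real q powr a - 1) / (complex_of_real q - 1)) \<longlongrightarrow> a) (at_left 1)"
    by (rule filterlim_compose)
  moreover have "(of_real q powr a - 1) / (complex_of_real q - 1)
      = (1 - of_real q powr a) / (1 - complex_of_real q)" for q
    by (metis minus_diff_eq minus_divide_divide)
  ultimately show ?thesis by simp
qed

lemma one_minus_q_powr_limit:
  assumes "\<And>n. qs n < 1" "qs \<longlonglongrightarrow> 1"
  shows "(\<lambda>n. (1 - of_real (qs n) powr a) / (1 - complex_of_real (qs n))) \<longlonglongrightarrow> a"
proof -
  have "filterlim qs (at_left 1) sequentially"
    using assms by (auto simp: filterlim_at intro!: always_eventually less_imp_neq)
  then show ?thesis by (rule filterlim_compose[OF one_minus_q_powr_at_left])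
qed

text \<open>A q-analogue of exp(-s): the deviations form a geometric series with sum -q \<sigma>.
  The extra factor q reflects the argument q^(k+1) at the node q^k / (1 - q).\<close>

lemma qinf_exp_limit:
  assumes q: "\<And>n. 0 < qs n" "\<And>n. qs n < 1" "qs \<longlonglongrightarrow> 1" and \<sigma>: "\<And>n. \<sigma> n \<ge> 0" "\<sigma> \<longlonglongrightarrow> s"
  shows "(\<lambda>n. q_base.qinf (qs n) (of_real (qs n * (1 - qs n) * \<sigma> n))) \<longlonglongrightarrow> exp (- of_real s)"
proof -
  obtain K where K: "\<And>n. norm (\<sigma> n) \<le> K"
    using Bseq_def convergent_imp_Bseq[OF convergentI[OF \<sigma>(2)]] by blast
  have qb: "q_base (qs n)" for n using q by unfold_locales auto
  show ?thesis
  proof (rule infinite_product_limit[OF q, where C = K and u = "\<lambda>n j. - (of_real (qs n) ^ j * of_real (qs n * (1 - qs n) * \<sigma> n))"])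
    fix n j
    have "norm (- (of_real (qs n) ^ j * of_real (qs n * (1 - qs n) * \<sigma> n)) :: complex)
        = qs n ^ j * (qs n * (1 - qs n) * \<sigma> n)"
      using q(1,2)[of n] \<sigma>(1)[of n]
      by (simp add: norm_mult norm_power del: of_real_mult of_real_diff of_real_power)
    also have "\<dots> \<le> qs n ^ j * (1 * (1 - qs n) * K)"
      using q(1,2)[of n] \<sigma>(1)[of n] K[of n] by (intro mult_left_mono mult_mono) auto
    finally show "norm (- (of_real (qs n) ^ j * of_real (qs n * (1 - qs n) * \<sigma> n)) :: complex)
        \<le> K * (1 - qs n) * qs n ^ j" by (simp add: mult_ac)
  next
    fix n
    show "(\<lambda>m. \<Prod>j<m. 1 + - (of_real (qs n) ^ j * of_real (qs n * (1 - qs n) * \<sigma> n)))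
        \<longlonglongrightarrow> q_base.qinf (qs n) (of_real (qs n * (1 - qs n) * \<sigma> n))"
      using q_base.qpoch_LIMSEQ[OF qb[of n], of "of_real (qs n * (1 - qs n) * \<sigma> n)"] by (simp add: qpoch_def)
  next
    have "(\<Sum>j. - (complex_of_real (qs n) ^ j * of_real (qs n * (1 - qs n) * \<sigma> n))) = - of_real (qs n * \<sigma> n)" for n
    proof -
      have n1: "norm (complex_of_real (qs n)) < 1" using q(1,2)[of n] by simp
      have q1: "complex_of_real (qs n) \<noteq> 1" using q(2)[of n] by simp
      have "(\<lambda>j. - (complex_of_real (qs n) ^ j * of_real (qs n * (1 - qs n) * \<sigma> n))) sums
          - (1 / (1 - complex_of_real (qs n)) * of_real (qs n * (1 - qs n) * \<sigma> n))"
        by (intro sums_minus sums_mult2 geometric_sums n1)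
      moreover have "1 / (1 - complex_of_real (qs n)) * of_real (qs n * (1 - qs n) * \<sigma> n) = of_real (qs n * \<sigma> n)"
        using q1 by simp
      ultimately show ?thesis by (simp add: sums_iff)
    qed
    moreover have "(\<lambda>n. - complex_of_real (qs n * \<sigma> n)) \<longlonglongrightarrow> - of_real (1 * s)"
      by (intro tendsto_intros q \<sigma>)
    ultimately show "(\<lambda>n. \<Sum>j. - (complex_of_real (qs n) ^ j * of_real (qs n * (1 - qs n) * \<sigma> n))) \<longlonglongrightarrow> - of_real s"
      by simp
  qed
qed

text \<open>The q-analogue of the binomial (1 - w)^(-a): the deviations are
  \<open>c n * v n j\<close>, where \<open>c n\<close> tends to a and the sum of \<open>v n\<close>
  tends to -Ln(1 - w).\<close>

lemma qratio_limit:
  assumes q: "\<And>n. 0 < qs n" "\<And>n. qs n < 1" "qs \<longlonglongrightarrow> 1"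
    and ws: "\<And>n. ws n \<notin> \<real>\<^sub>\<ge>\<^sub>0" "\<And>n. ray_gap (ws n) \<ge> \<delta>" "\<delta> > 0" "ws \<longlonglongrightarrow> w" and w: "w \<notin> \<real>\<^sub>\<ge>\<^sub>0"
  shows "(\<lambda>n. q_base.qinf (qs n) (of_real (qs n) powr a * ws n) / q_base.qinf (qs n) (ws n)) \<longlonglongrightarrow> (1 - w) powr (- a)"
proof -
  obtain W where W: "\<And>n. norm (ws n) \<le> W"
    using Bseq_def convergent_imp_Bseq[OF convergentI[OF ws(4)]] by blast
  have W0: "W \<ge> 0" using W[of 0] norm_ge_zero order_trans by blast
  have lim_a: "(\<lambda>n. (1 - of_real (qs n) powr a) / (1 - complex_of_real (qs n))) \<longlonglongrightarrow> a"
    by (rule one_minus_q_powr_limit[OF q(2,3)])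
  then obtain A where A: "\<And>n. norm ((1 - of_real (qs n) powr a) / (1 - complex_of_real (qs n))) \<le> A"
    using convergent_imp_Bseq[OF convergentI[OF lim_a]] unfolding Bseq_def by blast
  have A0: "A \<ge> 0" using A[of 0] norm_ge_zero order_trans by blast
  have qb: "q_base (qs n)" for n using q by unfold_locales auto
  define v where "v n j = of_real ((1 - qs n) * qs n ^ j) * ws n / (1 - of_real (qs n ^ j) * ws n)" for n j
  define c where "c n = (1 - of_real (qs n) powr a) / (1 - complex_of_real (qs n))" for n
  have q1: "1 - complex_of_real (qs n) \<noteq> 0" for n using q(2)[of n] by simp
  have cv: "c n * v n j = (1 - of_real (qs n) powr a) * (of_real (qs n ^ j) * ws n / (1 - of_real (qs n ^ j) * ws n))" for n j
    using q1[of n] by (simp add: c_def v_def)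
  have v_bound: "norm (v n j) \<le> W / \<delta> * (1 - qs n) * qs n ^ j" for n j
  proof -
    have "\<delta> * 1 \<le> \<delta> * (1 + qs n ^ j * norm (ws n))"
      using ws(3) q(1)[of n] by (intro mult_left_mono) auto
    then have den: "\<delta> \<le> norm (1 - of_real (qs n ^ j) * ws n)"
      using ray_denominator_bound[OF ws(2)[of n] ws(3), of "qs n ^ j"] q(1)[of n] by simp
    have "norm (v n j) = (1 - qs n) * qs n ^ j * norm (ws n) / norm (1 - of_real (qs n ^ j) * ws n)"
      using q(1,2)[of n] by (simp add: v_def norm_mult norm_divide del: of_real_mult of_real_diff of_real_power)
    also have "\<dots> \<le> (1 - qs n) * qs n ^ j * W / \<delta>"
      using den W[of n] q(1,2)[of n] ws(3) W0 by (intro frac_le mult_left_mono mult_nonneg_nonneg) auto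
    finally show ?thesis by (simp add: mult_ac)
  qed
  have "(\<lambda>n. W / \<delta> * (1 - qs n)) \<longlonglongrightarrow> 0" by (rule mult_one_minus_tendsto_0[OF q(3)])
  then have "\<forall>\<^sub>F n in sequentially. W / \<delta> * (1 - qs n) < 1/2" by (rule order_tendstoD) simp
  then have ev: "\<forall>\<^sub>F n in sequentially. norm (suminf (v n) + Ln (1 - ws n)) \<le> 2 * (W / \<delta>)\<^sup>2 * (1 - qs n)"
  proof eventually_elim
    case (elim n)
    then show ?case
      using geometric_log_sum[OF q(1,2)[of n] ws(1,2)[of n] ws(3) W[of n]] unfolding v_def by (simp only: less_imp_le)
  qed
  have "(\<lambda>n. suminf (v n) + Ln (1 - ws n)) \<longlonglongrightarrow> 0"
    by (rule Lim_null_comparison[OF ev mult_one_minus_tendsto_0[OF q(3)]])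
  moreover have "1 - w \<notin> \<real>\<^sub>\<le>\<^sub>0" using slit_scale[OF w, of 1] by (simp add: cut_plane_def)
  then have "(\<lambda>n. Ln (1 - ws n)) \<longlonglongrightarrow> Ln (1 - w)" by (intro tendsto_intros ws) auto
  ultimately have "(\<lambda>n. suminf (v n) + Ln (1 - ws n) - Ln (1 - ws n)) \<longlonglongrightarrow> 0 - Ln (1 - w)"
    by (intro tendsto_diff)
  then have "(\<lambda>n. c n * suminf (v n)) \<longlonglongrightarrow> a * (- Ln (1 - w))"
    using lim_a unfolding c_def[symmetric] by (intro tendsto_mult) simp_all
  moreover have "c n * suminf (v n) = (\<Sum>j. c n * v n j)" for n
  proof -
    have "summable (v n)"
      by (rule summable_norm_cancel, rule summable_comparison_test'[where g = "\<lambda>j. W / \<delta> * (1 - qs n) * qs n ^ j"])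
         (use v_bound q(1,2)[of n] in \<open>auto intro!: summable_mult summable_geometric\<close>)
    then show ?thesis by (simp add: suminf_mult)
  qed
  ultimately have L: "(\<lambda>n. \<Sum>j. c n * v n j) \<longlonglongrightarrow> a * (- Ln (1 - w))" by simp
  have "(\<lambda>n. q_base.qinf (qs n) (of_real (qs n) powr a * ws n) / q_base.qinf (qs n) (ws n)) \<longlonglongrightarrow> exp (a * (- Ln (1 - w)))"
  proof (rule infinite_product_limit[OF q _ _ L, where C = "A * (W / \<delta>)"])
    show "norm (c n * v n j) \<le> A * (W / \<delta>) * (1 - qs n) * qs n ^ j" for n j
      using mult_mono[OF A[of n] v_bound[of n j] A0 norm_ge_zero] by (simp only: c_def norm_mult mult.assoc)
    show "(\<lambda>m. \<Prod>j<m. 1 + c n * v n j)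
        \<longlonglongrightarrow> q_base.qinf (qs n) (of_real (qs n) powr a * ws n) / q_base.qinf (qs n) (ws n)" for n
      unfolding cv by (rule q_base.qratio_factor[OF qb ws(1)])
  qed
  moreover have "1 - w \<noteq> 0" using \<open>1 - w \<notin> \<real>\<^sub>\<le>\<^sub>0\<close> by auto
  ultimately show ?thesis by (simp add: powr_def)
qed

section \<open>Jackson sums as integrals of step functions\<close>

definition jackson_step :: "(nat \<Rightarrow> real) \<Rightarrow> (nat \<Rightarrow> complex) \<Rightarrow> real \<Rightarrow> complex" where
  "jackson_step t v s = (\<Sum>k. indicator {t (Suc k)<..t k} s *\<^sub>R v k)"

text \<open>The intervals are disjoint, so one term survives. The map \<open>f\<close> is used as
  the identity, for the value, and as the norm, for absolute summability.\<close>

lemma jackson_step_sums: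
  fixes t :: "nat \<Rightarrow> real" and f :: "'b \<Rightarrow> 'a :: real_normed_vector"
  assumes t: "\<And>k. t (Suc k) \<le> t k" and s: "s \<in> {t (Suc k)<..t k}"
  shows "(\<lambda>j. indicator {t (Suc j)<..t j} s *\<^sub>R f (v j)) sums f (v k)"
proof -
  have mono: "t j \<le> t i" if "i \<le> j" for i j using lift_Suc_antimono_le[of t i j] t that by blast
  have "s \<notin> {t (Suc j)<..t j}" if "j \<noteq> k" for j
    using s mono[of "Suc j" k] mono[of "Suc k" j] that by (cases "j < k") auto
  then have "(\<lambda>j. indicator {t (Suc j)<..t j} s *\<^sub>R f (v j)) = (\<lambda>j. if j = k then f (v j) else 0)"
    using s by (auto simp: indicator_def fun_eq_iff)
  then show ?thesis using sums_single[of k "\<lambda>j. f (v j)"] by simp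
qed

lemma jackson_step_eq:
  assumes "\<And>k. t (Suc k) \<le> t k" "s \<in> {t (Suc k)<..t k}"
  shows "jackson_step t v s = v k"
  using jackson_step_sums[where t = t and f = "\<lambda>x. x" and v = v, OF assms] by (simp add: jackson_step_def sums_iff)

lemma jackson_step_outside:
  assumes "\<And>k. s \<notin> {t (Suc k)<..t k}"
  shows "jackson_step t v s = 0"
  using assms by (simp add: jackson_step_def)

lemma jackson_step_measurable: "jackson_step t v \<in> borel_measurable borel"
  unfolding jackson_step_def[abs_def] by measurable

text \<open>Termwise integration of indicators, legitimate by absolute summability of the weighted
  values. Sums with q-dependent nodes thus become integrals over one fixed space, open to dominated
  convergence.\<close>

lemma integral_jackson_step:
  assumes t: "\<And>k. t (Suc k) \<le> t k" and v: "summable (\<lambda>k. norm ((t k - t (Suc k)) *\<^sub>R v k))"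
  shows "(\<integral>s. jackson_step t v s \<partial>lborel) = (\<Sum>k. (t k - t (Suc k)) *\<^sub>R v k)"
proof -
  define f where "f k s = indicator {t (Suc k)<..t k} s *\<^sub>R v k" for k and s :: real
  have fint: "integrable lborel (f k)" for k
    unfolding f_def by (intro integrable_indicator) (auto simp: emeasure_lborel_Ioc t)
  have "(\<lambda>k. integral\<^sup>L lborel (f k)) sums (\<integral>s. (\<Sum>k. f k s) \<partial>lborel)"
  proof (rule sums_integral[OF fint])
    show "AE s in lborel. summable (\<lambda>k. norm (f k s))"
    proof (rule AE_I2)
      fix s :: real
      have n: "norm (f k s) = indicator {t (Suc k)<..t k} s *\<^sub>R norm (v k)" for k by (simp add: f_def)
      show "summable (\<lambda>k. norm (f k s))"
        unfolding n
      proof (cases "\<exists>k. s \<in> {t (Suc k)<..t k}")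
        case True
        then show "summable (\<lambda>k. indicator {t (Suc k)<..t k} s *\<^sub>R norm (v k))"
          using jackson_step_sums[where t = t and s = s and f = norm and v = v, OF t] sums_summable by blast
      next
        case False
        then have "(\<lambda>k. indicator {t (Suc k)<..t k} s *\<^sub>R norm (v k)) = (\<lambda>k. 0)"
          by (auto simp: indicator_def fun_eq_iff)
        then show "summable (\<lambda>k. indicator {t (Suc k)<..t k} s *\<^sub>R norm (v k))" by simp
      qed
    qed
    have "(\<integral>s. norm (f k s) \<partial>lborel) = norm ((t k - t (Suc k)) *\<^sub>R v k)" for k
      using t[of k] by (simp add: f_def[abs_def])
    then show "summable (\<lambda>k. \<integral>s. norm (f k s) \<partial>lborel)" using v by simp
  qed
  moreover have "integral\<^sup>L lborel (f k) = (t k - t (Suc k)) *\<^sub>R v k" for k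
    using t[of k] by (simp add: f_def[abs_def])
  ultimately show ?thesis by (simp add: f_def jackson_step_def sums_iff)
qed

subsection \<open>The integral representation in the limit\<close>

context q_base begin

text \<open>The points s for which s x runs through the arguments q^k x / (1 - q) of Heine's series;
  as q tends to 1 they reach out to infinity with relative mesh 1 - q.\<close>

definition heine_node :: "nat \<Rightarrow> real" where
  "heine_node k = q ^ k / (1 - q)"

text \<open>At a node the middle factor is \<open>qinf (Q ^ Suc k)\<close>. The exponent is b - 1
  because the length (1 - q) s of the interval below the node s supplies the missing power of
  s.\<close>

definition heine_value :: "complex \<Rightarrow> complex \<Rightarrow> complex \<Rightarrow> real \<Rightarrow> complex" where
  "heine_value a b x s = cpow (b - 1) s * qinf (of_real (q * (1 - q) * s)) *
     (qinf (Q powr a * (of_real s * x)) / qinf (of_real s * x))"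

definition heine_step :: "complex \<Rightarrow> complex \<Rightarrow> complex \<Rightarrow> real \<Rightarrow> complex" where
  "heine_step a b x = jackson_step heine_node (\<lambda>k. heine_value a b x (heine_node k))"

lemma heine_node_pos: "heine_node k > 0"
  using q by (simp add: heine_node_def)

lemma heine_node_Suc: "heine_node (Suc k) = q * heine_node k"
  by (simp add: heine_node_def)

lemma heine_node_antimono: "heine_node (Suc k) \<le> heine_node k"
  using q heine_node_pos[of k] by (simp add: heine_node_Suc mult_left_le_one_le)

lemma heine_node_diff: "heine_node k - heine_node (Suc k) = (1 - q) * heine_node k"
  by (simp add: heine_node_Suc algebra_simps)

text \<open>At each node, interval length times value is the Heine term times \<open>c\<close> = (1
  - q)^(1 - b). This constant depends on neither k nor a, so it cancels in the quotient.\<close>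

lemma Phi_eq_integral:
  assumes b: "Re b > 0" and x: "x \<notin> \<real>\<^sub>\<ge>\<^sub>0"
  shows "Phi a b q x = (\<integral>s. heine_step a b x s \<partial>lborel) / (\<integral>s. heine_step 0 b x s \<partial>lborel)"
proof -
  define f where "f a k = (Q powr b) ^ k * qinf (Q ^ Suc k) *
     (qinf (Q powr a * (Q ^ k * (x / (1 - Q)))) / qinf (Q ^ k * (x / (1 - Q))))" for a k
  define c where "c = of_real (1 - q) * cpow b (1 / (1 - q))"
  have c: "c \<noteq> 0" using q by (simp add: c_def cpow_def)
  have Qx: "of_real (heine_node k) * x = Q ^ k * (x / (1 - Q))" for k
    by (simp add: heine_node_def)
  have Qn: "of_real (q * (1 - q) * heine_node k) = Q ^ Suc k" for k
    using q by (simp add: heine_node_def)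
  have pw: "of_real (heine_node k) * cpow (b - 1) (heine_node k) = (Q powr b) ^ k * cpow b (1 / (1 - q))" for k
  proof -
    have "of_real (heine_node k) * cpow (b - 1) (heine_node k) = cpow (1 + (b - 1)) (heine_node k)"
      unfolding cpow_add using cpow_of_nat[OF heine_node_pos, of 1 k] by simp
    also have "\<dots> = cpow b (q ^ k) * cpow b (1 / (1 - q))"
      using cpow_mult[of "q ^ k" "1 / (1 - q)" b] q by (simp add: heine_node_def)
    also have "cpow b (q ^ k) = (Q powr b) ^ k"
      using q by (simp add: cpow_def powr_def Ln_of_real ln_realpow exp_of_nat_mult[symmetric] mult_ac)
    finally show ?thesis .
  qed
  have weighted: "(heine_node k - heine_node (Suc k)) *\<^sub>R heine_value a b x (heine_node k) = c * f a k" for a k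
  proof -
    have "(heine_node k - heine_node (Suc k)) *\<^sub>R heine_value a b x (heine_node k)
        = of_real (1 - q) * (of_real (heine_node k) * cpow (b - 1) (heine_node k)) *
          (qinf (of_real (q * (1 - q) * heine_node k)) *
          (qinf (Q powr a * (of_real (heine_node k) * x)) / qinf (of_real (heine_node k) * x)))"
      by (simp add: heine_node_diff heine_value_def scaleR_conv_of_real)
    also have "\<dots> = c * f a k"
      unfolding pw Qn Qx f_def c_def by (simp only: mult_ac)
    finally show ?thesis .
  qed
  have "(\<integral>s. heine_step a b x s \<partial>lborel) = (\<Sum>k. c * f a k)" for a
    unfolding heine_step_def weighted[symmetric]
    using Phi_ratio(1)[OF b x, of a, folded f_def]
    by (intro integral_jackson_step heine_node_antimono) (simp only: weighted norm_mult[of c] summable_mult)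
  moreover have "(\<Sum>k. c * f a k) = c * suminf (f a)" for a
    using summable_norm_cancel[OF Phi_ratio(1)[OF b x, of a, folded f_def]] by (rule suminf_mult)
  moreover have "Phi a b q x = suminf (f a) / suminf (f 0)"
    using Phi_ratio(2)[OF b x, of a] by (simp only: f_def[abs_def])
  ultimately show ?thesis using c by simp
qed

text \<open>The value at s is taken at the nearest node \<sigma> at or above s; the next node q
  \<sigma> lies below s, whence \<sigma> <= s / q. Beyond the largest node 1 / (1 - q) the step
  function is 0.\<close>

lemma heine_step_cases:
  assumes "s > 0"
  shows "s > 1 / (1 - q) \<and> heine_step a b x s = 0 \<or>
    (\<exists>\<sigma>. s \<le> \<sigma> \<and> \<sigma> \<le> s / q \<and> \<sigma> \<le> 1 / (1 - q) \<and> heine_step a b x s = heine_value a b x \<sigma>)"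
proof (cases "s > 1 / (1 - q)")
  case True
  have "heine_node k \<le> 1 / (1 - q)" for k
    using q power_le_one[of q k] by (simp add: heine_node_def divide_right_mono)
  then have "s \<notin> {heine_node (Suc k)<..heine_node k}" for k
    using True by (auto simp: not_le intro: le_less_trans)
  then show ?thesis using True by (auto simp: heine_step_def intro!: jackson_step_outside)
next
  case False
  have "(\<lambda>k. heine_node k) \<longlonglongrightarrow> 0 / (1 - q)"
    unfolding heine_node_def using q by (intro tendsto_intros LIMSEQ_power_zero) auto
  then have "\<forall>\<^sub>F k in sequentially. heine_node k < s"
    using assms by (intro order_tendstoD(2)) auto
  then obtain k0 where "heine_node k0 < s" by (auto simp: eventually_sequentially)
  define k where "k = (LEAST k. heine_node k < s)"
  have k: "heine_node k < s" unfolding k_def by (rule LeastI) fact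
  have "k \<noteq> 0"
  proof
    assume "k = 0"
    then show False using k False by (simp add: heine_node_def)
  qed
  then obtain m where m: "k = Suc m" by (cases k) auto
  have "\<not> heine_node m < s" using not_less_Least[of m "\<lambda>k. heine_node k < s"] m by (simp add: k_def)
  then have s: "s \<in> {heine_node (Suc m)<..heine_node m}" using k m by auto
  have "heine_step a b x s = heine_value a b x (heine_node m)"
    unfolding heine_step_def by (rule jackson_step_eq[OF heine_node_antimono s])
  moreover have "heine_node m \<le> s / q" using s q by (simp add: heine_node_Suc field_simps)
  moreover have "heine_node m \<le> 1 / (1 - q)"
    using q power_le_one[of q m] by (simp add: heine_node_def divide_right_mono)
  ultimately show ?thesis using s by auto
qed

lemma heine_step_nonpos:
  assumes "s \<le> 0"
  shows "heine_step a b x s = 0"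
proof -
  have "s \<notin> {heine_node (Suc k)<..heine_node k}" for k
    using assms heine_node_pos[of "Suc k"] by auto
  then show ?thesis by (auto simp: heine_step_def intro!: jackson_step_outside)
qed

text \<open>For q >= 1/2 the node satisfies s <= \<sigma> <= 2 s, which explains the factor 2 in the
  power and in the growth term and the halved decay rate. The condition \<sigma> <= 1 / (1 - q) puts
  q (1 - q) \<sigma> into [0, 1], where the real product decays.\<close>

lemma heine_value_bound:
  assumes q2: "1/2 \<le> q" and s: "s > 0" "s \<le> \<sigma>" "\<sigma> \<le> s / q" "\<sigma> \<le> 1 / (1 - q)"
    and x: "x \<notin> \<real>\<^sub>\<ge>\<^sub>0" "ray_gap x \<ge> \<delta>" "\<delta> > 0" "norm x \<le> W"
    and A: "norm (1 - Q powr a) \<le> A * (1 - q)"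
  shows "norm (heine_value a b x \<sigma>) \<le> 2 powr \<bar>Re b - 1\<bar> *
    (norm (cpow (of_real (Re b) - 1) s) * exp (- (1/2) * s) * (1 + 2 * W * s) powr (A / \<delta>))"
proof -
  have \<sigma>: "\<sigma> > 0" "\<sigma> \<le> 2 * s"
  proof -
    have "s / q \<le> s / (1/2)" using q2 s by (intro divide_left_mono) auto
    then show "\<sigma> > 0" "\<sigma> \<le> 2 * s" using s by auto
  qed
  have W: "W \<ge> 0" using x(4) norm_ge_zero order_trans by blast
  have A0: "A \<ge> 0" using order_trans[OF norm_ge_zero A] q by (simp add: zero_le_mult_iff)
  have 1: "norm (cpow (b - 1) \<sigma>) \<le> 2 powr \<bar>Re b - 1\<bar> * norm (cpow (of_real (Re b) - 1) s)"
  proof -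
    have "\<sigma> powr (Re b - 1) \<le> 2 powr \<bar>Re b - 1\<bar> * s powr (Re b - 1)"
    proof (cases "Re b \<ge> 1")
      case True
      then have "\<sigma> powr (Re b - 1) \<le> (2 * s) powr (Re b - 1)" using \<sigma> by (intro powr_mono2) auto
      then show ?thesis using True s by (simp add: powr_mult)
    next
      case False
      then have "\<sigma> powr (Re b - 1) \<le> s powr (Re b - 1)" using s \<sigma> by (intro powr_mono2') auto
      also have "\<dots> \<le> 2 powr \<bar>Re b - 1\<bar> * s powr (Re b - 1)"
        by (simp add: mult_le_cancel_right1 ge_one_powr_ge_zero)
      finally show ?thesis .
    qed
    then show ?thesis using s \<sigma> by (simp add: norm_cpow)
  qed
  have 2: "norm (qinf (of_real (q * (1 - q) * \<sigma>))) \<le> exp (- (1/2) * s)"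
  proof -
    have "(1 - q) * \<sigma> \<le> 1" using s q by (simp add: field_simps)
    then have "q * ((1 - q) * \<sigma>) \<le> 1" by (rule mult_le_one[rotated 2]) (use q \<sigma> in auto)
    then have "norm (qinf (of_real (q * (1 - q) * \<sigma>))) \<le> exp (- (q * (1 - q) * \<sigma>) / (1 - q))"
      using q \<sigma> by (intro norm_qinf_real_le) (auto simp: mult.assoc)
    also have "- (q * (1 - q) * \<sigma>) / (1 - q) = - (q * \<sigma>)" using q by simp
    also have "exp (- (q * \<sigma>)) \<le> exp (- (1/2) * s)"
    proof -
      have "1/2 * s \<le> q * \<sigma>" using q2 s \<sigma> by (intro mult_mono) auto
      then show ?thesis by simp
    qed
    finally show ?thesis .
  qed
  have 3: "norm (qinf (Q powr a * (of_real \<sigma> * x)) / qinf (of_real \<sigma> * x)) \<le> (1 + 2 * W * s) powr (A / \<delta>)"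
  proof -
    have "of_real \<sigma> * x \<notin> \<real>\<^sub>\<ge>\<^sub>0"
      using x(1) nonneg_Reals_divide_I[of "of_real \<sigma> * x" "of_real \<sigma>"] \<sigma> by auto
    then have "norm (qinf (Q powr a * (of_real \<sigma> * x)) / qinf (of_real \<sigma> * x)) \<le> (1 + norm (of_real \<sigma> * x)) powr (A / \<delta>)"
      using x \<sigma> A by (intro norm_qratio_le) (simp_all add: ray_gap_scale)
    also have "\<dots> \<le> (1 + 2 * W * s) powr (A / \<delta>)"
    proof (rule powr_mono2)
      have "\<sigma> * norm x \<le> 2 * s * W" using x \<sigma> s by (intro mult_mono) auto
      then show "1 + norm (of_real \<sigma> * x) \<le> 1 + 2 * W * s" using \<sigma> by (simp add: norm_mult mult_ac)
    qed (use A0 x in auto)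
    finally show ?thesis .
  qed
  have "norm (heine_value a b x \<sigma>) \<le> (2 powr \<bar>Re b - 1\<bar> * norm (cpow (of_real (Re b) - 1) s)) *
      exp (- (1/2) * s) * (1 + 2 * W * s) powr (A / \<delta>)"
    unfolding heine_value_def norm_mult[of _ "_ / _"] norm_mult[of "cpow _ _"]
    by (intro mult_mono 1 2 3) auto
  then show ?thesis by (simp only: mult.assoc)
qed

end

lemma heine_integral_limit:
  assumes b: "Re b > 0" and q: "\<And>n. 1/2 \<le> qs n" "\<And>n. qs n < 1" "qs \<longlonglongrightarrow> 1"
    and xs: "\<And>n. xs n \<notin> \<real>\<^sub>\<ge>\<^sub>0" "\<And>n. ray_gap (xs n) \<ge> \<delta>" "\<delta> > 0" "xs \<longlonglongrightarrow> x" and x: "x \<notin> \<real>\<^sub>\<ge>\<^sub>0"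
  shows "(\<lambda>n. \<integral>s. q_base.heine_step (qs n) a b (xs n) s \<partial>lborel)
    \<longlonglongrightarrow> (\<integral>s. gamma_weight b s * (1 - of_real s * x) powr (- a) \<partial>lborel)"
proof -
  have q0: "0 < qs n" for n using q(1)[of n] by linarith
  have qb: "q_base (qs n)" for n using q0 q(2) by unfold_locales auto
  obtain W where W: "\<And>n. norm (xs n) \<le> W"
    using convergent_imp_Bseq[OF convergentI[OF xs(4)]] unfolding Bseq_def by blast
  have W0: "W \<ge> 0" using W[of 0] norm_ge_zero order_trans by blast
  have lim_a: "(\<lambda>n. (1 - of_real (qs n) powr a) / (1 - complex_of_real (qs n))) \<longlonglongrightarrow> a"
    by (rule one_minus_q_powr_limit[OF q(2,3)])
  then obtain A where A: "\<And>n. norm ((1 - of_real (qs n) powr a) / (1 - complex_of_real (qs n))) \<le> A"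
    using convergent_imp_Bseq[OF convergentI[OF lim_a]] unfolding Bseq_def by blast
  have A0: "A \<ge> 0" using A[of 0] norm_ge_zero order_trans by blast
  have A': "norm (1 - of_real (qs n) powr a) \<le> A * (1 - qs n)" for n
  proof -
    have "norm (1 - complex_of_real (qs n)) = 1 - qs n"
      using q(2)[of n] norm_of_real[of "1 - qs n", where 'a = complex] by simp
    then show ?thesis using A[of n] q(2)[of n] by (simp add: norm_divide divide_le_eq)
  qed
  define D where "D s = 2 powr \<bar>Re b - 1\<bar> *
    (norm (cpow (of_real (Re b) - 1) s) * exp (- (1/2) * s) * (1 + 2 * W * s) powr (A / \<delta>))" for s
  show ?thesis
  proof (rule integral_dominated_convergence[where w = D])
    show "integrable lborel D"
      unfolding D_def by (intro integrable_mult_right integrable_power_exp_poly) (use b W0 A0 xs in auto)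
    show "(\<lambda>s. gamma_weight b s * (1 - of_real s * x) powr (- a)) \<in> borel_measurable lborel"
      by (rule gamma_weight_times_measurable[OF x])
    show "(\<lambda>s. q_base.heine_step (qs n) a b (xs n) s) \<in> borel_measurable lborel" for n
      using jackson_step_measurable by (simp add: q_base.heine_step_def[OF qb])
    show "AE s in lborel. norm (q_base.heine_step (qs n) a b (xs n) s) \<le> D s" for n
    proof (rule AE_I2)
      fix s :: real
      show "norm (q_base.heine_step (qs n) a b (xs n) s) \<le> D s"
      proof (cases "s > 0")
        case True
        have D: "D s \<ge> 0" by (simp add: D_def)
        from q_base.heine_step_cases[OF qb True, of n a b "xs n"] show ?thesis
        proof (elim disjE exE conjE)
          fix \<sigma> assume \<sigma>: "s \<le> \<sigma>" "\<sigma> \<le> s / qs n" "\<sigma> \<le> 1 / (1 - qs n)"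
            "q_base.heine_step (qs n) a b (xs n) s = q_base.heine_value (qs n) a b (xs n) \<sigma>"
          show ?thesis unfolding \<sigma>(4) D_def
            by (rule q_base.heine_value_bound[OF qb q(1) True \<sigma>(1,2,3) xs(1,2,3) W A'])
        qed (use D in simp)
      next
        case False
        then show ?thesis by (simp add: q_base.heine_step_nonpos[OF qb] D_def)
      qed
    qed
    show "AE s in lborel. (\<lambda>n. q_base.heine_step (qs n) a b (xs n) s)
        \<longlonglongrightarrow> gamma_weight b s * (1 - of_real s * x) powr (- a)"
    proof (rule AE_I2)
      fix s :: real
      show "(\<lambda>n. q_base.heine_step (qs n) a b (xs n) s) \<longlonglongrightarrow> gamma_weight b s * (1 - of_real s * x) powr (- a)"
      proof (cases "s > 0")
        case s: True
        \<comment> \<open>When s lies beyond the last node, \<sigma> = s serves as a placeholder;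
          this ends once 1 / (1 - q) exceeds s. The sandwich s <= \<sigma> <= s / q then gives
          \<sigma> -> s.\<close>
        have "\<exists>\<sigma>. s \<le> \<sigma> \<and> \<sigma> \<le> s / qs n \<and>
          (s \<le> 1 / (1 - qs n) \<longrightarrow> q_base.heine_step (qs n) a b (xs n) s = q_base.heine_value (qs n) a b (xs n) \<sigma>)" for n
        proof -
          have "s \<le> s / qs n" using s q0[of n] q(2)[of n] by (simp add: field_simps)
          then show ?thesis using q_base.heine_step_cases[OF qb s, of n a b "xs n"] by force
        qed
        then obtain \<sigma> where \<sigma>: "\<And>n. s \<le> \<sigma> n" "\<And>n. \<sigma> n \<le> s / qs n"
          "\<And>n. s \<le> 1 / (1 - qs n) \<Longrightarrow> q_base.heine_step (qs n) a b (xs n) s = q_base.heine_value (qs n) a b (xs n) (\<sigma> n)"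
          by metis
        have \<sigma>0: "\<sigma> n > 0" for n using \<sigma>(1)[of n] s by linarith
        have "(\<lambda>n. s / qs n) \<longlonglongrightarrow> s / 1" by (intro tendsto_intros q) auto
        then have lim\<sigma>: "\<sigma> \<longlonglongrightarrow> s"
          by (intro tendsto_sandwich[of "\<lambda>_. s" \<sigma> sequentially "\<lambda>n. s / qs n" s])
             (use \<sigma> in \<open>auto intro!: always_eventually\<close>)
        have sx: "of_real r * z \<notin> \<real>\<^sub>\<ge>\<^sub>0" if "z \<notin> \<real>\<^sub>\<ge>\<^sub>0" "r > 0" for r and z :: complex
          using that nonneg_Reals_divide_I[of "of_real r * z" "of_real r"] by auto
        have "isCont (cpow (b - 1)) s"
          using continuous_on_cpow[of "b - 1"] s by (simp add: continuous_on_eq_continuous_at)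
        then have "(\<lambda>n. cpow (b - 1) (\<sigma> n)) \<longlonglongrightarrow> cpow (b - 1) s"
          by (rule isCont_tendsto_compose[OF _ lim\<sigma>])
        moreover have "(\<lambda>n. q_base.qinf (qs n) (of_real (qs n * (1 - qs n) * \<sigma> n))) \<longlonglongrightarrow> exp (- of_real s)"
          by (rule qinf_exp_limit[OF q0 q(2,3) _ lim\<sigma>]) (use \<sigma>0 in \<open>simp add: less_imp_le\<close>)
        moreover have "(\<lambda>n. q_base.qinf (qs n) (of_real (qs n) powr a * (of_real (\<sigma> n) * xs n)) /
            q_base.qinf (qs n) (of_real (\<sigma> n) * xs n)) \<longlonglongrightarrow> (1 - of_real s * x) powr (- a)"
        proof (rule qratio_limit[OF q0 q(2,3)])
          show "(\<lambda>n. of_real (\<sigma> n) * xs n) \<longlonglongrightarrow> of_real s * x" by (intro tendsto_intros lim\<sigma> xs)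
          show "ray_gap (of_real (\<sigma> n) * xs n) \<ge> \<delta>" for n
            using xs(2)[of n] \<sigma>0[of n] by (simp add: ray_gap_scale)
        qed (use xs x sx s \<sigma>0 in auto)
        ultimately have "(\<lambda>n. q_base.heine_value (qs n) a b (xs n) (\<sigma> n))
            \<longlonglongrightarrow> cpow (b - 1) s * exp (- of_real s) * (1 - of_real s * x) powr (- a)"
          unfolding q_base.heine_value_def[OF qb] by (intro tendsto_mult)
        moreover have "\<forall>\<^sub>F n in sequentially. q_base.heine_value (qs n) a b (xs n) (\<sigma> n) = q_base.heine_step (qs n) a b (xs n) s"
        proof -
          have "\<forall>\<^sub>F n in sequentially. s * (1 - qs n) < 1"
            by (rule order_tendstoD(2)[OF mult_one_minus_tendsto_0[OF q(3)]]) simp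
          then show ?thesis
          proof eventually_elim
            case (elim n)
            then have "s \<le> 1 / (1 - qs n)" using q(2)[of n] by (simp add: field_simps)
            then show ?case using \<sigma>(3) by simp
          qed
        qed
        ultimately have "(\<lambda>n. q_base.heine_step (qs n) a b (xs n) s)
            \<longlonglongrightarrow> cpow (b - 1) s * exp (- of_real s) * (1 - of_real s * x) powr (- a)"
          by (rule Lim_transform_eventually)
        then show ?thesis by (simp add: gamma_weight_def exp_of_real[symmetric])
      next
        case False
        then show ?thesis by (simp add: q_base.heine_step_nonpos[OF qb])
      qed
    qed
  qed
qed

lemma Phi_tendsto_euler_integral:
  assumes b: "Re b > 0" and q: "\<And>n. 0 < qs n" "\<And>n. qs n < 1" "qs \<longlonglongrightarrow> 1"
    and xs: "xs \<longlonglongrightarrow> x" and x: "x \<notin> \<real>\<^sub>\<ge>\<^sub>0"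
  shows "(\<lambda>n. Phi a b (qs n) (xs n)) \<longlonglongrightarrow> euler_integral a b x"
proof -
  obtain r where r: "r > 0" "\<And>y. y \<in> ball x r \<Longrightarrow> y \<notin> \<real>\<^sub>\<ge>\<^sub>0" "\<And>y. y \<in> ball x r \<Longrightarrow> ray_gap y \<ge> ray_gap x / 2"
    using slit_neighbourhood[OF x] by metis
  have "\<forall>\<^sub>F n in sequentially. 1/2 < qs n" by (rule order_tendstoD(1)[OF q(3)]) simp
  moreover have "\<forall>\<^sub>F n in sequentially. xs n \<in> ball x r"
    using r by (intro topological_tendstoD[OF xs]) auto
  ultimately have "\<forall>\<^sub>F n in sequentially. 1/2 < qs n \<and> xs n \<in> ball x r" by eventually_elim simp
  \<comment> \<open>Discarding an initial segment secures q >= 1/2 and a common lower bound for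
    \<open>ray_gap\<close>, as the majorant requires.\<close>
  then obtain N where N: "\<And>n. n \<ge> N \<Longrightarrow> 1/2 < qs n \<and> xs n \<in> ball x r" by (auto simp: eventually_sequentially)
  have q': "1/2 \<le> qs (n + N)" "qs (n + N) < 1" and x': "xs (n + N) \<in> ball x r" for n
    using N[of "n + N"] q(2) by auto
  have lims: "(\<lambda>n. qs (n + N)) \<longlonglongrightarrow> 1" "(\<lambda>n. xs (n + N)) \<longlonglongrightarrow> x"
    using q(3) xs by (auto intro: LIMSEQ_ignore_initial_segment)
  have qb: "q_base (qs (n + N))" for n using q by unfold_locales auto
  have lim: "(\<lambda>n. \<integral>s. q_base.heine_step (qs (n + N)) a b (xs (n + N)) s \<partial>lborel)
    \<longlonglongrightarrow> (\<integral>s. gamma_weight b s * (1 - of_real s * x) powr (- a) \<partial>lborel)" for a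
    using ray_gap_pos[OF x]
    by (intro heine_integral_limit[where \<delta> = "ray_gap x / 2"] b q' lims x r(2,3) x') auto
  \<comment> \<open>At a = 0 the denominator tends to Gamma(b), the normalisation in
    \<open>euler_integral\<close>.\<close>
  have "gamma_weight b s * (1 - of_real s * x) powr (- 0) = gamma_weight b s" for s
  proof (cases "s > 0")
    case True
    then have "1 - of_real s * x \<noteq> 0" using slit_scale[OF x, of s] by (auto simp: cut_plane_def)
    then show ?thesis by simp
  qed simp
  then have G: "(\<integral>s. gamma_weight b s * (1 - of_real s * x) powr (- 0) \<partial>lborel) = Gamma b"
    by (simp only: integral_gamma_weight[OF b])
  have "(\<lambda>n. Phi a b (qs (n + N)) (xs (n + N))) \<longlonglongrightarrow>
    (\<integral>s. gamma_weight b s * (1 - of_real s * x) powr (- a) \<partial>lborel) /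
    (\<integral>s. gamma_weight b s * (1 - of_real s * x) powr (- 0) \<partial>lborel)"
    unfolding q_base.Phi_eq_integral[OF qb b r(2)[OF x']]
    by (intro tendsto_divide lim) (use G Gamma_nonzero[OF b] in simp)
  then have "(\<lambda>n. Phi a b (qs (n + N)) (xs (n + N))) \<longlonglongrightarrow> euler_integral a b x"
    unfolding G euler_integral_def .
  then show ?thesis by (rule LIMSEQ_offset)
qed

subsection \<open>Contiguous relations and the uniform limit\<close>

text \<open>Continuous convergence: x varies along with q, which encodes local uniformity while
  remaining sequential. Regularity is asked only near q = 1, since contiguous relations divide by
  coefficients known to be nonzero only there.\<close>

definition Phi_tendsto :: "complex \<Rightarrow> complex \<Rightarrow> (complex \<Rightarrow> complex) \<Rightarrow> bool" where
  "Phi_tendsto a b f \<longleftrightarrow> (\<forall>\<^sub>F q in at_left 1. Phi_regular a b q) \<and>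
     (\<forall>qs xs x. (\<forall>n. 0 < qs n \<and> qs n < 1) \<longrightarrow> qs \<longlonglongrightarrow> 1 \<longrightarrow> xs \<longlonglongrightarrow> x \<longrightarrow> x \<notin> \<real>\<^sub>\<ge>\<^sub>0 \<longrightarrow>
       (\<lambda>n. Phi a b (qs n) (xs n)) \<longlonglongrightarrow> f x)"

lemma Phi_tendstoD:
  assumes "Phi_tendsto a b f" "\<And>n. 0 < qs n" "\<And>n. qs n < 1" "qs \<longlonglongrightarrow> 1" "xs \<longlonglongrightarrow> x" "x \<notin> \<real>\<^sub>\<ge>\<^sub>0"
  shows "(\<lambda>n. Phi a b (qs n) (xs n)) \<longlonglongrightarrow> f x"
  using assms unfolding Phi_tendsto_def by simp

lemma eventually_q_base: "\<forall>\<^sub>F q in at_left 1. q_base q"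
proof -
  have "\<forall>\<^sub>F q in at_left (1::real). q \<in> {0<..<1}"
    by (rule eventually_at_leftI[of 0]) auto
  then show ?thesis by eventually_elim (unfold_locales, auto)
qed

lemma Phi_tendsto_euler:
  assumes "Re b > 0"
  shows "Phi_tendsto a b (euler_integral a b)"
  unfolding Phi_tendsto_def
proof (intro conjI allI impI)
  show "\<forall>\<^sub>F q in at_left 1. Phi_regular a b q"
    using eventually_q_base by eventually_elim (rule q_base.Phi_heine(1)[OF _ assms])
qed (rule Phi_tendsto_euler_integral[OF assms]; simp)

lemma Phi_tendsto_commute: "Phi_tendsto a b f \<Longrightarrow> Phi_tendsto b a f"
proof -
  have "Phi_fps a b = Phi_fps b a" by (simp add: Phi_fps_def fun_eq_iff mult.commute)
  then have "Phi a b = Phi b a" "Phi_regular a b = Phi_regular b a"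
    by (simp_all add: Phi_def[abs_def] Phi_regular_def[abs_def])
  then show "Phi_tendsto a b f \<Longrightarrow> Phi_tendsto b a f" by (simp add: Phi_tendsto_def)
qed

lemma Phi_tendsto_linear:
  assumes 1: "Phi_tendsto a1 b1 f1" and 2: "Phi_tendsto a2 b2 f2"
    and l: "(l \<longlongrightarrow> c1) (at_left 1)" and m: "(m \<longlongrightarrow> c2) (at_left 1)"
    and eq: "\<forall>\<^sub>F q in at_left 1. Phi_fps a b q = fps_const (l q) * Phi_fps a1 b1 q + fps_const (m q) * Phi_fps a2 b2 q"
  shows "Phi_tendsto a b (\<lambda>x. c1 * f1 x + c2 * f2 x)"
proof -
  have ev: "\<forall>\<^sub>F q in at_left 1. Phi_regular a b q \<and>
      (\<forall>x. x \<notin> \<real>\<^sub>\<ge>\<^sub>0 \<longrightarrow> Phi a b q x = l q * Phi a1 b1 q x + m q * Phi a2 b2 q x)"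
    using conjunct1[OF 1[unfolded Phi_tendsto_def]] conjunct1[OF 2[unfolded Phi_tendsto_def]] eq
    by eventually_elim (use Phi_linear in blast)
  have "(\<lambda>n. Phi a b (qs n) (xs n)) \<longlonglongrightarrow> c1 * f1 x + c2 * f2 x"
    if qs: "\<forall>n. 0 < qs n \<and> qs n < 1" "qs \<longlonglongrightarrow> 1" and xs: "xs \<longlonglongrightarrow> x" "x \<notin> \<real>\<^sub>\<ge>\<^sub>0" for qs xs x
  proof -
    have lim: "filterlim qs (at_left 1) sequentially"
      using qs by (auto simp: filterlim_at intro!: always_eventually less_imp_neq)
    have "\<forall>\<^sub>F n in sequentially. xs n \<in> - \<real>\<^sub>\<ge>\<^sub>0"
      using xs by (intro topological_tendstoD[OF xs(1)]) (auto simp: open_Compl)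
    then have "\<forall>\<^sub>F n in sequentially. l (qs n) * Phi a1 b1 (qs n) (xs n) + m (qs n) * Phi a2 b2 (qs n) (xs n)
        = Phi a b (qs n) (xs n)"
      using eventually_compose_filterlim[OF ev lim] by eventually_elim simp
    moreover have "(\<lambda>n. Phi a1 b1 (qs n) (xs n)) \<longlonglongrightarrow> f1 x" "(\<lambda>n. Phi a2 b2 (qs n) (xs n)) \<longlonglongrightarrow> f2 x"
      using Phi_tendstoD[OF 1 _ _ qs(2) xs] Phi_tendstoD[OF 2 _ _ qs(2) xs] qs(1) by simp_all
    then have "(\<lambda>n. l (qs n) * Phi a1 b1 (qs n) (xs n) + m (qs n) * Phi a2 b2 (qs n) (xs n)) \<longlonglongrightarrow> c1 * f1 x + c2 * f2 x"
      by (intro tendsto_intros filterlim_compose[OF l lim] filterlim_compose[OF m lim])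
    ultimately show ?thesis by (rule Lim_transform_eventually[rotated])
  qed
  then show ?thesis using ev unfolding Phi_tendsto_def by (auto elim: eventually_mono)
qed

section \<open>Contiguous relations and their q-analogues\<close>

lemma pochhammer_contiguous:
  fixes a b :: complex
  shows "(a - b) * (pochhammer a n * pochhammer b n)
    = a * (pochhammer (a + 1) n * pochhammer b n) - b * (pochhammer a n * pochhammer (b + 1) n)"
proof -
  have shift: "c * pochhammer (c + 1) n = (c + of_nat n) * pochhammer c n" for c :: complex
    using pochhammer_rec[of c n] pochhammer_rec'[of c n] by simp
  have "a * (pochhammer (a + 1) n * pochhammer b n) - b * (pochhammer a n * pochhammer (b + 1) n)
      = a * pochhammer (a + 1) n * pochhammer b n - pochhammer a n * (b * pochhammer (b + 1) n)" by simp
  also have "\<dots> = (a - b) * (pochhammer a n * pochhammer b n)"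
    unfolding shift by (simp add: algebra_simps)
  finally show ?thesis ..
qed

definition q_number :: "complex \<Rightarrow> real \<Rightarrow> complex" where
  "q_number a q = (1 - of_real q powr a) / (1 - of_real q)"

definition q_rising :: "complex \<Rightarrow> real \<Rightarrow> nat \<Rightarrow> complex" where
  "q_rising a q n = qpoch (of_real q powr a) (of_real q) n"

text \<open>Raising c by 1 multiplies (q^c; q)_n by (1 - q^c q^n) / (1 - q^c). The crossed weights
  q^b and q^a make the two terms in q^(a+b+n) cancel, leaving q^b - q^a free of n, just as (a + n) -
  (b + n) = a - b classically.\<close>

lemma q_rising_contiguous:
  assumes "q > 0"
  shows "(q_number a q - q_number b q) * (q_rising a q n * q_rising b q n)
    = of_real q powr b * q_number a q * (q_rising (a + 1) q n * q_rising b q n)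
      - of_real q powr a * q_number b q * (q_rising a q n * q_rising (b + 1) q n)"
proof -
  have shift: "q_number c q * q_rising (c + 1) q n
      = (1 - of_real q powr c * of_real q ^ n) * q_rising c q n / (1 - of_real q)" for c
  proof -
    have "complex_of_real q powr (c + 1) = of_real q * of_real q powr c"
      using assms by (simp add: powr_add)
    then have "(1 - of_real q powr c) * q_rising (c + 1) q n = (1 - of_real q powr c * of_real q ^ n) * q_rising c q n"
      using qpoch_Suc[of "of_real q powr c" "of_real q" n] qpoch_Suc'[of "of_real q powr c" "of_real q" n]
      by (simp add: q_rising_def mult.commute)
    then show ?thesis by (simp add: q_number_def)
  qed
  have "of_real q powr b * q_number a q * (q_rising (a + 1) q n * q_rising b q n)
      - of_real q powr a * q_number b q * (q_rising a q n * q_rising (b + 1) q n)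
      = of_real q powr b * (q_number a q * q_rising (a + 1) q n) * q_rising b q n
      - of_real q powr a * q_rising a q n * (q_number b q * q_rising (b + 1) q n)"
    by simp
  also have "\<dots> = (q_number a q - q_number b q) * (q_rising a q n * q_rising b q n)"
    unfolding shift by (simp add: q_number_def diff_divide_distrib[symmetric] algebra_simps)
  finally show ?thesis ..
qed

text \<open>\<open>\<Phi>\<close> and its limit together; both sides satisfy the contiguous relations below, which move
  the parameters out of the strip \<open>0 < Re b < 2\<close> where the integral representations hold.\<close>
definition Phi_resummed :: "complex \<Rightarrow> complex \<Rightarrow> bool" where
  "Phi_resummed a b \<longleftrightarrow> (\<exists>f. Phi_tendsto a b f \<and> borel_summable_to a b f)"

lemma Phi_resummed_commute: "Phi_resummed a b \<Longrightarrow> Phi_resummed b a"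
  unfolding Phi_resummed_def using Phi_tendsto_commute borel_summable_to_commute by blast

lemma Phi_resummed_strip: "0 < Re b \<Longrightarrow> Re b < 2 \<Longrightarrow> Phi_resummed a b"
  unfolding Phi_resummed_def using Phi_tendsto_euler borel_summable_to_euler by blast

text \<open>Dividing by the leading coefficient gives the same combination on both sides; its limit
  \<open>c0\<close> is nonzero, so the division is possible for q near 1.\<close>

lemma Phi_resummed_linear:
  assumes 1: "Phi_resummed a1 b1" and 2: "Phi_resummed a2 b2"
    and k: "(k0 \<longlongrightarrow> c0) (at_left 1)" "(k1 \<longlongrightarrow> c1) (at_left 1)" "(k2 \<longlongrightarrow> c2) (at_left 1)" and c0: "c0 \<noteq> 0"
    and rising: "\<And>q n. 0 < q \<Longrightarrow> k0 q * (q_rising a q n * q_rising b q n)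
      = k1 q * (q_rising a1 q n * q_rising b1 q n) + k2 q * (q_rising a2 q n * q_rising b2 q n)"
    and poch: "\<And>n. c0 * (pochhammer a n * pochhammer b n)
      = c1 * (pochhammer a1 n * pochhammer b1 n) + c2 * (pochhammer a2 n * pochhammer b2 n)"
  shows "Phi_resummed a b"
proof -
  obtain f1 f2 where f: "Phi_tendsto a1 b1 f1" "borel_summable_to a1 b1 f1"
    "Phi_tendsto a2 b2 f2" "borel_summable_to a2 b2 f2"
    using 1 2 unfolding Phi_resummed_def by blast
  have div: "X = k / l * Y + m / l * Z" if "l * X = k * Y + m * Z" "l \<noteq> 0" for k l m X Y Z :: complex
  proof -
    have "X = (l * X) / l" using that(2) by simp
    also have "\<dots> = k / l * Y + m / l * Z" unfolding that(1) by (simp add: add_divide_distrib)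
    finally show ?thesis .
  qed
  have "\<forall>\<^sub>F q in at_left 1. k0 q \<noteq> 0" by (rule tendsto_imp_eventually_ne[OF k(1) c0])
  then have "\<forall>\<^sub>F q in at_left 1. Phi_fps a b q
      = fps_const (k1 q / k0 q) * Phi_fps a1 b1 q + fps_const (k2 q / k0 q) * Phi_fps a2 b2 q"
    using eventually_q_base
  proof eventually_elim
    case (elim q)
    then have "q > 0" by (auto simp: q_base_def)
    have "fps_nth (Phi_fps a b q) n = fps_nth
        (fps_const (k1 q / k0 q) * Phi_fps a1 b1 q + fps_const (k2 q / k0 q) * Phi_fps a2 b2 q) n" for n
    proof -
      \<comment> \<open>The part of the n-th coefficient common to all parameters, so that an
        identity between the rising factors carries over.\<close>
      obtain w where w: "\<And>c d. fps_nth (Phi_fps c d q) n = q_rising c q n * q_rising d q n * w"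
        by (rule that[of "(1 / (1 - of_real q)) ^ n / qpoch (of_real q) (of_real q) n"])
           (simp add: Phi_fps_def q_rising_def)
      show ?thesis
        unfolding fps_add_nth fps_mult_left_const_nth w div[OF rising[OF \<open>q > 0\<close>] elim(1), of n]
        by (simp only: distrib_right mult.assoc)
    qed
    then show ?case by (rule fps_ext)
  qed
  then have "Phi_tendsto a b (\<lambda>x. c1 / c0 * f1 x + c2 / c0 * f2 x)"
    by (rule Phi_tendsto_linear[OF f(1,3) tendsto_divide[OF k(2,1) c0] tendsto_divide[OF k(3,1) c0]])
  moreover have "borel_summable_to a b (\<lambda>x. c1 / c0 * f1 x + c2 / c0 * f2 x)"
    by (intro borel_summable_to_linear[OF f(2,4)] div poch c0)
  ultimately show ?thesis unfolding Phi_resummed_def by blast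
qed

lemma q_powr_at_left: "((\<lambda>q. complex_of_real q powr a) \<longlongrightarrow> 1) (at_left 1)"
proof -
  have "((\<lambda>q. complex_of_real q powr a) \<longlongrightarrow> of_real 1 powr a) (at_left 1)"
    by (intro tendsto_intros) auto
  then show ?thesis by simp
qed

lemma q_number_at_left: "(q_number a \<longlongrightarrow> a) (at_left 1)"
  unfolding q_number_def[abs_def] by (rule one_minus_q_powr_at_left)

lemma q_coefficient_at_left: "((\<lambda>q. of_real q powr a * q_number b q) \<longlongrightarrow> b) (at_left 1)"
  using tendsto_mult[OF q_powr_at_left q_number_at_left] by simp

text \<open>The contiguous relation solved for the pair (a, b + 1); its leading coefficient tends to
  b.\<close>

lemma Phi_resummed_up:
  assumes "Phi_resummed (a + 1) b" "Phi_resummed a b" and b: "b \<noteq> 0"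
  shows "Phi_resummed a (b + 1)"
proof (rule Phi_resummed_linear[OF assms(1,2)])
  show "((\<lambda>q. of_real q powr a * q_number b q) \<longlongrightarrow> b) (at_left 1)"
    "((\<lambda>q. of_real q powr b * q_number a q) \<longlongrightarrow> a) (at_left 1)"
    "((\<lambda>q. q_number b q - q_number a q) \<longlongrightarrow> b - a) (at_left 1)"
    by (intro q_coefficient_at_left tendsto_diff q_number_at_left)+
  show "of_real q powr a * q_number b q * (q_rising a q n * q_rising (b + 1) q n)
      = of_real q powr b * q_number a q * (q_rising (a + 1) q n * q_rising b q n)
        + (q_number b q - q_number a q) * (q_rising a q n * q_rising b q n)" if "q > 0" for q n
    using q_rising_contiguous[OF that, of a b n] by (simp only: left_diff_distrib) (simp add: algebra_simps)
  show "b * (pochhammer a n * pochhammer (b + 1) n)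
      = a * (pochhammer (a + 1) n * pochhammer b n) + (b - a) * (pochhammer a n * pochhammer b n)" for n
    using pochhammer_contiguous[of a b n] by (simp only: left_diff_distrib) (simp add: algebra_simps)
qed (rule b)

text \<open>The contiguous relation solved for the pair (a, b); its leading coefficient tends to a -
  b.\<close>

lemma Phi_resummed_down:
  assumes "Phi_resummed (a + 1) b" "Phi_resummed a (b + 1)" and ab: "a \<noteq> b"
  shows "Phi_resummed a b"
proof (rule Phi_resummed_linear[OF assms(1,2)])
  show "((\<lambda>q. q_number a q - q_number b q) \<longlongrightarrow> a - b) (at_left 1)"
    "((\<lambda>q. of_real q powr b * q_number a q) \<longlongrightarrow> a) (at_left 1)"
    "((\<lambda>q. - (of_real q powr a * q_number b q)) \<longlongrightarrow> - b) (at_left 1)"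
    by (intro q_coefficient_at_left tendsto_diff tendsto_minus q_number_at_left)+
  show "(q_number a q - q_number b q) * (q_rising a q n * q_rising b q n)
      = of_real q powr b * q_number a q * (q_rising (a + 1) q n * q_rising b q n)
        + - (of_real q powr a * q_number b q) * (q_rising a q n * q_rising (b + 1) q n)" if "q > 0" for q n
    using q_rising_contiguous[OF that, of a b n] by (simp only: minus_mult_left[symmetric] add_uminus_conv_diff)
  show "(a - b) * (pochhammer a n * pochhammer b n)
      = a * (pochhammer (a + 1) n * pochhammer b n) + - b * (pochhammer a n * pochhammer (b + 1) n)" for n
    using pochhammer_contiguous[of a b n] by (simp only: minus_mult_left[symmetric] add_uminus_conv_diff)
qed (use ab in simp)

text \<open>If Re b >= 2, then b - 1 is nonzero with positive real part, and the upward relation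
  reaches b. It involves a and a + 1, so a stays arbitrary in the induction on a bound for Re
  b.\<close>

lemma Phi_resummed_Re_pos:
  assumes "Re b > 0"
  shows "Phi_resummed a b"
proof -
  have "Phi_resummed a b" if "Re b > 0" "Re b < of_nat n" for n a b
    using that
  proof (induction n arbitrary: a b)
    case (Suc n)
    show ?case
    proof (cases "Re b < 2")
      case False
      have "Phi_resummed c (b - 1)" for c
        by (rule Suc.IH) (use Suc.prems False in auto)
      from Phi_resummed_up[OF this this, of a] show ?thesis using False by fastforce
    qed (use Suc.prems Phi_resummed_strip in auto)
  qed simp
  then show ?thesis using assms reals_Archimedean2[of "Re b"] by blast
qed

text \<open>The downward relation reduces to pairs for which Re a + Re b is larger by 1. Once that
  sum is positive, a or b has positive real part, and symmetry covers either case. Integer shifts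
  preserve a - b outside the integers, so no division by 0 occurs.\<close>

lemma Phi_resummed_generic:
  assumes "a - b \<notin> \<int>"
  shows "Phi_resummed a b"
proof -
  have "Phi_resummed a b" if "a - b \<notin> \<int>" "- (Re a + Re b) < of_nat n" for n a b
    using that
  proof (induction n arbitrary: a b)
    case 0
    then have "Re a > 0 \<or> Re b > 0" by auto
    then show ?case using Phi_resummed_Re_pos Phi_resummed_commute by blast
  next
    case (Suc n)
    have "a - b = (a + 1 - b) - 1" "a - b = (a - (b + 1)) + 1" by simp_all
    then have "a + 1 - b \<notin> \<int>" "a - (b + 1) \<notin> \<int>"
      using Suc.prems(1) by (metis Ints_1 Ints_diff, metis Ints_1 Ints_add)
    then have "Phi_resummed (a + 1) b" "Phi_resummed a (b + 1)"
      using Suc.prems(2) by (auto intro!: Suc.IH)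
    moreover have "a \<noteq> b" using Suc.prems(1) by auto
    ultimately show ?case by (rule Phi_resummed_down)
  qed
  then show ?thesis using assms reals_Archimedean2[of "- (Re a + Re b)"] by blast
qed

section \<open>From continuous convergence to uniform convergence on compacts\<close>

lemma one_minus_inverse_Suc_limit: "(\<lambda>n. 1 - 1 / real (n + 2)) \<longlonglongrightarrow> 1"
proof -
  have "(\<lambda>n. 1 / real (n + 2)) \<longlonglongrightarrow> 0"
    using LIMSEQ_ignore_initial_segment[OF lim_1_over_n, of 2] by simp
  then have "(\<lambda>n. 1 - 1 / real (n + 2)) \<longlonglongrightarrow> 1 - 0" by (intro tendsto_intros)
  then show ?thesis by simp
qed

text \<open>Continuous convergence: the sequential form of \<open>Phi_tendsto\<close> forces the limit to be continuous.\<close>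
lemma Phi_tendsto_continuous:
  assumes f: "Phi_tendsto a b f" and ys: "ys \<longlonglongrightarrow> l" "\<And>n. ys n \<notin> \<real>\<^sub>\<ge>\<^sub>0" "l \<notin> \<real>\<^sub>\<ge>\<^sub>0"
  shows "(\<lambda>n. f (ys n)) \<longlonglongrightarrow> f l"
proof -
  \<comment> \<open>A diagonal choice: q = 1 - 1 / (k + 2) is close enough to 1 for the point
    \<open>ys n\<close>, with k >= n so that q tends to 1. The shift by 2 keeps q strictly between 0
    and 1.\<close>
  have "\<exists>k\<ge>n. dist (Phi a b (1 - 1 / real (k + 2)) (ys n)) (f (ys n)) < 1 / real (n + 1)" for n
  proof -
    have "(\<lambda>k. Phi a b (1 - 1 / real (k + 2)) (ys n)) \<longlonglongrightarrow> f (ys n)"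
      by (rule Phi_tendstoD[OF f _ _ one_minus_inverse_Suc_limit tendsto_const ys(2)]) simp_all
    then have "\<forall>\<^sub>F k in sequentially. dist (Phi a b (1 - 1 / real (k + 2)) (ys n)) (f (ys n)) < 1 / real (n + 1)"
      by (rule tendstoD) simp
    then obtain N where N: "\<And>k. k \<ge> N \<Longrightarrow> dist (Phi a b (1 - 1 / real (k + 2)) (ys n)) (f (ys n)) < 1 / real (n + 1)"
      by (auto simp: eventually_sequentially)
    then show ?thesis by (intro exI[of _ "max n N"]) auto
  qed
  then obtain k where k: "\<And>n. k n \<ge> n"
    "\<And>n. dist (Phi a b (1 - 1 / real (k n + 2)) (ys n)) (f (ys n)) < 1 / real (n + 1)" by metis
  have "filterlim k at_top sequentially"
    by (rule filterlim_at_top_mono[OF filterlim_ident]) (use k(1) in auto)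
  then have "(\<lambda>n. 1 - 1 / real (k n + 2)) \<longlonglongrightarrow> 1"
    by (rule filterlim_compose[OF one_minus_inverse_Suc_limit])
  from Phi_tendstoD[OF f _ _ this ys(1,3)] have 1: "(\<lambda>n. Phi a b (1 - 1 / real (k n + 2)) (ys n)) \<longlonglongrightarrow> f l" by simp
  have "(\<lambda>n. f (ys n) - Phi a b (1 - 1 / real (k n + 2)) (ys n)) \<longlonglongrightarrow> 0"
  proof (rule Lim_null_comparison)
    show "\<forall>\<^sub>F n in sequentially. norm (f (ys n) - Phi a b (1 - 1 / real (k n + 2)) (ys n)) \<le> 1 / real (n + 1)"
      using k(2) by (auto intro!: always_eventually simp: dist_norm norm_minus_commute less_imp_le)
    show "(\<lambda>n. 1 / real (n + 1)) \<longlonglongrightarrow> 0"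
      using LIMSEQ_ignore_initial_segment[OF lim_1_over_n, of 1] by simp
  qed
  from tendsto_add[OF this 1] show ?thesis by simp
qed

text \<open>Failure of uniformity yields q_n -> 1 and x_n in K with distance at least e. Along a
  subsequence converging to l in K, \<open>Phi\<close> tends to f l by continuous convergence and f
  to f l by continuity, a contradiction.\<close>

lemma Phi_tendsto_uniform:
  assumes f: "Phi_tendsto a b f" and K: "compact K" "K \<inter> \<real>\<^sub>\<ge>\<^sub>0 = {}"
  shows "uniform_limit K (\<lambda>q x. Phi a b q x) f (at_left 1)"
  unfolding uniform_limit_iff
proof (intro allI impI, rule ccontr)
  fix e :: real assume e: "e > 0" and "\<not> (\<forall>\<^sub>F q in at_left 1. \<forall>x\<in>K. dist (Phi a b q x) (f x) < e)"
  then have freq: "\<exists>\<^sub>F q in at_left 1. \<exists>x\<in>K. dist (Phi a b q x) (f x) \<ge> e"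
    by (simp add: frequently_def not_le)
  have "\<exists>q x. 1 - 1 / real (n + 2) < q \<and> q < 1 \<and> x \<in> K \<and> dist (Phi a b q x) (f x) \<ge> e" for n
  proof -
    have "\<forall>\<^sub>F q in at_left (1::real). q \<in> {1 - 1 / real (n + 2)<..<1}"
      by (rule eventually_at_leftI[of "1 - 1 / real (n + 2)"]) auto
    from frequently_ex[OF frequently_eventually_frequently[OF freq this]] show ?thesis by auto
  qed
  then obtain qs xs where qs: "\<And>n. 1 - 1 / real (n + 2) < qs n" "\<And>n. qs n < 1"
    and xs: "\<And>n. xs n \<in> K" and far: "\<And>n. dist (Phi a b (qs n) (xs n)) (f (xs n)) \<ge> e" by metis
  have q0: "0 < qs n" for n
  proof -
    have "1 / real (n + 2) \<le> 1" by simp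
    then show ?thesis using qs(1)[of n] by linarith
  qed
  have lim: "qs \<longlonglongrightarrow> 1"
    by (rule tendsto_sandwich[OF _ _ one_minus_inverse_Suc_limit tendsto_const])
       (use qs in \<open>auto intro!: always_eventually less_imp_le\<close>)
  obtain l r where l: "l \<in> K" "strict_mono r" "(xs \<circ> r) \<longlonglongrightarrow> l"
    using K(1) xs unfolding compact_def by metis
  have not: "y \<notin> \<real>\<^sub>\<ge>\<^sub>0" if "y \<in> K" for y using that K(2) by auto
  have "(\<lambda>n. Phi a b (qs (r n)) (xs (r n))) \<longlonglongrightarrow> f l"
    using LIMSEQ_subseq_LIMSEQ[OF lim l(2)] l(3) unfolding o_def
    by (intro Phi_tendstoD[OF f] q0 qs(2) not[OF l(1)])
  moreover have "(\<lambda>n. f (xs (r n))) \<longlonglongrightarrow> f l"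
    by (rule Phi_tendsto_continuous[OF f]) (use l not xs in \<open>auto simp: o_def\<close>)
  ultimately have "(\<lambda>n. dist (Phi a b (qs (r n)) (xs (r n))) (f (xs (r n)))) \<longlonglongrightarrow> dist (f l) (f l)"
    by (rule tendsto_dist)
  then have "\<forall>\<^sub>F n in sequentially. dist (Phi a b (qs (r n)) (xs (r n))) (f (xs (r n))) < e"
    using e by (intro order_tendstoD(2)) auto
  then obtain n where "dist (Phi a b (qs (r n)) (xs (r n))) (f (xs (r n))) < e"
    by (auto simp: eventually_sequentially)
  then show False using far[of "r n"] by simp
qed

theorem corollary3:
  fixes a b :: complex and d :: real and K :: "complex set"
  assumes "a - b \<notin> \<int>"
    and "0 < d" and "d < 2 * pi"
    and "compact K" and "K \<subseteq> sector d"
  shows "uniform_limit K (\<lambda>q x. Phi a b q x) (\<lambda>x. borel_sum d (hyp2F0_fps a b) x) (at_left 1)"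
proof -
  obtain f where f: "Phi_tendsto a b f" "borel_summable_to a b f"
    using Phi_resummed_generic[OF assms(1)] unfolding Phi_resummed_def by blast
  have "K \<inter> \<real>\<^sub>\<ge>\<^sub>0 = {}" using assms(5) sector_not_nonneg by blast
  then have "uniform_limit K (\<lambda>q x. Phi a b q x) f (at_left 1)"
    by (rule Phi_tendsto_uniform[OF f(1) assms(4)])
  also have "?this \<longleftrightarrow> ?thesis"
    using assms(5) borel_sum_eq[OF f(2) assms(2,3)]
    by (intro uniform_limit_cong') (auto simp: subset_iff)
  finally show ?thesis .
qed

end
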